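(* Let $\Delta\subset\mathfrak d^*$ be an $n$-dimensional convex polytope with chosen inward-pointing normals $X_1,\dots,X_d$ and quasilattice $Q$ containing them, let $M=\Psi^{-1}(0)/N$ be the associated space, with the action of the quasitorus $D=\mathfrak d/Q$ and the mapping $\Phi\colon M\to\mathfrak d^*$, decomposed into the singular pieces $\mathcal T_F$ ($F$ a singular face of $\Delta$) and the regular piece $\mathcal T_\Delta$, each a symplectic quasifold as described in the context. Then the restriction of the $D$-action and of the mapping $\Phi$ to each piece of $M$ is smooth, the action of $D$ on each piece is Hamiltonian, and a moment mapping is given by the restriction of $\Phi$.
   Context: **The space $M$.** Let $\mathfrak d$ be a real vector space of dimension $n$ and $\Delta\subset\mathfrak d^*$ an $n$-dimensional convex polytope, $\Delta=\bigcap_{j=1}^d\{\mu\in\mathfrak d^*\mid\langle\mu,X_j\rangle\ge\lambda_j\}$, where $X_1,\dots,X_d\in\mathfrak d$ are inward-pointing normals, one for each codimension-$1$ face, and $\lambda_j\in\mathbb R$. A quasilattice in $\mathfrak d$ is the $\mathbb Z$-span of a finite set of $\mathbb R$-spanning vectors; $Q$ is a quasilattice containing all $X_j$; $D=\mathfrak d/Q$ is the quasitorus (a group and a quasifold with the single chart $\mathfrak d/Q$). Let $\pi\colon\mathbb R^d\to\mathfrak d$ be linear with $\pi(e_j)=X_j$. Let $T^d=\mathbb R^d/\mathbb Z^d$ act on $\mathbb C^d$ by $\exp(x)\cdot\underline z=(e^{2\pi i x_j}z_j)_j$, where $\exp\colon\mathbb R^d\to T^d$ is the quotient map. Let $N$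 be the kernel of the homomorphism $T^d\to\mathfrak d/Q$ induced by $\pi$, so $T^d/N\cong D$; the Lie algebra of $N$ is $\mathfrak n=\ker\pi$, with inclusion $\iota\colon\mathfrak n\to\mathbb R^d$. Let $\Upsilon(\underline z)=\sum_j(|z_j|^2+\lambda_j)e_j^*$, $\Psi=\iota^*\circ\Upsilon\colon\mathbb C^d\to\mathfrak n^*$, and $M=\Psi^{-1}(0)/N$ with the quotient topology and projection $p\colon\Psi^{-1}(0)\to M$. $D$ acts on $M$ via $T^d/N\cong D$, and $\Phi\colon M\to\mathfrak d^*$ is defined by $\pi^*(\Phi([\underline z]))=\Upsilon(\underline z)$. The standard symplectic form $\omega_0$ of $\mathbb C^d$ is normalized so that $\Upsilon$ is a moment mapping for the $T^d$-action (e.g. $\omega_0=\frac{1}{2\pi i}\sum_j dz_j\wedge d\bar z_j$ with the convention $\iota(X)\omega_0=d\langle\Upsilon,X\rangle$). **Faces and pieces.** An open face is $F=\{\mu\in\Delta\mid\langle\mu,X_j\rangle=\lambda_j\text{ iff }j\in I_F\}$, $I_F\subset\{1,\dots,d\}$, $r_F=\mathrm{card}(I_F)$; a $p$-dimensional face is singular if $r_F>n-p$ and nonsingular if $r_F=n-p$ (the interior of $\Delta$ is nonsingular). For $J\subset\{1,\dots,d\}$ and $\mathbb K\subset\mathbb C$, $\mathbb K^J=\{\underline z\in\mathbb C^d\mid z_j\in\mathbb K\text{ if }j\in J,\ z_j=0\text{ if }j\notin J\}$; $T^J=\{a\in T^d\mid a_j=1\text{ if }j\notin J\}$; $J^c$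 is the complement; $F^c$ stands for $I_F^c$. The pieces are $\mathcal T_F=\Phi^{-1}(F)=(\Psi^{-1}(0)\cap(\mathbb C^* )^{F^c})/N$ for $F$ singular and $\mathcal T_\Delta=\Psi^{-1}(0)_\Delta/N$, with $\Psi^{-1}(0)_\Delta=\bigcup_{F\text{ nonsing.}}(\Psi^{-1}(0)\cap(\mathbb C^* )^{F^c})$. **Quasifolds.** A model of dimension $k$ is a quotient $\tilde U/\Gamma$, where $\tilde U$ is a connected, simply connected $k$-manifold and $\Gamma$ is a discrete (possibly infinite) group acting smoothly on $\tilde U$ so that the set of points where the action is free is connected and dense. If $\tilde U$ is not simply connected but the rest holds, $\tilde U/\Gamma$ is regarded as a model by replacing $\tilde U$ with its universal cover $U^\sharp$ and $\Gamma$ with the group $\Lambda$ of diffeomorphisms of $U^\sharp$ covering the action of some element of $\Gamma$. An open subset $W\subset\tilde U/\Gamma$ is a submodel if $W$ together with its preimage in $\tilde U$ defines a model in this way. A map of models is smooth if it lifts to a smooth map of the covering manifolds, and is a diffeomorphism of models if it is bijective and the lift is a diffeomorphism. A $k$-dimensional quasifold is a topological space with a maximal atlas of charts $(U_\alpha,\phi_\alpha,\tilde U_\alpha/\Gamma_\alpha)$: the $U_\alpha$ are an open cover, $\tilde U_\alpha\subset\mathbb R^k$ is open, connected and simply connected, $\tilde U_\alpha/\Gamma_\alpha$ is a model, $\phi_\alpha\colon\tilde U_\alpha/\Gamma_\alpha\to U_\alpha$ is a homeomorphism, and on overlaps the preimages are submodels and $\phi_\beta^{-1}\circ\phi_\alpha$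 is a diffeomorphism of models. A continuous map between quasifolds is smooth if around each point and its image there are charts in which it is given by a smooth mapping of models. Products of quasifolds are quasifolds via products of charts; a manifold is a quasifold with trivial groups. **Quasifold structure on the pieces.** Let $\mathcal I_\mu$, for $\mu$ a vertex, be the set of $I\subset I_\mu$ such that $\{X_j\}_{j\in I}$ is a basis of $\mathfrak d$, and $\mathcal I=\bigcup_\mu\mathcal I_\mu$. For $I\in\mathcal I$ define $a_{hk}$ by $X_k=\sum_{h\in I}a_{hk}X_h$, and let $\Gamma_I=N\cap T^I$, a discrete group. For $I\in\mathcal I_\mu$ let $\tilde U_I$ be the set of $\underline u\in\mathbb C^I$ with $\sum_{h\in I}a_{hk}|u_h|^2>0$ for $k\in I_\mu\setminus I$ and $\sum_{h\in I}a_{hr}(|u_h|^2+\lambda_h)-\lambda_r>0$ for $r\notin I_\mu$; let $F_I(\underline u)\in(\mathbb R_{>0})^{I^c}$ have components the positive square roots of these expressions. The atlas of $\mathcal T_\Delta$ is generated by the charts $\tilde U_I/\Gamma_I\to(\Psi^{-1}(0)\cap(\mathbb C^I\times(\mathbb C^* )^{I^c}))/N$, $[\underline u]\mapsto[\underline u+F_I(\underline u)]$, $I\in\mathcal I$. For a singular vertex $\mu$, $\mathcal T_\mu$ is a point. For a singular $F$ of dimension $p>0$, choose a vertex $\mu\in\overline F$ and $I\in\mathcal I_\mu$ with $\mathrm{card}(I\cap I_F)=n-p$; let $\check\Gamma_{I\setminus(I\cap I_F)}$ be the image of $\Gamma_I$ under the projection $T^I\to T^{I\setminus(I\cap I_F)}$,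 and $\check U_{F,I}$ the set of $\underline w\in(\mathbb C^* )^{I\setminus(I\cap I_F)}$ with $\sum_{h\in I\setminus(I\cap I_F)}a_{hl}|w_h|^2>0$ for $l\in I_\mu\setminus(I\cup I_F)$ and $\sum_{h\in I\cap I_F}a_{hr}\lambda_h+\sum_{h\in I\setminus(I\cap I_F)}a_{hr}(|w_h|^2+\lambda_h)-\lambda_r>0$ for $r\notin I_\mu$. The atlas of $\mathcal T_F$ is generated by the chart $\check U_{F,I}/\check\Gamma_{I\setminus(I\cap I_F)}\to\mathcal T_F$, $[\underline w]\mapsto[\underline w+\check\phi_{F,I}(\underline w)]$, where $\check\phi_{F,I}(\underline w)$ has zero components for indices in $I\cup I_F$ and the other components are the positive square roots of the expressions just listed. (Any of the domains $\tilde U_I$, $\check U_{F,I}$ that is not simply connected is replaced by its universal cover, and the group $\Gamma_I$, respectively $\check\Gamma_{I\setminus(I\cap I_F)}$, acting on it is replaced by the group of diffeomorphisms of the universal cover covering the action of some element of that group.) **Symplectic structure.** A differential form on a quasifold is given by a $\Gamma_\alpha$-invariant form $\tilde\omega_\alpha$ on $\tilde U_\alpha$ for each chart, compatible (via the lifts) with changes of charts; it is symplectic if each $\tilde\omega_\alpha$ is symplectic. Each piece carries the symplectic form whose pull-back via $p$ (defined through local smooth lifts of $p$ to charts) is the restriction of $\omega_0$ to $\Psi^{-1}(0)\cap(\mathbb C^* )^{F^c}$, respectively to $\Psi^{-1}(0)_\Delta$. **Hamiltonian actions.** A smooth action of $D$ on a quasifold $T$ is an action $D\times T\to T$ that is a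 smooth mapping. For $X\in\mathfrak d$ the fundamental vector field $X_T$ is given in charts by the vector field on $\tilde U_\alpha$ obtained by differentiating at $t=0$ the local lifts of $t\mapsto[tX]\cdot(\,\cdot\,)$ that are the identity at $t=0$. If $(T,\omega)$ is a symplectic quasifold, the action is Hamiltonian with moment mapping $\Phi_T\colon T\to\mathfrak d^*$ if it preserves $\omega$, $\Phi_T$ is smooth and $D$-invariant, and $\iota(X_T)\omega=d\langle\Phi_T,X\rangle$ for all $X\in\mathfrak d$ (same sign convention as for $\Upsilon$). *)

theory Defs
  imports "HOL-Analysis.Analysis" "HOL-Algebra.Bij"
begin

section \<open>Smooth maps and differential forms on subsets of Euclidean spaces\<close>

primrec Ck_on :: "nat \<Rightarrow> 'a::euclidean_space set \<Rightarrow> ('a \<Rightarrow> 'b::real_normed_vector) \<Rightarrow> bool" where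
  "Ck_on 0 W f \<longleftrightarrow> continuous_on W f"
| "Ck_on (Suc k) W f \<longleftrightarrow>
     f differentiable_on W \<and> (\<forall>v. Ck_on k W (\<lambda>x. frechet_derivative f (at x) v))"

text \<open>
  \<^const>\<open>Ck_on\<close> is meant for open sets.  On an arbitrary subset, smooth means: locally the
  restriction of a smooth map defined on an open set of the ambient space.  On relatively open
  subsets of linear subspaces and on submanifolds this is the usual notion.
\<close>

definition smooth_on :: "'a::euclidean_space set \<Rightarrow> ('a \<Rightarrow> 'b::real_normed_vector) \<Rightarrow> bool" where
  "smooth_on S f \<longleftrightarrow>
     (\<forall>x\<in>S. \<exists>W g. open W \<and> x \<in> W \<and> (\<forall>k. Ck_on k W g) \<and> (\<forall>y\<in>S \<inter> W. g y = f y))"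

definition diffeo :: "'a::euclidean_space set \<Rightarrow> 'b::euclidean_space set \<Rightarrow> ('a \<Rightarrow> 'b) \<Rightarrow> bool" where
  "diffeo S T f \<longleftrightarrow> bij_betw f S T \<and> smooth_on S f \<and> smooth_on T (inv_into S f)"

definition tangent_space :: "'a::euclidean_space set \<Rightarrow> 'a \<Rightarrow> 'a set" where
  "tangent_space S x =
     {v. \<exists>e>0. \<exists>c :: real \<Rightarrow> 'a. smooth_on {-e<..<e} c \<and> c ` {-e<..<e} \<subseteq> S \<and> c 0 = x \<and>
           (c has_vector_derivative v) (at 0)}"

text \<open>
  \<open>pulls_back f S \<omega> \<eta>\<close>: on \<open>S\<close>, the pull-back of the 2-form \<open>\<omega>\<close> under \<open>f\<close> is \<open>\<eta>\<close>.
  If \<open>S\<close> is lower-dimensional the derivative within \<open>S\<close> is not unique as a linear map on the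
  ambient space, but its restriction to tangent vectors of \<open>S\<close> is.
\<close>

type_synonym 'e two_form = "'e \<Rightarrow> 'e \<Rightarrow> 'e \<Rightarrow> real"

definition pulls_back ::
  "('a::euclidean_space \<Rightarrow> 'b::euclidean_space) \<Rightarrow> 'a set \<Rightarrow> 'b two_form \<Rightarrow> 'a two_form \<Rightarrow> bool" where
  "pulls_back f S \<omega> \<eta> \<longleftrightarrow>
     (\<forall>x\<in>S. \<forall>f'. (f has_derivative f') (at x within S) \<longrightarrow>
        (\<forall>v\<in>tangent_space S x. \<forall>w\<in>tangent_space S x. \<omega> (f x) (f' v) (f' w) = \<eta> x v w))"

text \<open>
  The remaining definitions of this section are for a nonempty relatively open subset \<open>U\<close> of a
  linear subspace of \<open>'e\<close>; that subspace is then \<open>span U\<close>, the tangent space at every point.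
\<close>

definition two_form_on :: "'e::euclidean_space set \<Rightarrow> 'e two_form \<Rightarrow> bool" where
  "two_form_on U \<omega> \<longleftrightarrow>
     (\<forall>x\<in>U. \<forall>u\<in>span U. \<forall>v\<in>span U. \<forall>w\<in>span U. \<forall>r.
        \<omega> x (u + v) w = \<omega> x u w + \<omega> x v w \<and>
        \<omega> x (r *\<^sub>R u) w = r * \<omega> x u w \<and>
        \<omega> x u w = - \<omega> x w u) \<and>
     (\<forall>v\<in>span U. \<forall>w\<in>span U. smooth_on U (\<lambda>x. \<omega> x v w))"

definition dir_deriv :: "('e::euclidean_space \<Rightarrow> real) \<Rightarrow> 'e \<Rightarrow> 'e \<Rightarrow> real" where
  "dir_deriv g x u = vector_derivative (\<lambda>t. g (x + t *\<^sub>R u)) (at 0)"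

definition closed_form_on :: "'e::euclidean_space set \<Rightarrow> 'e two_form \<Rightarrow> bool" where
  "closed_form_on U \<omega> \<longleftrightarrow>
     (\<forall>x\<in>U. \<forall>u\<in>span U. \<forall>v\<in>span U. \<forall>w\<in>span U.
        dir_deriv (\<lambda>y. \<omega> y v w) x u - dir_deriv (\<lambda>y. \<omega> y u w) x v
          + dir_deriv (\<lambda>y. \<omega> y u v) x w = 0)"

definition nondegenerate_on :: "'e::euclidean_space set \<Rightarrow> 'e two_form \<Rightarrow> bool" where
  "nondegenerate_on U \<omega> \<longleftrightarrow>
     (\<forall>x\<in>U. \<forall>v\<in>span U. (\<forall>w\<in>span U. \<omega> x v w = 0) \<longrightarrow> v = 0)"


section \<open>Quotient topologies and universal covers\<close>

definition quotient_top :: "'a::topological_space set \<Rightarrow> ('a \<Rightarrow> 'b) \<Rightarrow> 'b topology" where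
  "quotient_top S q = topology (\<lambda>U. U \<subseteq> q ` S \<and> openin (top_of_set S) {x\<in>S. q x \<in> U})"

lemma openin_quotient_top:
  "openin (quotient_top S q) U \<longleftrightarrow> U \<subseteq> q ` S \<and> openin (top_of_set S) {x\<in>S. q x \<in> U}"
proof -
  let ?L = "\<lambda>U. U \<subseteq> q ` S \<and> openin (top_of_set S) {x\<in>S. q x \<in> U}"
  have "istopology ?L"
    unfolding istopology_def
  proof (intro conjI allI impI)
    fix A B assume A: "?L A" and B: "?L B"
    show "A \<inter> B \<subseteq> q ` S" using A by blast
    have "{x\<in>S. q x \<in> A \<inter> B} = {x\<in>S. q x \<in> A} \<inter> {x\<in>S. q x \<in> B}" by blast
    then show "openin (top_of_set S) {x\<in>S. q x \<in> A \<inter> B}"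
      using openin_Int[of "top_of_set S" "{x\<in>S. q x \<in> A}" "{x\<in>S. q x \<in> B}"] A B by simp
  next
    fix K assume K: "\<forall>U\<in>K. ?L U"
    show "\<Union>K \<subseteq> q ` S" using K by blast
    have "{x\<in>S. q x \<in> \<Union>K} = (\<Union>U\<in>K. {x\<in>S. q x \<in> U})" by blast
    moreover have "openin (top_of_set S) (\<Union>U\<in>K. {x\<in>S. q x \<in> U})"
      using K by (intro openin_Union) auto
    ultimately show "openin (top_of_set S) {x\<in>S. q x \<in> \<Union>K}" by simp
  qed
  then show ?thesis
    unfolding quotient_top_def by (simp only: topology_inverse')
qed

text \<open>
  The universal cover of a connected, locally simply connected set \<open>W\<close>, as the space of homotopy
  classes (with fixed end points) of paths in \<open>W\<close> issuing from a base point.  For \<open>W\<close> relatively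
  open in a subspace, its smooth structure is the one that makes the end-point projection
  \<open>ucover_proj\<close> a local diffeomorphism.
\<close>

definition base_point :: "'e set \<Rightarrow> 'e" where
  "base_point W = (SOME x. x \<in> W)"

definition path_class :: "'e::topological_space set \<Rightarrow> (real \<Rightarrow> 'e) \<Rightarrow> (real \<Rightarrow> 'e) set" where
  "path_class W g = {h. homotopic_paths W g h}"

definition based_paths :: "'e::topological_space set \<Rightarrow> (real \<Rightarrow> 'e) set" where
  "based_paths W = {g. path g \<and> path_image g \<subseteq> W \<and> pathstart g = base_point W}"

definition ucover :: "'e::topological_space set \<Rightarrow> (real \<Rightarrow> 'e) set set" where
  "ucover W = path_class W ` based_paths W"

definition ucover_proj :: "(real \<Rightarrow> 'e::topological_space) set \<Rightarrow> 'e" where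
  "ucover_proj C = pathfinish (SOME g. g \<in> C)"

definition ucover_top :: "'e::real_normed_vector set \<Rightarrow> (real \<Rightarrow> 'e) set topology" where
  "ucover_top W = topology_generated_by
     {{path_class W (g +++ h) | h. path h \<and> path_image h \<subseteq> B \<and> pathstart h = pathfinish g} | g B.
        g \<in> based_paths W \<and> openin (top_of_set W) B \<and> pathfinish g \<in> B}"

definition sheet :: "'e::real_normed_vector set \<Rightarrow> (real \<Rightarrow> 'e) set set \<Rightarrow> bool" where
  "sheet W S \<longleftrightarrow> openin (ucover_top W) S \<and> inj_on ucover_proj S"

definition smooth_on_ucover ::
  "'e::euclidean_space set \<Rightarrow> ((real \<Rightarrow> 'e) set \<Rightarrow> 'f::real_normed_vector) \<Rightarrow> bool" where
  "smooth_on_ucover W f \<longleftrightarrow>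
     (\<forall>y\<in>ucover W. \<exists>S. sheet W S \<and> y \<in> S \<and>
        smooth_on (ucover_proj ` S) (f \<circ> inv_into S ucover_proj))"

definition ucover_diffeo ::
  "'e::euclidean_space set \<Rightarrow> 'e set \<Rightarrow> ((real \<Rightarrow> 'e) set \<Rightarrow> (real \<Rightarrow> 'e) set) \<Rightarrow> bool" where
  "ucover_diffeo W W' F \<longleftrightarrow>
     homeomorphic_map (ucover_top W) (ucover_top W') F \<and>
     smooth_on_ucover W (ucover_proj \<circ> F) \<and>
     smooth_on_ucover W' (ucover_proj \<circ> inv_into (ucover W) F)"


section \<open>Quasifolds\<close>

text \<open>
  A chart with values in a space of points of type \<open>'x\<close>: the covering manifold
  \<open>cdom\<close>, the group \<open>cgrp\<close> acting on it, and the composite \<open>cmap\<close> of the quotient map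
  \<open>cdom \<rightarrow> cdom / cgrp\<close> with the homeomorphism of \<open>cdom / cgrp\<close> onto the open set \<open>cim\<close>.

  In order to have charts of different dimensions in one type, \<open>\<real>\<^sup>k\<close> is replaced by an arbitrary
  \<open>k\<close>-dimensional linear subspace of the Euclidean space \<open>'e\<close>, namely \<open>span cdom\<close>.
  The group is a set of (extensional) bijections of \<open>cdom\<close>.  No generality is lost by taking it
  effective: the existence of free points forces this.
\<close>

record ('e, 'x) chart =
  cdom :: "'e set"
  cgrp :: "('e \<Rightarrow> 'e) set"
  cmap :: "'e \<Rightarrow> 'x"

definition cim :: "('e, 'x) chart \<Rightarrow> 'x set" where
  "cim a = cmap a ` cdom a"

definition free_points :: "('e \<Rightarrow> 'e) set \<Rightarrow> 'e set \<Rightarrow> 'e set" where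
  "free_points G U = {x\<in>U. \<forall>g\<in>G. g x = x \<longrightarrow> (\<forall>y\<in>U. g y = y)}"

text \<open>
  Everything required of a model on \<open>U\<close> except simple connectedness.  A discrete
  group is a zero-dimensional (second countable) Lie group, hence countable.
\<close>

definition premodel :: "('e \<Rightarrow> 'e) set \<Rightarrow> 'e::euclidean_space set \<Rightarrow> bool" where
  "premodel G U \<longleftrightarrow>
     U \<noteq> {} \<and> openin (top_of_set (span U)) U \<and> connected U \<and>
     subgroup G (BijGroup U) \<and> countable G \<and> (\<forall>g\<in>G. smooth_on U g) \<and>
     connected (free_points G U) \<and> U \<subseteq> closure (free_points G U)"

definition quasifold_chart :: "'x topology \<Rightarrow> nat \<Rightarrow> ('e::euclidean_space, 'x) chart \<Rightarrow> bool" where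
  "quasifold_chart T k a \<longleftrightarrow>
     premodel (cgrp a) (cdom a) \<and> dim (cdom a) = k \<and> simply_connected (cdom a) \<and>
     openin T (cim a) \<and>
     quotient_map (top_of_set (cdom a)) (subtopology T (cim a)) (cmap a) \<and>
     (\<forall>x\<in>cdom a. \<forall>y\<in>cdom a. cmap a x = cmap a y \<longleftrightarrow> (\<exists>g\<in>cgrp a. y = g x))"

definition overlap_preimage :: "('e, 'x) chart \<Rightarrow> ('e, 'x) chart \<Rightarrow> 'e set" where
  "overlap_preimage a b = {x\<in>cdom a. cmap a x \<in> cim b}"

definition submodel :: "('e::euclidean_space, 'x) chart \<Rightarrow> 'e set \<Rightarrow> bool" where
  "submodel a W \<longleftrightarrow> premodel ((\<lambda>g. restrict g W) ` cgrp a) W"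

text \<open>
  The lifts to the universal covers of the change of charts \<open>\<phi>\<^sub>b\<inverse> \<circ> \<phi>\<^sub>a\<close> that exhibit it as a
  diffeomorphism of models.  (If a preimage is simply connected, it is its own universal cover.)
\<close>

definition change_of_charts_lift ::
  "('e::euclidean_space, 'x) chart \<Rightarrow> ('e, 'x) chart \<Rightarrow>
   ((real \<Rightarrow> 'e) set \<Rightarrow> (real \<Rightarrow> 'e) set) \<Rightarrow> bool" where
  "change_of_charts_lift a b F \<longleftrightarrow>
     ucover_diffeo (overlap_preimage a b) (overlap_preimage b a) F \<and>
     (\<forall>y\<in>ucover (overlap_preimage a b).
        cmap b (ucover_proj (F y)) = cmap a (ucover_proj y))"

definition compatible_charts ::
  "('e::euclidean_space, 'x) chart \<Rightarrow> ('e, 'x) chart \<Rightarrow> bool" where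
  "compatible_charts a b \<longleftrightarrow>
     (cim a \<inter> cim b \<noteq> {} \<longrightarrow>
        submodel a (overlap_preimage a b) \<and> submodel b (overlap_preimage b a) \<and>
        (\<exists>F. change_of_charts_lift a b F))"

definition atlas :: "'x topology \<Rightarrow> nat \<Rightarrow> ('e::euclidean_space, 'x) chart set \<Rightarrow> bool" where
  "atlas T k \<A> \<longleftrightarrow>
     (\<forall>a\<in>\<A>. quasifold_chart T k a) \<and> (\<Union>a\<in>\<A>. cim a) = topspace T \<and>
     (\<forall>a\<in>\<A>. \<forall>b\<in>\<A>. compatible_charts a b)"

definition quasifold :: "'x topology \<Rightarrow> nat \<Rightarrow> ('e::euclidean_space, 'x) chart set \<Rightarrow> bool" where
  "quasifold T k \<A> \<longleftrightarrow> atlas T k \<A> \<and> (\<forall>\<B>. atlas T k \<B> \<and> \<A> \<subseteq> \<B> \<longrightarrow> \<B> = \<A>)"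

text \<open>\<open>\<A>\<close> and \<open>\<B>\<close> may be any collections of charts contained in the maximal atlases.\<close>

definition quasifold_smooth ::
  "'x topology \<Rightarrow> ('e::euclidean_space, 'x) chart set \<Rightarrow>
   'y topology \<Rightarrow> ('f::euclidean_space, 'y) chart set \<Rightarrow> ('x \<Rightarrow> 'y) \<Rightarrow> bool" where
  "quasifold_smooth S \<A> T \<B> f \<longleftrightarrow>
     continuous_map S T f \<and>
     (\<forall>x\<in>topspace S. \<exists>a\<in>\<A>. \<exists>b\<in>\<B>. x \<in> cim a \<and> f x \<in> cim b \<and>
        (\<exists>F. smooth_on (cdom a) F \<and> F ` cdom a \<subseteq> cdom b \<and>
             (\<forall>u\<in>cdom a. cmap b (F u) = f (cmap a u))))"

definition prod_charts ::
  "('e, 'x) chart set \<Rightarrow> ('f, 'y) chart set \<Rightarrow> ('e \<times> 'f, 'x \<times> 'y) chart set" where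
  "prod_charts \<A> \<B> =
     {\<lparr>cdom = cdom a \<times> cdom b,
       cgrp = {restrict (map_prod g h) (cdom a \<times> cdom b) | g h. g \<in> cgrp a \<and> h \<in> cgrp b},
       cmap = map_prod (cmap a) (cmap b)\<rparr> | a b. a \<in> \<A> \<and> b \<in> \<B>}"

definition vector_space_chart :: "('v, 'v) chart" where
  "vector_space_chart = \<lparr>cdom = UNIV, cgrp = {id}, cmap = id\<rparr>"


subsection \<open>Symplectic forms\<close>

text \<open>
  A family \<open>\<omega>\<close> of 2-forms, one for each chart.  Compatibility with a change of charts:
  its lift \<open>F\<close> to the universal covers pulls back \<open>\<omega> b\<close> to \<open>\<omega> a\<close>, where both are transported to
  the universal covers by \<open>ucover_proj\<close>; on each sheet this is expressed downstairs.
\<close>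

type_synonym ('e, 'x) form_family = "('e, 'x) chart \<Rightarrow> 'e two_form"

definition quasifold_two_form ::
  "('e::euclidean_space, 'x) chart set \<Rightarrow> ('e, 'x) form_family \<Rightarrow> bool" where
  "quasifold_two_form \<A> \<omega> \<longleftrightarrow>
     (\<forall>a\<in>\<A>. two_form_on (cdom a) (\<omega> a) \<and>
        (\<forall>g\<in>cgrp a. pulls_back g (cdom a) (\<omega> a) (\<omega> a))) \<and>
     (\<forall>a\<in>\<A>. \<forall>b\<in>\<A>. cim a \<inter> cim b \<noteq> {} \<longrightarrow>
        (\<forall>F S. change_of_charts_lift a b F \<and> sheet (overlap_preimage a b) S \<longrightarrow>
           pulls_back (ucover_proj \<circ> F \<circ> inv_into S ucover_proj) (ucover_proj ` S) (\<omega> b) (\<omega> a)))"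

definition symplectic_form ::
  "('e::euclidean_space, 'x) chart set \<Rightarrow> ('e, 'x) form_family \<Rightarrow> bool" where
  "symplectic_form \<A> \<omega> \<longleftrightarrow> quasifold_two_form \<A> \<omega> \<and>
     (\<forall>a\<in>\<A>. closed_form_on (cdom a) (\<omega> a) \<and> nondegenerate_on (cdom a) (\<omega> a))"

text \<open>\<open>f\<^sup>*\<omega> = \<omega>\<close>, tested on all local smooth lifts of \<open>f\<close> to charts.\<close>

definition preserves_form ::
  "('e::euclidean_space, 'x) chart set \<Rightarrow> ('e, 'x) form_family \<Rightarrow> ('x \<Rightarrow> 'x) \<Rightarrow> bool" where
  "preserves_form \<A> \<omega> f \<longleftrightarrow>
     (\<forall>a\<in>\<A>. \<forall>b\<in>\<A>. \<forall>W G. openin (top_of_set (cdom a)) W \<and> smooth_on W G \<and> G ` W \<subseteq> cdom b \<and>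
        (\<forall>x\<in>W. cmap b (G x) = f (cmap a x)) \<longrightarrow> pulls_back G W (\<omega> b) (\<omega> a))"


section \<open>Quasitori and Hamiltonian actions\<close>

definition quasilattice :: "'a::euclidean_space set \<Rightarrow> bool" where
  "quasilattice Q \<longleftrightarrow>
     (\<exists>S. finite S \<and> span S = UNIV \<and> Q = {\<Sum>v\<in>S. of_int (k v) *\<^sub>R v | k :: 'a \<Rightarrow> int. True})"

definition qclass :: "'a::ab_group_add set \<Rightarrow> 'a \<Rightarrow> 'a set" where
  "qclass Q Y = (+) Y ` Q"

text \<open>The quasitorus \<open>\<dd>/Q\<close> is the set \<open>range (qclass Q)\<close> of cosets.\<close>

definition quasitorus_top :: "'a::euclidean_space set \<Rightarrow> 'a set topology" where
  "quasitorus_top Q = quotient_top UNIV (qclass Q)"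

definition quasitorus_chart :: "'a::euclidean_space set \<Rightarrow> ('a, 'a set) chart" where
  "quasitorus_chart Q = \<lparr>cdom = UNIV, cgrp = (+) ` Q, cmap = qclass Q\<rparr>"

definition smooth_quasitorus_action ::
  "'a::euclidean_space set \<Rightarrow> 'x topology \<Rightarrow> ('e::euclidean_space, 'x) chart set \<Rightarrow>
   ('a set \<Rightarrow> 'x \<Rightarrow> 'x) \<Rightarrow> bool" where
  "smooth_quasitorus_action Q T \<A> act \<longleftrightarrow>
     (\<forall>m\<in>topspace T. act (qclass Q 0) m = m) \<and>
     (\<forall>Y Z. \<forall>m\<in>topspace T. act (qclass Q (Y + Z)) m = act (qclass Q Y) (act (qclass Q Z) m)) \<and>
     quasifold_smooth (prod_topology (quasitorus_top Q) T) (prod_charts {quasitorus_chart Q} \<A>)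
       T \<A> (\<lambda>(c, m). act c m)"

text \<open>
  \<open>\<xi>\<close> is the value at \<open>x\<close> of the fundamental vector field of \<open>Y\<close> in the chart \<open>a\<close>: the
  derivative at \<open>t = 0\<close> of a local lift of \<open>t \<mapsto> [t Y] \<cdot> ( )\<close> that is the identity at \<open>t = 0\<close>.
\<close>

definition fundamental_vector ::
  "'a::euclidean_space set \<Rightarrow> ('a set \<Rightarrow> 'x \<Rightarrow> 'x) \<Rightarrow> 'a \<Rightarrow> ('e::euclidean_space, 'x) chart \<Rightarrow>
   'e \<Rightarrow> 'e \<Rightarrow> bool" where
  "fundamental_vector Q act Y a x \<xi> \<longleftrightarrow>
     (\<exists>W H. \<exists>e>0. openin (top_of_set (cdom a)) W \<and> x \<in> W \<and>
        smooth_on ({-e<..<e} \<times> W) H \<and> H ` ({-e<..<e} \<times> W) \<subseteq> cdom a \<and>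
        (\<forall>y\<in>W. H (0, y) = y) \<and>
        (\<forall>t\<in>{-e<..<e}. \<forall>y\<in>W. cmap a (H (t, y)) = act (qclass Q (t *\<^sub>R Y)) (cmap a y)) \<and>
        ((\<lambda>t. H (t, x)) has_vector_derivative \<xi>) (at 0))"

text \<open>
  \<open>\<dd>\<close> is a Euclidean space \<open>'a\<close>, and \<open>\<dd>\<^sup>*\<close> is identified with \<open>'a\<close> through
  the inner product, the pairing being \<open>\<langle>\<mu>, Y\<rangle> = \<mu> \<bullet> Y\<close>.  The last clause says
  that \<open>\<iota>(Y\<^sub>T)\<omega> = d\<langle>\<Phi>, Y\<rangle>\<close> in every chart, the vector field \<open>Y\<^sub>T\<close> being well-defined.
\<close>

definition hamiltonian_action ::
  "'a::euclidean_space set \<Rightarrow> 'x topology \<Rightarrow> ('e::euclidean_space, 'x) chart set \<Rightarrow>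
   ('e, 'x) form_family \<Rightarrow> ('a set \<Rightarrow> 'x \<Rightarrow> 'x) \<Rightarrow> ('x \<Rightarrow> 'a) \<Rightarrow> bool" where
  "hamiltonian_action Q T \<A> \<omega> act \<Phi> \<longleftrightarrow>
     (\<forall>c\<in>range (qclass Q). preserves_form \<A> \<omega> (act c)) \<and>
     quasifold_smooth T \<A> euclidean {vector_space_chart} \<Phi> \<and>
     (\<forall>c\<in>range (qclass Q). \<forall>m\<in>topspace T. \<Phi> (act c m) = \<Phi> m) \<and>
     (\<forall>Y. \<forall>a\<in>\<A>. \<forall>x\<in>cdom a.
        (\<exists>\<xi>. fundamental_vector Q act Y a x \<xi>) \<and>
        (\<forall>\<xi>. fundamental_vector Q act Y a x \<xi> \<longrightarrow>
           (\<forall>v\<in>span (cdom a).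
              ((\<lambda>t. \<Phi> (cmap a (x + t *\<^sub>R v)) \<bullet> Y) has_real_derivative \<omega> a x \<xi> v) (at 0))))"


section \<open>The space associated with a convex polytope\<close>

definition polytope_normals ::
  "'a::euclidean_space set \<Rightarrow> ('d::finite \<Rightarrow> 'a) \<Rightarrow> ('d \<Rightarrow> real) \<Rightarrow> bool" where
  "polytope_normals \<Delta> X lam \<longleftrightarrow>
     polytope \<Delta> \<and> aff_dim \<Delta> = int DIM('a) \<and>
     \<Delta> = (\<Inter>j. {\<mu>. \<mu> \<bullet> X j \<ge> lam j}) \<and>
     bij_betw (\<lambda>j. {\<mu>\<in>\<Delta>. \<mu> \<bullet> X j = lam j}) UNIV {F. F facet_of \<Delta>}"

definition pi_map :: "('d::finite \<Rightarrow> 'a::real_vector) \<Rightarrow> real ^ 'd \<Rightarrow> 'a" where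
  "pi_map X x = (\<Sum>j\<in>UNIV. x $ j *\<^sub>R X j)"

text \<open>
  \<open>T\<^sup>d = \<real>\<^sup>d/\<int>\<^sup>d\<close> is realized by vectors of complex numbers of modulus 1, and \<open>exp\<close> by \<open>texp\<close>.  The class of
  \<open>texp x\<close> is in the kernel of \<open>T\<^sup>d \<rightarrow> \<dd>/Q\<close> iff \<open>\<pi>(x) \<in> Q\<close>.
\<close>

definition texp :: "real ^ 'd \<Rightarrow> complex ^ 'd" where
  "texp x = (\<chi> j. exp (2 * of_real pi * \<i> * of_real (x $ j)))"

definition tmul :: "complex ^ 'd \<Rightarrow> complex ^ 'd \<Rightarrow> complex ^ 'd" where
  "tmul a z = (\<chi> j. a $ j * z $ j)"

definition N_grp :: "('d::finite \<Rightarrow> 'a::euclidean_space) \<Rightarrow> 'a set \<Rightarrow> (complex ^ 'd) set" where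
  "N_grp X Q = texp ` {x. pi_map X x \<in> Q}"

definition Ups :: "('d::finite \<Rightarrow> real) \<Rightarrow> complex ^ 'd \<Rightarrow> real ^ 'd \<Rightarrow> real" where
  "Ups lam z v = (\<Sum>j\<in>UNIV. ((cmod (z $ j))\<^sup>2 + lam j) * v $ j)"

text \<open>\<open>\<Psi>(z)\<close> is the restriction of the functional \<open>Ups lam z\<close> to \<open>\<nn> = ker \<pi>\<close>.\<close>

definition Psi_zero ::
  "('d::finite \<Rightarrow> 'a::euclidean_space) \<Rightarrow> ('d \<Rightarrow> real) \<Rightarrow> (complex ^ 'd) set" where
  "Psi_zero X lam = {z. \<forall>v. pi_map X v = 0 \<longrightarrow> Ups lam z v = 0}"

definition N_orbit ::
  "('d::finite \<Rightarrow> 'a::euclidean_space) \<Rightarrow> 'a set \<Rightarrow> complex ^ 'd \<Rightarrow> (complex ^ 'd) set" where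
  "N_orbit X Q z = (\<lambda>a. tmul a z) ` N_grp X Q"

definition M_top ::
  "('d::finite \<Rightarrow> 'a::euclidean_space) \<Rightarrow> ('d \<Rightarrow> real) \<Rightarrow> 'a set \<Rightarrow> (complex ^ 'd) set topology" where
  "M_top X lam Q = quotient_top (Psi_zero X lam) (N_orbit X Q)"

text \<open>\<open>D \<cong> T\<^sup>d/N\<close> acts on orbits: \<open>[\<pi>(x)] \<cdot> [z] = [texp x \<cdot> z]\<close>.\<close>

definition D_act ::
  "('d::finite \<Rightarrow> 'a::euclidean_space) \<Rightarrow> 'a set \<Rightarrow> (complex ^ 'd) set \<Rightarrow> (complex ^ 'd) set" where
  "D_act X c m = {tmul (texp x) z | x z. pi_map X x \<in> c \<and> z \<in> m}"

definition Phi ::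
  "('d::finite \<Rightarrow> 'a::euclidean_space) \<Rightarrow> ('d \<Rightarrow> real) \<Rightarrow> (complex ^ 'd) set \<Rightarrow> 'a" where
  "Phi X lam m = (THE \<mu>. \<forall>z\<in>m. \<forall>v. \<mu> \<bullet> pi_map X v = Ups lam z v)"

definition omega0 :: "(complex ^ 'd::finite) \<Rightarrow> complex ^ 'd \<Rightarrow> real" where
  "omega0 v w = Re ((\<Sum>j\<in>UNIV. v $ j * cnj (w $ j) - w $ j * cnj (v $ j)) / (2 * of_real pi * \<i>))"


subsection \<open>Faces and pieces\<close>

text \<open>An open face \<open>F\<close> is given by its index set \<open>J = I\<^sub>F\<close>.\<close>

definition open_face ::
  "'a::euclidean_space set \<Rightarrow> ('d \<Rightarrow> 'a) \<Rightarrow> ('d \<Rightarrow> real) \<Rightarrow> 'd set \<Rightarrow> 'a set" where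
  "open_face \<Delta> X lam J = {\<mu>\<in>\<Delta>. \<forall>j. \<mu> \<bullet> X j = lam j \<longleftrightarrow> j \<in> J}"

definition singular_face ::
  "'a::euclidean_space set \<Rightarrow> ('d::finite \<Rightarrow> 'a) \<Rightarrow> ('d \<Rightarrow> real) \<Rightarrow> 'd set \<Rightarrow> bool" where
  "singular_face \<Delta> X lam J \<longleftrightarrow> open_face \<Delta> X lam J \<noteq> {} \<and>
     int (card J) > int DIM('a) - aff_dim (open_face \<Delta> X lam J)"

definition nonsingular_face ::
  "'a::euclidean_space set \<Rightarrow> ('d::finite \<Rightarrow> 'a) \<Rightarrow> ('d \<Rightarrow> real) \<Rightarrow> 'd set \<Rightarrow> bool" where
  "nonsingular_face \<Delta> X lam J \<longleftrightarrow> open_face \<Delta> X lam J \<noteq> {} \<and>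
     int (card J) = int DIM('a) - aff_dim (open_face \<Delta> X lam J)"

definition coord_set :: "complex set \<Rightarrow> 'd set \<Rightarrow> (complex ^ 'd) set" where
  "coord_set K J = {z. \<forall>j. if j \<in> J then z $ j \<in> K else z $ j = 0}"

definition singular_level ::
  "('d::finite \<Rightarrow> 'a::euclidean_space) \<Rightarrow> ('d \<Rightarrow> real) \<Rightarrow> 'd set \<Rightarrow> (complex ^ 'd) set" where
  "singular_level X lam J = Psi_zero X lam \<inter> coord_set (- {0}) (- J)"

definition regular_level ::
  "'a::euclidean_space set \<Rightarrow> ('d::finite \<Rightarrow> 'a) \<Rightarrow> ('d \<Rightarrow> real) \<Rightarrow> (complex ^ 'd) set" where
  "regular_level \<Delta> X lam =
     (\<Union>J\<in>{J. nonsingular_face \<Delta> X lam J}. Psi_zero X lam \<inter> coord_set (- {0}) (- J))"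

text \<open>The piece \<open>S/N\<close> of \<open>M\<close>, for an \<open>N\<close>-invariant subset \<open>S\<close> of the zero level of \<open>\<Psi>\<close>.\<close>

definition piece_top ::
  "('d::finite \<Rightarrow> 'a::euclidean_space) \<Rightarrow> ('d \<Rightarrow> real) \<Rightarrow> 'a set \<Rightarrow> (complex ^ 'd) set \<Rightarrow>
   (complex ^ 'd) set topology" where
  "piece_top X lam Q S = subtopology (M_top X lam Q) (N_orbit X Q ` S)"


subsection \<open>The charts of the pieces\<close>

definition active_indices :: "('d \<Rightarrow> 'a::euclidean_space) \<Rightarrow> ('d \<Rightarrow> real) \<Rightarrow> 'a \<Rightarrow> 'd set" where
  "active_indices X lam \<mu> = {j. \<mu> \<bullet> X j = lam j}"

text \<open>The set \<open>\<I>\<^sub>\<mu>\<close> for a vertex \<open>\<mu>\<close>.\<close>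

definition vertex_bases ::
  "('d::finite \<Rightarrow> 'a::euclidean_space) \<Rightarrow> ('d \<Rightarrow> real) \<Rightarrow> 'a \<Rightarrow> 'd set set" where
  "vertex_bases X lam \<mu> =
     {I. I \<subseteq> active_indices X lam \<mu> \<and> inj_on X I \<and> independent (X ` I) \<and> span (X ` I) = UNIV}"

text \<open>\<open>X k = (\<Sum>h\<in>I. base_coeff X I h k *\<^sub>R X h)\<close>.\<close>

definition base_coeff :: "('d \<Rightarrow> 'a::euclidean_space) \<Rightarrow> 'd set \<Rightarrow> 'd \<Rightarrow> 'd \<Rightarrow> real" where
  "base_coeff X I h k = representation (X ` I) (X k) (X h)"

definition torus_part :: "'d set \<Rightarrow> (complex ^ 'd) set" where
  "torus_part J = {a \<in> range texp. \<forall>j. j \<notin> J \<longrightarrow> a $ j = 1}"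

definition Gamma_grp ::
  "('d::finite \<Rightarrow> 'a::euclidean_space) \<Rightarrow> 'a set \<Rightarrow> 'd set \<Rightarrow> (complex ^ 'd) set" where
  "Gamma_grp X Q I = N_grp X Q \<inter> torus_part I"

definition torus_proj :: "'d set \<Rightarrow> complex ^ 'd \<Rightarrow> complex ^ 'd" where
  "torus_proj J a = (\<chi> j. if j \<in> J then a $ j else 1)"

definition act_on :: "(complex ^ 'd) set \<Rightarrow> (complex ^ 'd) set \<Rightarrow> (complex ^ 'd \<Rightarrow> complex ^ 'd) set" where
  "act_on G U = (\<lambda>a. restrict (tmul a) U) ` G"

text \<open>The expressions defining \<open>\<tilde>U\<^sub>I\<close>: the squared moduli of the coordinates \<open>k \<notin> I\<close> on the zero level.\<close>

definition regular_sq ::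
  "('d::finite \<Rightarrow> 'a::euclidean_space) \<Rightarrow> ('d \<Rightarrow> real) \<Rightarrow> 'a \<Rightarrow> 'd set \<Rightarrow> complex ^ 'd \<Rightarrow> 'd \<Rightarrow> real" where
  "regular_sq X lam \<mu> I u k =
     (if k \<in> active_indices X lam \<mu> then \<Sum>h\<in>I. base_coeff X I h k * (cmod (u $ h))\<^sup>2
      else (\<Sum>h\<in>I. base_coeff X I h k * ((cmod (u $ h))\<^sup>2 + lam h)) - lam k)"

definition regular_dom ::
  "('d::finite \<Rightarrow> 'a::euclidean_space) \<Rightarrow> ('d \<Rightarrow> real) \<Rightarrow> 'a \<Rightarrow> 'd set \<Rightarrow> (complex ^ 'd) set" where
  "regular_dom X lam \<mu> I = {u \<in> coord_set UNIV I. \<forall>k. k \<notin> I \<longrightarrow> regular_sq X lam \<mu> I u k > 0}"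

definition regular_base_chart ::
  "('d::finite \<Rightarrow> 'a::euclidean_space) \<Rightarrow> ('d \<Rightarrow> real) \<Rightarrow> 'a set \<Rightarrow> 'a \<Rightarrow> 'd set \<Rightarrow>
   (complex ^ 'd, (complex ^ 'd) set) chart" where
  "regular_base_chart X lam Q \<mu> I =
     \<lparr>cdom = regular_dom X lam \<mu> I,
      cgrp = act_on (Gamma_grp X Q I) (regular_dom X lam \<mu> I),
      cmap = (\<lambda>u. N_orbit X Q
        (\<chi> j. if j \<in> I then u $ j else of_real (sqrt (regular_sq X lam \<mu> I u j))))\<rparr>"

definition singular_sq ::
  "('d::finite \<Rightarrow> 'a::euclidean_space) \<Rightarrow> ('d \<Rightarrow> real) \<Rightarrow> 'a \<Rightarrow> 'd set \<Rightarrow> 'd set \<Rightarrow>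
   complex ^ 'd \<Rightarrow> 'd \<Rightarrow> real" where
  "singular_sq X lam \<mu> I J w k =
     (if k \<in> active_indices X lam \<mu> then \<Sum>h\<in>I - J. base_coeff X I h k * (cmod (w $ h))\<^sup>2
      else (\<Sum>h\<in>I \<inter> J. base_coeff X I h k * lam h)
         + (\<Sum>h\<in>I - J. base_coeff X I h k * ((cmod (w $ h))\<^sup>2 + lam h)) - lam k)"

definition singular_dom ::
  "('d::finite \<Rightarrow> 'a::euclidean_space) \<Rightarrow> ('d \<Rightarrow> real) \<Rightarrow> 'a \<Rightarrow> 'd set \<Rightarrow> 'd set \<Rightarrow>
   (complex ^ 'd) set" where
  "singular_dom X lam \<mu> I J =
     {w \<in> coord_set (- {0}) (I - J). \<forall>k. k \<notin> I \<union> J \<longrightarrow> singular_sq X lam \<mu> I J w k > 0}"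

definition singular_base_chart ::
  "('d::finite \<Rightarrow> 'a::euclidean_space) \<Rightarrow> ('d \<Rightarrow> real) \<Rightarrow> 'a set \<Rightarrow> 'a \<Rightarrow> 'd set \<Rightarrow> 'd set \<Rightarrow>
   (complex ^ 'd, (complex ^ 'd) set) chart" where
  "singular_base_chart X lam Q \<mu> I J =
     \<lparr>cdom = singular_dom X lam \<mu> I J,
      cgrp = act_on (torus_proj (I - J) ` Gamma_grp X Q I) (singular_dom X lam \<mu> I J),
      cmap = (\<lambda>w. N_orbit X Q
        (\<chi> j. if j \<in> I - J then w $ j
              else if j \<in> I \<union> J then 0
              else of_real (sqrt (singular_sq X lam \<mu> I J w j))))\<rparr>"

text \<open>
  \<open>c\<close> exhibits \<open>W\<close>, a simply connected open subset of a subspace of the same dimension, as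
  the smooth universal cover of \<open>U\<close>.  If \<open>U\<close> is itself simply connected, \<open>c\<close> is just a
  diffeomorphism, e.g. the identity.
\<close>

definition smooth_universal_cover ::
  "'e::euclidean_space set \<Rightarrow> ('e \<Rightarrow> 'e) \<Rightarrow> 'e set \<Rightarrow> bool" where
  "smooth_universal_cover W c U \<longleftrightarrow>
     W \<noteq> {} \<and> openin (top_of_set (span W)) W \<and> dim W = dim U \<and>
     connected W \<and> simply_connected W \<and> covering_space W c U \<and>
     (\<forall>x\<in>W. \<exists>B. openin (top_of_set W) B \<and> x \<in> B \<and> openin (top_of_set U) (c ` B) \<and>
        diffeo B (c ` B) c)"

definition cover_chart ::
  "'e::euclidean_space set \<Rightarrow> ('e \<Rightarrow> 'e) \<Rightarrow> ('e, 'x) chart \<Rightarrow> ('e, 'x) chart" where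
  "cover_chart W c b =
     \<lparr>cdom = W,
      cgrp = {g \<in> Bij W. diffeo W W g \<and> (\<exists>h\<in>cgrp b. \<forall>x\<in>W. c (g x) = h (c x))},
      cmap = cmap b \<circ> c\<rparr>"


subsection \<open>The symplectic quasifold structure of the pieces\<close>

text \<open>
  The pull-back of \<open>\<omega>\<close> under the projection \<open>p\<close>, computed by local smooth lifts \<open>P\<close> of \<open>p\<close>
  to charts, is the restriction of \<open>\<omega>\<^sub>0\<close> to the submanifold \<open>S\<close>.
\<close>

definition pulls_back_to_omega0 ::
  "('d::finite \<Rightarrow> 'a::euclidean_space) \<Rightarrow> 'a set \<Rightarrow> (complex ^ 'd) set \<Rightarrow>
   (complex ^ 'd, (complex ^ 'd) set) chart set \<Rightarrow>
   (complex ^ 'd, (complex ^ 'd) set) form_family \<Rightarrow> bool" where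
  "pulls_back_to_omega0 X Q S \<A> \<omega> \<longleftrightarrow>
     (\<forall>a\<in>\<A>. \<forall>W P. openin (top_of_set S) W \<and> smooth_on W P \<and> P ` W \<subseteq> cdom a \<and>
        (\<forall>z\<in>W. cmap a (P z) = N_orbit X Q z) \<longrightarrow> pulls_back P W (\<omega> a) (\<lambda>_. omega0))"

definition regular_structure ::
  "'a::euclidean_space set \<Rightarrow> ('d::finite \<Rightarrow> 'a) \<Rightarrow> ('d \<Rightarrow> real) \<Rightarrow> 'a set \<Rightarrow>
   (complex ^ 'd, (complex ^ 'd) set) chart set \<Rightarrow>
   (complex ^ 'd, (complex ^ 'd) set) form_family \<Rightarrow> bool" where
  "regular_structure \<Delta> X lam Q \<A> \<omega> \<longleftrightarrow>
     quasifold (piece_top X lam Q (regular_level \<Delta> X lam)) (2 * DIM('a)) \<A> \<and>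
     (\<forall>\<mu> I. \<mu> extreme_point_of \<Delta> \<and> I \<in> vertex_bases X lam \<mu> \<longrightarrow>
        (\<exists>W c. smooth_universal_cover W c (regular_dom X lam \<mu> I) \<and>
               cover_chart W c (regular_base_chart X lam Q \<mu> I) \<in> \<A>)) \<and>
     symplectic_form \<A> \<omega> \<and> pulls_back_to_omega0 X Q (regular_level \<Delta> X lam) \<A> \<omega>"

text \<open>
  Here the existential quantifier over \<open>\<mu>\<close> and \<open>I\<close> is the choice of the vertex and of the
  basis in the description of the atlas.  For a vertex the definitions give a single point.
\<close>

definition singular_structure ::
  "'a::euclidean_space set \<Rightarrow> ('d::finite \<Rightarrow> 'a) \<Rightarrow> ('d \<Rightarrow> real) \<Rightarrow> 'a set \<Rightarrow> 'd set \<Rightarrow>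
   (complex ^ 'd, (complex ^ 'd) set) chart set \<Rightarrow>
   (complex ^ 'd, (complex ^ 'd) set) form_family \<Rightarrow> bool" where
  "singular_structure \<Delta> X lam Q J \<A> \<omega> \<longleftrightarrow>
     quasifold (piece_top X lam Q (singular_level X lam J))
       (2 * nat (aff_dim (open_face \<Delta> X lam J))) \<A> \<and>
     (\<exists>\<mu> I. \<mu> extreme_point_of \<Delta> \<and> \<mu> \<in> closure (open_face \<Delta> X lam J) \<and>
        I \<in> vertex_bases X lam \<mu> \<and>
        int (card (I \<inter> J)) = int DIM('a) - aff_dim (open_face \<Delta> X lam J) \<and>
        (\<exists>W c. smooth_universal_cover W c (singular_dom X lam \<mu> I J) \<and>
               cover_chart W c (singular_base_chart X lam Q \<mu> I J) \<in> \<A>)) \<and>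
     symplectic_form \<A> \<omega> \<and> pulls_back_to_omega0 X Q (singular_level X lam J) \<A> \<omega>"

end

theory Submission
  imports Defs "HOL-Complex_Analysis.Cauchy_Integral_Formula"
begin

text \<open>
  If \<open>G\<close> is a map into a chart and \<open>\<sigma>\<close> a map into the level set \<open>S\<close> that both represent the same
  map into the piece \<open>S / N\<close>, then \<open>G\<^sup>*\<omega> = \<sigma>\<^sup>*\<omega>\<^sub>0\<close>: composing \<open>\<sigma>\<close> with a local lift of the projection
  \<open>p\<close> gives a second lift into the chart, which on a dense open set differs from \<open>G\<close> locally by
  elements of the countable group of the chart, and these preserve \<open>\<omega>\<close>.  With \<open>\<sigma>\<close> a local section of
  \<open>p\<close> and \<open>G\<close> a lift of the action of \<open>c \<in> D\<close>, this reduces the invariance of \<open>\<omega>\<close> to that of \<open>\<omega>\<^sub>0\<close>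
  under the torus.  With \<open>G\<close> a lift \<open>H(t, x + s v)\<close> of the flow of \<open>Y\<close> it reduces
  \<open>\<iota>(Y\<^sub>T)\<omega> = d\<langle>\<Phi>, Y\<rangle>\<close> to the same identity for the torus action on \<open>\<complex>\<^sup>d\<close> and \<open>\<Upsilon>\<close>.  Smoothness of the action
  is seen in the given charts, where the torus \<open>T\<^sup>I\<close> acts linearly; the action is lifted
  to the universal covers by the lifting property of coverings.
\<close>

section \<open>Calculus of smooth maps\<close>

text \<open>The atlas is maximal, so invariance of the form and the moment map identity have to be
  checked in charts about which hardly anything is known beyond compatibility. Explicit data exist
  only for the covers of the base charts. Everything else is transported from them by changes of
  charts, which are given as lifts between universal covers of overlaps and must be brought down to
  local diffeomorphisms. A second obstacle: chart domains are open merely in their linear span, so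
  derivatives there are taken within a set and are not unique. Tangent vectors are therefore
  realised by maps from open sets of the plane, and forms are compared after pulling back to these
  parameters, where derivatives are unique. Finally, the hypothesis linking \<omega> to
  \<open>omega0\<close> speaks about local lifts of p and says something only once such lifts exist.
  They are built by normalising the phases of the coordinates outside a basis I of normals, using
  elements of exp(ker \<pi>) that depend smoothly on the point.\<close>

lemma Ck_on_subset: "Ck_on k W f \<Longrightarrow> V \<subseteq> W \<Longrightarrow> Ck_on k V f"
  by (induction k arbitrary: f) (auto intro: continuous_on_subset differentiable_on_subset)

text \<open>Openness of \<open>W\<close> makes the derivatives agree:
  \<open>frechet_derivative\<close> at a point sees a whole neighbourhood, not only
  \<open>W\<close>.\<close>

lemma Ck_on_cong:
  assumes "open W" "\<And>x. x \<in> W \<Longrightarrow> f x = g x" "Ck_on k W f"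
  shows "Ck_on k W g"
  using assms(2,3)
proof (induction k arbitrary: f g)
  case 0
  then show ?case by (simp cong: continuous_on_cong)
next
  case (Suc k)
  have eq: "frechet_derivative g (at x) = frechet_derivative f (at x)" if "x \<in> W" for x
  proof -
    have "(f has_derivative F) (at x) \<longleftrightarrow> (g has_derivative F) (at x)" for F
      using has_derivative_transform_within_open[of f F x UNIV W g]
        has_derivative_transform_within_open[of g F x UNIV W f] assms(1) that Suc.prems(1) by auto
    then show ?thesis by (simp add: frechet_derivative_def)
  qed
  have "g differentiable_on W"
    using Suc.prems unfolding differentiable_on_def
    by (metis Ck_on.simps(2) differentiable_on_def differentiable_transform_within zero_less_one)
  moreover have "Ck_on k W (\<lambda>x. frechet_derivative g (at x) v)" for v
    using Suc.IH[of "\<lambda>x. frechet_derivative f (at x) v"] Suc.prems eq by simp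
  ultimately show ?case by simp
qed

lemma Ck_on_differentiable:
  assumes "Ck_on (Suc k) W f" "open W" "x \<in> W"
  shows "(f has_derivative frechet_derivative f (at x)) (at x)"
  using assms by (metis Ck_on.simps(2) differentiable_on_eq_differentiable_at frechet_derivative_works)

text \<open>Lets a proof name the derivative \<open>F\<close> itself; uniqueness of the full
  derivative identifies it with the \<open>frechet_derivative\<close> of the definition.\<close>

lemma Ck_on_SucI:
  assumes "open W" and "\<And>x. x \<in> W \<Longrightarrow> (f has_derivative F x) (at x)"
    and "\<And>v. Ck_on k W (\<lambda>x. F x v)"
  shows "Ck_on (Suc k) W f"
proof -
  have eq: "F x = frechet_derivative f (at x)" if "x \<in> W" for x
    using assms(2) that frechet_derivative_at by blast
  have "Ck_on k W (\<lambda>x. frechet_derivative f (at x) v)" for v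
    by (rule Ck_on_cong[OF assms(1) _ assms(3)[of v]]) (simp add: eq)
  moreover have "f differentiable_on W"
    using assms(2) by (meson differentiable_at_withinI differentiable_def differentiable_on_def)
  ultimately show ?thesis by simp
qed

lemma Ck_on_decrease: "Ck_on (Suc k) W f \<Longrightarrow> Ck_on k W f"
  by (induction k arbitrary: f) (auto intro: differentiable_imp_continuous_on)

lemma Ck_on_const: "open W \<Longrightarrow> Ck_on k W (\<lambda>x. c)"
  by (induction k arbitrary: c) (auto intro!: Ck_on_SucI[where F = "\<lambda>x v. 0"] simp del: Ck_on.simps(2))

lemma Ck_on_linear:
  assumes "open W" "bounded_linear f"
  shows "Ck_on k W f"
proof (cases k)
  case 0
  then show ?thesis using assms by (simp add: linear_continuous_on)
next
  case (Suc m)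
  then show ?thesis
    using assms by (auto intro!: Ck_on_SucI[where F = "\<lambda>x. f"] Ck_on_const bounded_linear_imp_has_derivative
        simp del: Ck_on.simps(2))
qed

lemma Ck_on_bounded_linear_compose:
  assumes "open W" "bounded_linear L" "Ck_on k W f"
  shows "Ck_on k W (\<lambda>x. L (f x))"
  using assms(3)
proof (induction k arbitrary: f)
  case 0
  then show ?case using assms(2) by (auto intro: bounded_linear.continuous_on)
next
  case (Suc k)
  show ?case
  proof (rule Ck_on_SucI[where F = "\<lambda>x v. L (frechet_derivative f (at x) v)"])
    show "((\<lambda>x. L (f x)) has_derivative (\<lambda>v. L (frechet_derivative f (at x) v))) (at x)"
      if "x \<in> W" for x
      using bounded_linear.has_derivative[OF assms(2) Ck_on_differentiable[OF Suc.prems assms(1) that]]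
      by simp
  qed (use Suc assms in auto)
qed

lemma Ck_on_add:
  assumes "open W" "Ck_on k W f" "Ck_on k W g"
  shows "Ck_on k W (\<lambda>x. f x + g x)"
  using assms(2,3)
proof (induction k arbitrary: f g)
  case 0
  then show ?case by (auto intro: continuous_on_add)
next
  case (Suc k)
  show ?case
    using Suc assms(1)
    by (intro Ck_on_SucI[where F = "\<lambda>x v. frechet_derivative f (at x) v + frechet_derivative g (at x) v"]
        has_derivative_add Ck_on_differentiable[OF Suc.prems(1)] Ck_on_differentiable[OF Suc.prems(2)] Suc.IH) auto
qed

lemma Ck_on_sum:
  assumes "open W" "finite I" "\<And>i. i \<in> I \<Longrightarrow> Ck_on k W (f i)"
  shows "Ck_on k W (\<lambda>x. \<Sum>i\<in>I. f i x)"
  using assms(2,3)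
  by (induction I rule: finite_induct) (auto intro!: Ck_on_const Ck_on_add assms(1))

lemma Ck_on_bilinear:
  assumes "open W" "bounded_bilinear B" "Ck_on k W f" "Ck_on k W g"
  shows "Ck_on k W (\<lambda>x. B (f x) (g x))"
  using assms(3,4)
proof (induction k arbitrary: f g)
  case 0
  then show ?case using assms(2) by (auto intro: bounded_bilinear.continuous_on)
next
  case (Suc k)
  show ?case
    using Suc assms(1)
    by (intro Ck_on_SucI[where F = "\<lambda>x v. B (f x) (frechet_derivative g (at x) v) + B (frechet_derivative f (at x) v) (g x)"]
        bounded_bilinear.FDERIV[OF assms(2)] Ck_on_differentiable[OF Suc.prems(1)]
        Ck_on_differentiable[OF Suc.prems(2)] Ck_on_add Suc.IH
        Ck_on_decrease[OF Suc.prems(1)] Ck_on_decrease[OF Suc.prems(2)]) auto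
qed

text \<open>\<open>Ck_on\<close> controls the derivative only along fixed vectors, whereas the chain
  rule evaluates the derivative of \<open>g\<close> at the moving vector given by that of
  \<open>f\<close>. Expanding this vector in \<open>Basis\<close> leaves fixed vectors and scalar
  coefficients, so the induction hypothesis, for all \<open>g\<close> but fixed \<open>f\<close>,
  applies to each term.\<close>

lemma Ck_on_compose:
  fixes f :: "'a::euclidean_space \<Rightarrow> 'b::euclidean_space" and g :: "'b \<Rightarrow> 'c::real_normed_vector"
  assumes "open W" "open V" "f ` W \<subseteq> V" "Ck_on k W f" "Ck_on k V g"
  shows "Ck_on k W (\<lambda>x. g (f x))"
  using assms(4,5)
proof (induction k arbitrary: g)
  case 0
  then show ?case using assms(3) by (auto intro: continuous_on_compose2)
next
  case (Suc k)
  let ?F = "\<lambda>x v. \<Sum>b\<in>Basis. (frechet_derivative f (at x) v \<bullet> b) *\<^sub>R frechet_derivative g (at (f x)) b"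
  show ?case
  proof (rule Ck_on_SucI[where F = ?F])
    show "((\<lambda>x. g (f x)) has_derivative ?F x) (at x)" if "x \<in> W" for x
    proof -
      have f: "(f has_derivative frechet_derivative f (at x)) (at x)"
        using Ck_on_differentiable Suc.prems(1) assms(1) that by blast
      have g: "(g has_derivative frechet_derivative g (at (f x))) (at (f x))"
        using Ck_on_differentiable Suc.prems(2) assms(2,3) that by blast
      have lin: "linear (frechet_derivative g (at (f x)))"
        using g has_derivative_linear by blast
      have "frechet_derivative g (at (f x)) u = (\<Sum>b\<in>Basis. (u \<bullet> b) *\<^sub>R frechet_derivative g (at (f x)) b)" for u
      proof -
        have "frechet_derivative g (at (f x)) (\<Sum>b\<in>Basis. (u \<bullet> b) *\<^sub>R b)
            = (\<Sum>b\<in>Basis. (u \<bullet> b) *\<^sub>R frechet_derivative g (at (f x)) b)"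
          by (simp add: linear_sum[OF lin] linear_scale[OF lin])
        then show ?thesis by (simp add: euclidean_representation)
      qed
      then have "?F x = (\<lambda>v. frechet_derivative g (at (f x)) (frechet_derivative f (at x) v))"
        by (intro ext) (rule sym)
      then show ?thesis
        using has_derivative_compose[OF f g] by (simp only:)
    qed
    fix v
    have fk: "Ck_on k W f" using Suc.prems(1) Ck_on_decrease by blast
    show "Ck_on k W (\<lambda>x. ?F x v)"
    proof (rule Ck_on_sum[OF assms(1) finite_Basis],
        rule Ck_on_bilinear[OF assms(1) bounded_bilinear_scaleR])
      fix b :: 'b assume "b \<in> Basis"
      show "Ck_on k W (\<lambda>x. frechet_derivative f (at x) v \<bullet> b)"
        using Suc.prems(1) Ck_on_bounded_linear_compose[OF assms(1) bounded_linear_inner_left] by auto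
      show "Ck_on k W (\<lambda>x. frechet_derivative g (at (f x)) b)"
        using Suc.prems(2) Suc.IH[OF fk, of "\<lambda>y. frechet_derivative g (at y) b"] by auto
    qed
  qed (rule assms(1))
qed

text \<open>The complex derivative is again holomorphic, so one induction gives all orders. The
  functions \<open>exp\<close>, \<open>csqrt\<close> and \<open>Ln\<close> become smooth through
  this lemma.\<close>

lemma Ck_on_holomorphic:
  assumes "open W" "f holomorphic_on W"
  shows "Ck_on k W f"
  using assms(2)
proof (induction k arbitrary: f)
  case 0
  then show ?case by (simp add: holomorphic_on_imp_continuous_on)
next
  case (Suc k)
  show ?case
  proof (rule Ck_on_SucI[where F = "\<lambda>x v. deriv f x * v"])
    show "(f has_derivative (\<lambda>v. deriv f x * v)) (at x)" if "x \<in> W" for x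
      using holomorphic_derivI[OF Suc.prems assms(1) that] has_field_derivative_imp_has_derivative
      by blast
    show "Ck_on k W (\<lambda>x. deriv f x * v)" for v
      by (intro Suc.IH holomorphic_on_mult holomorphic_deriv[OF Suc.prems assms(1)] holomorphic_on_const)
  qed (rule assms(1))
qed

section \<open>Smooth maps on arbitrary subsets, through local extensions\<close>

lemma smooth_onI_open: "open W \<Longrightarrow> (\<And>k. Ck_on k W f) \<Longrightarrow> smooth_on W f"
  unfolding smooth_on_def by blast

text \<open>At a point of an open set the local extension coincides with \<open>f\<close> on a full
  neighbourhood, so \<open>f\<close> itself has class \<open>k\<close> there; the local pieces are
  then glued.\<close>

lemma smooth_on_openD:
  assumes "open W" "smooth_on W f"
  shows "Ck_on k W f"
proof -
  have loc: "\<exists>V. open V \<and> x \<in> V \<and> V \<subseteq> W \<and> Ck_on k V f" if x: "x \<in> W" for x k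
  proof -
    obtain V g where V: "open V" "x \<in> V" "Ck_on k V g" "\<forall>y\<in>W \<inter> V. g y = f y"
      using assms(2) x unfolding smooth_on_def by metis
    have "Ck_on k (W \<inter> V) f"
      using Ck_on_cong[of "W \<inter> V" g f k] Ck_on_subset[OF V(3)] V assms(1) by auto
    then show ?thesis using V(1,2) x assms(1) by (intro exI[of _ "W \<inter> V"]) auto
  qed
  \<comment> \<open>Stated for every function and order, because the induction passes from
    \<open>h\<close> to its directional derivatives.\<close>
  have glue: "Ck_on k W h" if "\<And>x. x \<in> W \<Longrightarrow> \<exists>V. open V \<and> x \<in> V \<and> V \<subseteq> W \<and> Ck_on k V h" for k and h :: "'a \<Rightarrow> 'b"
    using that
  proof (induction k arbitrary: h)
    case 0
    then show ?case
      unfolding Ck_on.simps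
      by (metis at_within_open continuous_on_eq_continuous_within subsetD assms(1))
  next
    case (Suc k)
    have "h differentiable_on W"
      unfolding differentiable_on_def
    proof
      fix x assume "x \<in> W"
      then obtain V where "open V" "x \<in> V" "Ck_on (Suc k) V h" using Suc.prems by blast
      then show "h differentiable (at x within W)"
        using Ck_on_differentiable differentiable_at_withinI differentiable_def by blast
    qed
    moreover have "Ck_on k W (\<lambda>x. frechet_derivative h (at x) v)" for v
    proof (rule Suc.IH)
      fix x assume "x \<in> W"
      then obtain V where "open V" "x \<in> V" "V \<subseteq> W" "Ck_on (Suc k) V h" using Suc.prems by blast
      then show "\<exists>V. open V \<and> x \<in> V \<and> V \<subseteq> W \<and> Ck_on k V (\<lambda>x. frechet_derivative h (at x) v)"
        by (intro exI[of _ V]) simp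
    qed
    ultimately show ?case by simp
  qed
  show ?thesis by (rule glue) (rule loc)
qed

lemma smooth_on_subset: "smooth_on S f \<Longrightarrow> T \<subseteq> S \<Longrightarrow> smooth_on T f"
  unfolding smooth_on_def
proof
  fix x assume S: "\<forall>x\<in>S. \<exists>W g. open W \<and> x \<in> W \<and> (\<forall>k. Ck_on k W g) \<and> (\<forall>y\<in>S \<inter> W. g y = f y)"
    and T: "T \<subseteq> S" and x: "x \<in> T"
  have "x \<in> S" using T x by auto
  from bspec[OF S this] obtain W g where "open W" "x \<in> W" "\<forall>k. Ck_on k W g" "\<forall>y\<in>S \<inter> W. g y = f y"
    by (elim exE conjE)
  then show "\<exists>W g. open W \<and> x \<in> W \<and> (\<forall>k. Ck_on k W g) \<and> (\<forall>y\<in>T \<inter> W. g y = f y)"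
    using T by (intro exI[of _ W] exI[of _ g]) auto
qed

lemma smooth_on_cong: "smooth_on S f \<Longrightarrow> (\<And>x. x \<in> S \<Longrightarrow> f x = g x) \<Longrightarrow> smooth_on S g"
  unfolding smooth_on_def
proof
  fix x assume S: "\<forall>x\<in>S. \<exists>W g. open W \<and> x \<in> W \<and> (\<forall>k. Ck_on k W g) \<and> (\<forall>y\<in>S \<inter> W. g y = f y)"
    and eq: "\<And>x. x \<in> S \<Longrightarrow> f x = g x" and x: "x \<in> S"
  from bspec[OF S x] obtain W h where "open W" "x \<in> W" "\<forall>k. Ck_on k W h" "\<forall>y\<in>S \<inter> W. h y = f y"
    by (elim exE conjE)
  then show "\<exists>W h. open W \<and> x \<in> W \<and> (\<forall>k. Ck_on k W h) \<and> (\<forall>y\<in>S \<inter> W. h y = g y)"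
    using eq by (intro exI[of _ W] exI[of _ h]) auto
qed

lemma smooth_on_local:
  assumes "\<And>x. x \<in> S \<Longrightarrow> \<exists>V. openin (top_of_set S) V \<and> x \<in> V \<and> smooth_on V f"
  shows "smooth_on S f"
  unfolding smooth_on_def
proof
  fix x assume "x \<in> S"
  then obtain V where V: "openin (top_of_set S) V" "x \<in> V" "smooth_on V f" using assms by blast
  obtain O1 where O1: "open O1" "V = S \<inter> O1" using V(1) by (auto simp: openin_open)
  obtain O2 g where O2: "open O2" "x \<in> O2" "\<forall>k. Ck_on k O2 g" "\<forall>y\<in>V \<inter> O2. g y = f y"
    using V(2,3) unfolding smooth_on_def by metis
  have "Ck_on k (O1 \<inter> O2) g" for k
    by (rule Ck_on_subset[OF spec[OF O2(3)]]) auto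
  then show "\<exists>W g. open W \<and> x \<in> W \<and> (\<forall>k. Ck_on k W g) \<and> (\<forall>y\<in>S \<inter> W. g y = f y)"
    using O1 O2(1,2,4) V(2) by (intro exI[of _ "O1 \<inter> O2"] exI[of _ g]) auto
qed

lemma smooth_on_compose:
  fixes f :: "'a::euclidean_space \<Rightarrow> 'b::euclidean_space" and g :: "'b \<Rightarrow> 'c::real_normed_vector"
  assumes "smooth_on S f" "smooth_on T g" "f ` S \<subseteq> T"
  shows "smooth_on S (\<lambda>x. g (f x))"
  unfolding smooth_on_def
proof
  fix x assume x: "x \<in> S"
  obtain V f' where V: "open V" "x \<in> V" "\<forall>k. Ck_on k V f'" "\<forall>y\<in>S \<inter> V. f' y = f y"
    using assms(1) x unfolding smooth_on_def by metis
  obtain U g' where U: "open U" "f x \<in> U" "\<forall>k. Ck_on k U g'" "\<forall>y\<in>T \<inter> U. g' y = g y"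
    using assms(2,3) x unfolding smooth_on_def by (metis image_subset_iff)
  have cont: "continuous_on V f'" using V(3) Ck_on.simps(1) by blast
  let ?W = "V \<inter> f' -` U"
  have op: "open ?W" using cont V(1) U(1) by (simp add: continuous_open_preimage)
  have "Ck_on k ?W (\<lambda>x. g' (f' x))" for k
    by (rule Ck_on_compose[OF op U(1) _ Ck_on_subset[OF spec[OF V(3)]] spec[OF U(3)]]) auto
  moreover have "x \<in> ?W" using V(2,4) U(2) x by auto
  moreover have "\<forall>y\<in>S \<inter> ?W. g' (f' y) = g (f y)"
    using V(4) U(4) assms(3) by (auto simp: image_subset_iff)
  ultimately show "\<exists>W h. open W \<and> x \<in> W \<and> (\<forall>k. Ck_on k W h) \<and> (\<forall>y\<in>S \<inter> W. h y = g (f y))"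
    using op by (intro exI[of _ ?W] exI[of _ "\<lambda>x. g' (f' x)"]) auto
qed

lemma smooth_on_const: "smooth_on S (\<lambda>x. c)"
  unfolding smooth_on_def by (metis Ck_on_const UNIV_I open_UNIV)

lemma smooth_on_linear: "bounded_linear f \<Longrightarrow> smooth_on S f"
  unfolding smooth_on_def by (metis Ck_on_linear UNIV_I open_UNIV)

lemma smooth_on_id: "smooth_on S (\<lambda>x. x)"
  by (rule smooth_on_linear) (rule bounded_linear_ident)

lemma smooth_on_bounded_linear_compose:
  assumes "bounded_linear L" "smooth_on S f"
  shows "smooth_on S (\<lambda>x. L (f x))"
  using assms(2) Ck_on_bounded_linear_compose[OF _ assms(1)] unfolding smooth_on_def by metis

lemma smooth_on_bilinear:
  assumes "bounded_bilinear B" "smooth_on S f" "smooth_on S g"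
  shows "smooth_on S (\<lambda>x. B (f x) (g x))"
  unfolding smooth_on_def
proof
  fix x assume x: "x \<in> S"
  obtain V f' where V: "open V" "x \<in> V" "\<forall>k. Ck_on k V f'" "\<forall>y\<in>S \<inter> V. f' y = f y"
    using assms(2) x unfolding smooth_on_def by metis
  obtain U g' where U: "open U" "x \<in> U" "\<forall>k. Ck_on k U g'" "\<forall>y\<in>S \<inter> U. g' y = g y"
    using assms(3) x unfolding smooth_on_def by metis
  have "Ck_on k (V \<inter> U) (\<lambda>x. B (f' x) (g' x))" for k
    by (intro Ck_on_bilinear[OF _ assms(1)] Ck_on_subset[OF spec[OF V(3)]] Ck_on_subset[OF spec[OF U(3)]])
      (use V(1) U(1) in auto)
  then show "\<exists>W h. open W \<and> x \<in> W \<and> (\<forall>k. Ck_on k W h) \<and> (\<forall>y\<in>S \<inter> W. h y = B (f y) (g y))"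
    using V U by (intro exI[of _ "V \<inter> U"] exI[of _ "\<lambda>x. B (f' x) (g' x)"]) auto
qed

lemma smooth_on_add:
  assumes "smooth_on S f" "smooth_on S g"
  shows "smooth_on S (\<lambda>x. f x + g x)"
  unfolding smooth_on_def
proof
  fix x assume x: "x \<in> S"
  obtain V f' where V: "open V" "x \<in> V" "\<forall>k. Ck_on k V f'" "\<forall>y\<in>S \<inter> V. f' y = f y"
    using assms(1) x unfolding smooth_on_def by metis
  obtain U g' where U: "open U" "x \<in> U" "\<forall>k. Ck_on k U g'" "\<forall>y\<in>S \<inter> U. g' y = g y"
    using assms(2) x unfolding smooth_on_def by metis
  have "Ck_on k (V \<inter> U) (\<lambda>x. f' x + g' x)" for k
    by (intro Ck_on_add Ck_on_subset[OF spec[OF V(3)]] Ck_on_subset[OF spec[OF U(3)]])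
      (use V(1) U(1) in auto)
  then show "\<exists>W h. open W \<and> x \<in> W \<and> (\<forall>k. Ck_on k W h) \<and> (\<forall>y\<in>S \<inter> W. h y = f y + g y)"
    using V U by (intro exI[of _ "V \<inter> U"] exI[of _ "\<lambda>x. f' x + g' x"]) auto
qed

lemma smooth_on_sum:
  assumes "\<And>i. i \<in> I \<Longrightarrow> smooth_on S (f i)"
  shows "smooth_on S (\<lambda>x. \<Sum>i\<in>I. f i x)"
  using assms by (induction I rule: infinite_finite_induct) (auto intro: smooth_on_const smooth_on_add)

lemma smooth_on_mult:
  fixes f g :: "'a::euclidean_space \<Rightarrow> 'b::real_normed_algebra"
  shows "smooth_on S f \<Longrightarrow> smooth_on S g \<Longrightarrow> smooth_on S (\<lambda>x. f x * g x)"
  by (rule smooth_on_bilinear[OF bounded_bilinear_mult])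

lemma smooth_on_scaleR:
  "smooth_on S f \<Longrightarrow> smooth_on S g \<Longrightarrow> smooth_on S (\<lambda>x. f x *\<^sub>R g x)"
  by (rule smooth_on_bilinear[OF bounded_bilinear_scaleR])

lemma smooth_on_diff:
  "smooth_on S f \<Longrightarrow> smooth_on S g \<Longrightarrow> smooth_on S (\<lambda>x. f x - g x)"
  using smooth_on_add[of S f "\<lambda>x. - g x"]
    smooth_on_bounded_linear_compose[OF bounded_linear_minus[OF bounded_linear_ident], of S g]
  by simp

lemma smooth_on_Pair:
  fixes f :: "'a::euclidean_space \<Rightarrow> 'b::real_normed_vector" and g :: "'a \<Rightarrow> 'c::real_normed_vector"
  assumes "smooth_on S f" "smooth_on S g"
  shows "smooth_on S (\<lambda>x. (f x, g x))"
proof -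
  have "bounded_linear (\<lambda>x::'b. (x, 0::'c))" "bounded_linear (\<lambda>x::'c. (0::'b, x))"
    by (auto intro!: bounded_linear_Pair bounded_linear_ident bounded_linear_zero)
  from smooth_on_add[OF smooth_on_bounded_linear_compose[OF this(1) assms(1)]
      smooth_on_bounded_linear_compose[OF this(2) assms(2)]]
  show ?thesis by simp
qed

lemma smooth_on_vec_lambda:
  fixes f :: "'j::finite \<Rightarrow> 'a::euclidean_space \<Rightarrow> 'b::euclidean_space"
  assumes "\<And>j. smooth_on S (f j)"
  shows "smooth_on S (\<lambda>x. \<chi> j. f j x)"
proof -
  have lin: "bounded_linear (axis j :: 'b \<Rightarrow> 'b ^ 'j)" for j :: 'j
    unfolding linear_conv_bounded_linear[symmetric] by (auto simp: linear_iff axis_def vec_eq_iff)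
  have "(\<Sum>j\<in>UNIV. axis j (f j x)) = (\<chi> j. f j x)" for x
    by (auto simp: vec_eq_iff axis_def if_distrib sum_component sum.delta cong: if_cong)
  then show ?thesis
    using smooth_on_sum[of UNIV S "\<lambda>j x. axis j (f j x)"] smooth_on_bounded_linear_compose[OF lin assms]
    by simp
qed

lemma smooth_on_vec_nth: "smooth_on S f \<Longrightarrow> smooth_on S (\<lambda>x. f x $ j)"
  by (rule smooth_on_bounded_linear_compose[OF bounded_linear_vec_nth])

lemma smooth_on_holomorphic:
  assumes "open T" "g holomorphic_on T" "smooth_on S f" "f ` S \<subseteq> T"
  shows "smooth_on S (\<lambda>x. g (f x))"
  by (rule smooth_on_compose[OF assms(3) smooth_onI_open[OF assms(1) Ck_on_holomorphic[OF assms(1,2)]] assms(4)])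

text \<open>On positive numbers the real square root is the restriction of \<open>csqrt\<close>,
  which is holomorphic off the nonpositive real axis.\<close>

lemma smooth_on_sqrt:
  assumes "smooth_on S f" "\<And>x. x \<in> S \<Longrightarrow> f x > 0"
  shows "smooth_on S (\<lambda>x. sqrt (f x))"
proof -
  have "smooth_on S (\<lambda>x. csqrt (of_real (f x)))"
  proof (rule smooth_on_holomorphic[of "- \<real>\<^sub>\<le>\<^sub>0" csqrt S "\<lambda>x. of_real (f x)"])
    show "csqrt holomorphic_on - \<real>\<^sub>\<le>\<^sub>0"
      by (auto intro: holomorphic_on_csqrt holomorphic_on_csqrt')
    show "open (- \<real>\<^sub>\<le>\<^sub>0 :: complex set)"
      by (simp add: open_Compl)
    show "smooth_on S (\<lambda>x. complex_of_real (f x))"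
      by (rule smooth_on_bounded_linear_compose[OF bounded_linear_of_real assms(1)])
    show "(\<lambda>x. complex_of_real (f x)) ` S \<subseteq> - \<real>\<^sub>\<le>\<^sub>0"
      using assms(2) by (auto simp: image_subset_iff not_le)
  qed
  then have "smooth_on S (\<lambda>x. Re (csqrt (of_real (f x))))"
    by (rule smooth_on_bounded_linear_compose[OF bounded_linear_Re])
  then show ?thesis
    by (rule smooth_on_cong) (use assms(2) in \<open>force simp: of_real_sqrt[symmetric] less_imp_le\<close>)
qed

lemma smooth_on_imp_continuous_on: "smooth_on S f \<Longrightarrow> continuous_on S f"
proof (rule continuous_on_eq_continuous_within[THEN iffD2], rule ballI)
  fix x assume f: "smooth_on S f" and x: "x \<in> S"
  obtain V g where V: "open V" "x \<in> V" "\<forall>k. Ck_on k V g" "\<forall>y\<in>S \<inter> V. g y = f y"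
    using f x unfolding smooth_on_def by metis
  have "isCont g x" using V(1-3) Ck_on.simps(1) continuous_on_eq_continuous_at by blast
  then have "continuous (at x within S) g" by (rule continuous_at_imp_continuous_within)
  moreover obtain d where "d > 0" "ball x d \<subseteq> V" using V(1,2) openE by blast
  ultimately show "continuous (at x within S) f"
    using V(4) x by (auto intro: continuous_transform_within[of x S g d f] simp: subset_iff dist_commute)
qed

text \<open>The derivative of a local extension serves. It need not be unique when \<open>S\<close>
  is thin, but \<open>pulls_back\<close> is quantified over all derivatives within the set, so any
  one may be used.\<close>

lemma smooth_on_has_derivative_within:
  assumes "smooth_on S f" "x \<in> S"
  obtains f' where "(f has_derivative f') (at x within S)"
proof -
  obtain V g where V: "open V" "x \<in> V" "\<forall>k. Ck_on k V g" "\<forall>y\<in>S \<inter> V. g y = f y"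
    using assms unfolding smooth_on_def by metis
  have "(g has_derivative frechet_derivative g (at x)) (at x within S)"
    using Ck_on_differentiable V(1-3) has_derivative_at_withinI by blast
  moreover obtain d where "d > 0" "ball x d \<subseteq> V" using V(1,2) openE by blast
  ultimately show ?thesis
    using V(4) assms(2) by (intro that[of "frechet_derivative g (at x)"] has_derivative_transform_within[of g _ x S d f])
      (auto simp: subset_iff dist_commute)
qed

lemma smooth_on_open_derivative:
  assumes "open S" "smooth_on S f"
  shows "x \<in> S \<Longrightarrow> (f has_derivative frechet_derivative f (at x)) (at x)"
    and "continuous_on S (\<lambda>x. frechet_derivative f (at x) v)"
proof -
  have C: "Ck_on (Suc 0) S f" by (rule smooth_on_openD[OF assms])
  show "x \<in> S \<Longrightarrow> (f has_derivative frechet_derivative f (at x)) (at x)"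
    by (rule Ck_on_differentiable[OF C assms(1)])
  show "continuous_on S (\<lambda>x. frechet_derivative f (at x) v)"
    using C by simp
qed

section \<open>Universal covers and changes of charts\<close>

lemma path_class_eq: "homotopic_paths W g h \<Longrightarrow> path_class W g = path_class W h"
  unfolding path_class_def by (auto intro: homotopic_paths_trans homotopic_paths_sym)

lemma path_class_eqD:
  assumes "path_class W g = path_class W h" "path g" "path_image g \<subseteq> W"
  shows "homotopic_paths W g h"
proof -
  have "g \<in> path_class W h"
    using assms unfolding path_class_def by auto
  then show ?thesis unfolding path_class_def by (auto intro: homotopic_paths_sym)
qed

lemma based_pathsD:
  assumes "g \<in> based_paths W"
  shows "path g" "path_image g \<subseteq> W" "pathstart g = base_point W"
  using assms by (auto simp: based_paths_def)

lemma based_paths_join: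
  assumes "g \<in> based_paths W" "path h" "path_image h \<subseteq> W" "pathstart h = pathfinish g"
  shows "g +++ h \<in> based_paths W"
  using assms unfolding based_paths_def by (auto simp: path_image_join)

lemma ucover_proj_class:
  assumes "g \<in> based_paths W"
  shows "ucover_proj (path_class W g) = pathfinish g"
proof -
  have "g \<in> path_class W g"
    using based_pathsD[OF assms] by (simp add: path_class_def)
  then have "(SOME h. h \<in> path_class W g) \<in> path_class W g" by (rule someI[of "\<lambda>h. h \<in> path_class W g"])
  then show ?thesis
    unfolding ucover_proj_def by (simp add: path_class_def homotopic_paths_imp_pathfinish)
qed

lemma topspace_ucover_top [simp]: "topspace (ucover_top W) = ucover W"
proof
  show "topspace (ucover_top W) \<subseteq> ucover W"
    unfolding ucover_top_def topology_generated_by_topspace ucover_def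
    by (auto simp: openin_subset dest: openin_imp_subset intro!: imageI based_paths_join)
  show "ucover W \<subseteq> topspace (ucover_top W)"
  proof
    fix C assume "C \<in> ucover W"
    then obtain g where g: "g \<in> based_paths W" "C = path_class W g" by (auto simp: ucover_def)
    define h where "h = linepath (pathfinish g) (pathfinish g)"
    have fin: "pathfinish g \<in> W" using based_pathsD[OF g(1)] pathfinish_in_path_image by blast
    have "homotopic_paths W (g +++ h) g"
      unfolding h_def using based_pathsD[OF g(1)] by (intro homotopic_paths_rid)
    then have "C = path_class W (g +++ h)" using g(2) path_class_eq by metis
    moreover have "path h" "path_image h \<subseteq> W" "pathstart h = pathfinish g"
      using fin by (auto simp: h_def)
    ultimately have C: "C \<in> {path_class W (g +++ h) | h. path h \<and> path_image h \<subseteq> W \<and> pathstart h = pathfinish g}"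
      by blast
    have "{path_class W (g +++ h) | h. path h \<and> path_image h \<subseteq> W \<and> pathstart h = pathfinish g}
      \<in> {{path_class W (g +++ h) | h. path h \<and> path_image h \<subseteq> B \<and> pathstart h = pathfinish g} | g B.
        g \<in> based_paths W \<and> openin (top_of_set W) B \<and> pathfinish g \<in> B}"
      using g(1) fin openin_subtopology_self by blast
    then show "C \<in> topspace (ucover_top W)"
      using C unfolding ucover_top_def topology_generated_by_topspace by (rule UnionI)
  qed
qed

text \<open>The generating sets form a basis, not just a subbasis: if the class of \<open>g\<close>
  lies in the set centred at \<open>g'\<close>, so that \<open>g\<close> is homotopic to
  \<open>g' +++ k\<close>, then every \<open>g +++ h\<close> is homotopic to
  \<open>g' +++ (k +++ h)\<close>, and the same \<open>B\<close> works with the centre moved to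
  \<open>g\<close>.\<close>

lemma openin_ucover_topD:
  assumes "openin (ucover_top W) S" "g \<in> based_paths W" "path_class W g \<in> S"
  shows "\<exists>B. openin (top_of_set W) B \<and> pathfinish g \<in> B \<and>
    {path_class W (g +++ h) | h. path h \<and> path_image h \<subseteq> B \<and> pathstart h = pathfinish g} \<subseteq> S"
proof -
  let ?\<B> = "{{path_class W (g +++ h) | h. path h \<and> path_image h \<subseteq> B \<and> pathstart h = pathfinish g} | g B.
        g \<in> based_paths W \<and> openin (top_of_set W) B \<and> pathfinish g \<in> B}"
  have "generate_topology_on ?\<B> S"
    using assms(1) unfolding ucover_top_def openin_topology_generated_by_iff .
  then show ?thesis
    using assms(3)
  proof (induction S rule: generate_topology_on.induct)
    case Empty
    then show ?case by simp
  next
    case (Int S1 S2)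
    then obtain B1 B2 where
      "openin (top_of_set W) B1" "pathfinish g \<in> B1"
      "{path_class W (g +++ h) | h. path h \<and> path_image h \<subseteq> B1 \<and> pathstart h = pathfinish g} \<subseteq> S1"
      "openin (top_of_set W) B2" "pathfinish g \<in> B2"
      "{path_class W (g +++ h) | h. path h \<and> path_image h \<subseteq> B2 \<and> pathstart h = pathfinish g} \<subseteq> S2"
      by auto
    then show ?case by (intro exI[of _ "B1 \<inter> B2"]) (auto intro: openin_Int)
  next
    case (UN K)
    then obtain S where S: "S \<in> K" "path_class W g \<in> S" by blast
    from UN.IH[OF S] obtain B where B: "openin (top_of_set W) B" "pathfinish g \<in> B"
      "{path_class W (g +++ h) | h. path h \<and> path_image h \<subseteq> B \<and> pathstart h = pathfinish g} \<subseteq> S"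
      by (elim exE conjE)
    show ?case
      by (intro exI[of _ B] conjI B(1,2) subset_trans[OF B(3)] Sup_upper S(1))
  next
    case (Basis S)
    then obtain g' B where S: "S = {path_class W (g' +++ h) | h. path h \<and> path_image h \<subseteq> B \<and> pathstart h = pathfinish g'}"
      and g': "g' \<in> based_paths W" and B: "openin (top_of_set W) B" "pathfinish g' \<in> B"
      by blast
    have BW: "B \<subseteq> W" using B(1) openin_imp_subset by blast
    obtain k where k: "path_class W g = path_class W (g' +++ k)" "path k" "path_image k \<subseteq> B"
      "pathstart k = pathfinish g'"
      using Basis.prems unfolding S by blast
    have hom: "homotopic_paths W g (g' +++ k)"
      using path_class_eqD[OF k(1)] based_pathsD[OF assms(2)] by blast
    have fin: "pathfinish g = pathfinish k"
      using homotopic_paths_imp_pathfinish[OF hom] by simp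
    have "path_class W (g +++ h) \<in> S" if h: "path h" "path_image h \<subseteq> B" "pathstart h = pathfinish g" for h
    proof -
      have "homotopic_paths W (g +++ h) ((g' +++ k) +++ h)"
        using hom h BW by (intro homotopic_paths_join) auto
      moreover have "homotopic_paths W ((g' +++ k) +++ h) (g' +++ (k +++ h))"
        using based_pathsD[OF g'] k h BW fin
        by (intro homotopic_paths_sym[OF homotopic_paths_assoc]) auto
      ultimately have "path_class W (g +++ h) = path_class W (g' +++ (k +++ h))"
        by (intro path_class_eq) (rule homotopic_paths_trans)
      moreover have "path (k +++ h)" "path_image (k +++ h) \<subseteq> B" "pathstart (k +++ h) = pathfinish g'"
        using k h fin by (auto simp: path_image_join)
      ultimately show ?thesis unfolding S by blast
    qed
    moreover have "pathfinish g \<in> B" using k fin pathfinish_in_path_image by fastforce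
    ultimately show ?case using B(1) by (intro exI[of _ B]) auto
  qed
qed

text \<open>Any point of a path-connected neighbourhood of the end point of \<open>g\<close> is
  reached by prolonging \<open>g\<close> inside it, and the prolonged class stays in
  \<open>S\<close>. This is how sheets of the universal cover yield open sets in chart
  domains.\<close>

lemma openin_ucover_proj_image:
  fixes W :: "'e::euclidean_space set"
  assumes "locally path_connected W" "openin (ucover_top W) S"
  shows "openin (top_of_set W) (ucover_proj ` S)"
proof (subst openin_subopen, intro ballI)
  fix y assume "y \<in> ucover_proj ` S"
  then obtain C where C: "C \<in> S" "y = ucover_proj C" by blast
  then have "C \<in> ucover W" using openin_subset[OF assms(2)] by auto
  then obtain g where g: "g \<in> based_paths W" "C = path_class W g" by (auto simp: ucover_def)
  have y: "y = pathfinish g" using C(2) g ucover_proj_class by metis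
  obtain B where B: "openin (top_of_set W) B" "pathfinish g \<in> B"
    "{path_class W (g +++ h) | h. path h \<and> path_image h \<subseteq> B \<and> pathstart h = pathfinish g} \<subseteq> S"
    using openin_ucover_topD[OF assms(2) g(1)] C(1) g(2) by auto
  obtain V where V: "openin (top_of_set W) V" "path_connected V" "pathfinish g \<in> V" "V \<subseteq> B"
    using assms(1) B(1,2) unfolding locally_path_connected by meson
  have VW: "V \<subseteq> W" using V(1) openin_imp_subset by blast
  have "V \<subseteq> ucover_proj ` S"
  proof
    fix z assume "z \<in> V"
    then obtain h where h: "path h" "path_image h \<subseteq> V" "pathstart h = pathfinish g" "pathfinish h = z"
      using V(2,3) unfolding path_connected_def by blast
    then have "path_class W (g +++ h) \<in> S" using B(3) V(4) by blast
    moreover have "ucover_proj (path_class W (g +++ h)) = z"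
      using h VW by (subst ucover_proj_class[OF based_paths_join[OF g(1)]]) auto
    ultimately show "z \<in> ucover_proj ` S" by blast
  qed
  then show "\<exists>T. openin (top_of_set W) T \<and> y \<in> T \<and> T \<subseteq> ucover_proj ` S"
    using V(1,3) y by blast
qed

lemma ucover_proj_surj:
  assumes "path_connected W" "x \<in> W"
  obtains C where "C \<in> ucover W" "ucover_proj C = x"
proof -
  have "base_point W \<in> W" unfolding base_point_def using assms(2) by (rule someI)
  then obtain g where g: "path g" "path_image g \<subseteq> W" "pathstart g = base_point W" "pathfinish g = x"
    using assms unfolding path_connected_def by blast
  then have "g \<in> based_paths W" by (simp add: based_paths_def)
  then show ?thesis
    using that[of "path_class W g"] ucover_proj_class g(4) by (auto simp: ucover_def)
qed

lemma locally_path_connected_open_in_span: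
  "openin (top_of_set (span U)) U \<Longrightarrow> locally path_connected U" for U :: "'e::euclidean_space set"
  by (rule locally_open_subset[OF convex_imp_locally_path_connected[OF subspace_imp_convex[OF subspace_span]]])

lemma openin_overlap_preimage:
  assumes "quasifold_chart T k a" "quasifold_chart T k b"
  shows "openin (top_of_set (cdom a)) (overlap_preimage a b)"
proof -
  have q: "quotient_map (top_of_set (cdom a)) (subtopology T (cim a)) (cmap a)" and "openin T (cim b)" "openin T (cim a)"
    using assms by (auto simp: quasifold_chart_def)
  then have "openin (subtopology T (cim a)) (cim a \<inter> cim b)"
    by (metis openin_subtopology_Int2 inf.commute)
  moreover have "continuous_map (top_of_set (cdom a)) (subtopology T (cim a)) (cmap a)"
    using q quotient_imp_continuous_map by blast
  ultimately have "openin (top_of_set (cdom a)) {x \<in> topspace (top_of_set (cdom a)). cmap a x \<in> cim a \<inter> cim b}"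
    by (rule openin_continuous_map_preimage[rotated])
  moreover have "{x \<in> topspace (top_of_set (cdom a)). cmap a x \<in> cim a \<inter> cim b} = overlap_preimage a b"
    by (auto simp: overlap_preimage_def cim_def)
  ultimately show ?thesis by simp
qed

text \<open>A change of charts has local lifts that are diffeomorphisms between open sets of the
  covering manifolds themselves, without passing to universal covers.\<close>

lemma local_change_of_charts:
  fixes a b :: "('e::euclidean_space, 'x) chart"
  assumes a: "quasifold_chart T k a" and b: "quasifold_chart T k b" and "compatible_charts a b"
    and x: "x \<in> cdom a" "cmap a x \<in> cim b"
  obtains V \<tau> \<rho> where "openin (top_of_set (cdom a)) V" "x \<in> V" "smooth_on V \<tau>" "\<tau> ` V \<subseteq> cdom b"
    "openin (top_of_set (cdom b)) (\<tau> ` V)" "smooth_on (\<tau> ` V) \<rho>"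
    "\<And>u. u \<in> V \<Longrightarrow> \<rho> (\<tau> u) = u" "\<And>u. u \<in> V \<Longrightarrow> cmap b (\<tau> u) = cmap a u"
proof -
  let ?A = "overlap_preimage a b" and ?B = "overlap_preimage b a"
  have "cim a \<inter> cim b \<noteq> {}" using x by (auto simp: cim_def)
  then obtain F where sub: "submodel a ?A" "submodel b ?B" and F: "change_of_charts_lift a b F"
    using assms(3) unfolding compatible_charts_def by blast
  have lpc: "locally path_connected ?A" "locally path_connected ?B"
    using sub unfolding submodel_def premodel_def by (auto intro: locally_path_connected_open_in_span)
  moreover have "connected ?A"
    using sub unfolding submodel_def premodel_def by auto
  ultimately have pc: "path_connected ?A"
    using lpc(1) path_component_eq_connected_component_set[of ?A]
    by (simp add: path_connected_component_set connected_component_eq_self)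
  have xA: "x \<in> ?A" using x by (simp add: overlap_preimage_def)
  obtain C where C: "C \<in> ucover ?A" "ucover_proj C = x" using ucover_proj_surj[OF pc xA] by blast
  have hom: "homeomorphic_map (ucover_top ?A) (ucover_top ?B) F"
    and sm1: "smooth_on_ucover ?A (ucover_proj \<circ> F)"
    and sm2: "smooth_on_ucover ?B (ucover_proj \<circ> inv_into (ucover ?A) F)"
    and comm: "\<And>y. y \<in> ucover ?A \<Longrightarrow> cmap b (ucover_proj (F y)) = cmap a (ucover_proj y)"
    using F unfolding change_of_charts_lift_def ucover_diffeo_def by auto
  have Fim: "F ` ucover ?A = ucover ?B" using homeomorphic_imp_surjective_map[OF hom] by simp
  have Finj: "inj_on F (ucover ?A)" using homeomorphic_imp_injective_map[OF hom] by simp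
  obtain S1 where S1: "sheet ?A S1" "C \<in> S1"
    "smooth_on (ucover_proj ` S1) ((ucover_proj \<circ> F) \<circ> inv_into S1 ucover_proj)"
    using sm1 C(1) unfolding smooth_on_ucover_def by blast
  obtain S2 where S2: "sheet ?B S2" "F C \<in> S2"
    "smooth_on (ucover_proj ` S2) ((ucover_proj \<circ> inv_into (ucover ?A) F) \<circ> inv_into S2 ucover_proj)"
    using sm2 C(1) Fim unfolding smooth_on_ucover_def by blast
  \<comment> \<open>The projection is injective on \<open>S\<close>, and also on the image of
    \<open>S\<close> under \<open>F\<close>, which lies in the sheet \<open>S2\<close>; hence
    \<open>F\<close> descends to a map \<open>\<tau>\<close> on \<open>V\<close> and its inverse to
    \<open>\<rho>\<close>. The point \<open>C\<close> over \<open>x\<close> belongs to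
    \<open>S\<close>.\<close>
  define S where "S = S1 \<inter> {c \<in> topspace (ucover_top ?A). F c \<in> S2}"
  have oS: "openin (ucover_top ?A) S"
    unfolding S_def using S1(1) S2(1) homeomorphic_imp_continuous_map[OF hom]
    by (intro openin_Int openin_continuous_map_preimage) (auto simp: sheet_def)
  have SA: "S \<subseteq> ucover ?A" by (auto simp: S_def)
  have CS: "C \<in> S" using C S1(2) S2(2) by (simp add: S_def)
  define V where "V = ucover_proj ` S"
  define \<tau> where "\<tau> = (ucover_proj \<circ> F) \<circ> inv_into S1 ucover_proj"
  define \<rho> where "\<rho> = (ucover_proj \<circ> inv_into (ucover ?A) F) \<circ> inv_into S2 ucover_proj"
  have \<tau>: "\<tau> (ucover_proj c) = ucover_proj (F c)" if "c \<in> S" for c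
    using that S1(1) by (simp add: \<tau>_def S_def sheet_def)
  have \<rho>: "\<rho> (ucover_proj (F c)) = ucover_proj c" if "c \<in> S" for c
    using that S2(1) Finj by (simp add: \<rho>_def S_def sheet_def)
  have \<tau>V: "\<tau> ` V = ucover_proj ` (F ` S)"
    using \<tau> by (force simp: V_def)
  have oFS: "openin (ucover_top ?B) (F ` S)"
    using homeomorphic_imp_open_map[OF hom] oS unfolding open_map_def by blast
  have "openin (top_of_set ?A) V"
    unfolding V_def by (rule openin_ucover_proj_image[OF lpc(1) oS])
  then have 1: "openin (top_of_set (cdom a)) V"
    using openin_overlap_preimage[OF a b] openin_trans by blast
  have "openin (top_of_set ?B) (\<tau> ` V)"
    unfolding \<tau>V by (rule openin_ucover_proj_image[OF lpc(2) oFS])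
  then have 2: "openin (top_of_set (cdom b)) (\<tau> ` V)"
    using openin_overlap_preimage[OF b a] openin_trans by blast
  have VS1: "V \<subseteq> ucover_proj ` S1" by (auto simp: V_def S_def)
  have VS2: "\<tau> ` V \<subseteq> ucover_proj ` S2" unfolding \<tau>V by (auto simp: S_def)
  show ?thesis
  proof (rule that[OF 1 _ _ _ 2])
    show "x \<in> V" using C CS by (auto simp: V_def)
    show "smooth_on V \<tau>" unfolding \<tau>_def by (rule smooth_on_subset[OF S1(3) VS1])
    show "\<tau> ` V \<subseteq> cdom b" using openin_imp_subset[OF 2] .
    show "smooth_on (\<tau> ` V) \<rho>" unfolding \<rho>_def by (rule smooth_on_subset[OF S2(3) VS2])
    show "\<rho> (\<tau> u) = u" if "u \<in> V" for u
      using that \<tau> \<rho> by (auto simp: V_def)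
    show "cmap b (\<tau> u) = cmap a u" if "u \<in> V" for u
      using that \<tau> comm SA by (auto simp: V_def)
  qed
qed

section \<open>Pull-backs along lifts that differ by a countable group\<close>

text \<open>Otherwise some closed ball in \<open>V\<close> misses all the interiors. In it each
  \<open>C i\<close> has a dense, relatively open complement, so by Baire's theorem the intersection
  of these complements is dense, although the cover makes it empty. The closed ball supplies the
  complete space that Baire's theorem asks for.\<close>

lemma countable_closed_cover_interiors_dense:
  fixes V :: "'a::euclidean_space set"
  assumes V: "open V" and I: "countable I" and C: "\<And>i. i \<in> I \<Longrightarrow> closedin (top_of_set V) (C i)"
    and cover: "V \<subseteq> (\<Union>i\<in>I. C i)"
  shows "V \<subseteq> closure (\<Union>i\<in>I. interior (C i))"
proof
  fix x assume x: "x \<in> V"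
  show "x \<in> closure (\<Union>i\<in>I. interior (C i))"
  proof (rule ccontr)
    let ?D = "- closure (\<Union>i\<in>I. interior (C i))"
    assume "x \<notin> closure (\<Union>i\<in>I. interior (C i))"
    then have "x \<in> V \<inter> ?D" "open (V \<inter> ?D)" using x V by (auto intro: open_Int)
    then obtain r where r: "r > 0" "cball x r \<subseteq> V \<inter> ?D"
      using open_contains_cball by blast
    have dense: "cball x r \<subseteq> closure (cball x r - C i)" if i: "i \<in> I" for i
    proof -
      \<comment> \<open>Points of the open ball come first: \<open>G \<inter> ball x r\<close> is
        open in the whole space, so it cannot lie in \<open>C i\<close>. The boundary follows
        because the closed ball is the closure of the open one.\<close>
      have "ball x r \<subseteq> closure (cball x r - C i)"
      proof
        fix z assume z: "z \<in> ball x r"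
        show "z \<in> closure (cball x r - C i)"
        proof (subst closure_iff_nhds_not_empty, intro allI impI)
          fix A G assume G: "G \<subseteq> A" "open G" "z \<in> G"
          have "\<not> G \<inter> ball x r \<subseteq> C i"
          proof
            assume "G \<inter> ball x r \<subseteq> C i"
            then have "z \<in> interior (C i)"
              using G z by (intro interiorI[of "G \<inter> ball x r"]) auto
            then have "z \<in> closure (\<Union>i\<in>I. interior (C i))"
              using i closure_subset[of "\<Union>i\<in>I. interior (C i)"] by blast
            moreover have "z \<in> cball x r" using z by simp
            ultimately show False using r(2) by blast
          qed
          then show "(cball x r - C i) \<inter> A \<noteq> {}" using G(1) ball_subset_cball by blast
        qed
      qed
      then have "closure (ball x r) \<subseteq> closure (cball x r - C i)"
        using closure_minimal by blast
      then show ?thesis using r(1) by simp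
    qed
    have "cball x r \<subseteq> closure (\<Inter>((\<lambda>i. cball x r - C i) ` I))"
    proof (rule Baire)
      show "openin (top_of_set (cball x r)) T \<and> cball x r \<subseteq> closure T"
        if T: "T \<in> (\<lambda>i. cball x r - C i) ` I" for T
      proof -
        obtain i where i: "i \<in> I" "T = cball x r - C i" using T by blast
        obtain K where K: "closed K" "C i = V \<inter> K" using C[OF i(1)] by (auto simp: closedin_closed)
        have "T = cball x r \<inter> - K" using i(2) K(2) r(2) by auto
        then have "openin (top_of_set (cball x r)) T" using K(1) by (auto intro: openin_open_Int)
        moreover have "cball x r \<subseteq> closure T" using dense[OF i(1)] i(2) by simp
        ultimately show ?thesis by blast
      qed
    qed (use I in auto)
    moreover have "I \<noteq> {}" using cover x by auto
    moreover have "\<Inter>((\<lambda>i. cball x r - C i) ` I) = {}"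
    proof (rule ccontr)
      assume "\<Inter>((\<lambda>i. cball x r - C i) ` I) \<noteq> {}"
      then obtain y where y: "\<And>i. i \<in> I \<Longrightarrow> y \<in> cball x r - C i" by blast
      then have "y \<in> V" using \<open>I \<noteq> {}\<close> r(2) by blast
      then show False using cover y by blast
    qed
    ultimately have "cball x r \<subseteq> {}" by (simp only: closure_empty)
    then show False using r(1) by simp
  qed
qed

text \<open>A vector orthogonal to \<open>S\<close> has inner product zero with every
  \<open>c t\<close>, hence with \<open>v\<close>. The component of \<open>v\<close> orthogonal to
  \<open>span S\<close> is therefore orthogonal to itself.\<close>

lemma derivative_in_span:
  fixes c :: "real \<Rightarrow> 'a::euclidean_space"
  assumes "e > 0" "c ` {-e<..<e} \<subseteq> S" "(c has_vector_derivative v) (at 0)"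
  shows "v \<in> span S"
proof -
  have perp: "v \<bullet> y = 0" if y: "\<And>w. w \<in> span S \<Longrightarrow> w \<bullet> y = 0" for y
  proof -
    have "((\<lambda>t. c t \<bullet> y) has_vector_derivative v \<bullet> y) (at 0)"
      by (rule bounded_linear.has_vector_derivative[OF bounded_linear_inner_left assms(3)])
    moreover have "((\<lambda>t. c t \<bullet> y) has_vector_derivative 0) (at 0)"
    proof (rule has_vector_derivative_transform_within_open[OF has_vector_derivative_const])
      show "open {-e<..<e}" "0 \<in> {-e<..<e}" using assms(1) by auto
      fix t assume "t \<in> {-e<..<e}"
      then have "c t \<in> S" using assms(2) by auto
      then show "0 = c t \<bullet> y" using y span_base by metis
    qed
    ultimately show ?thesis by (rule vector_derivative_unique_at)
  qed
  obtain p q where pq: "p \<in> span S" "\<And>w. w \<in> span S \<Longrightarrow> orthogonal q w" "v = p + q"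
    using orthogonal_subspace_decomp_exists[of S v] by metis
  have "v \<bullet> q = 0" using pq(2) by (intro perp) (auto simp: orthogonal_def inner_commute)
  moreover have "p \<bullet> q = 0" using pq(1,2) by (simp add: orthogonal_def inner_commute)
  ultimately have "q = 0" using pq(3) by (simp add: inner_add_left)
  then show ?thesis using pq by simp
qed

text \<open>\<open>two_form_on\<close> speaks of vectors of \<open>span U\<close> only; tangent
  vectors qualify by this inclusion.\<close>

lemma tangent_space_subset_span: "tangent_space S x \<subseteq> span S"
  unfolding tangent_space_def using derivative_in_span by blast

text \<open>The curve is the image of the straight line through \<open>x\<close> in direction
  \<open>v\<close>. Tangency in this sense is what \<open>pulls_back\<close> requires of its
  vectors.\<close>

lemma smooth_derivative_in_tangent_space:
  fixes f :: "'a::euclidean_space \<Rightarrow> 'b::euclidean_space"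
  assumes "open V" "smooth_on V f" "f ` V \<subseteq> S" "x \<in> V" "(f has_derivative f') (at x)"
  shows "f' v \<in> tangent_space S (f x)"
proof -
  define l where "l = (\<lambda>t::real. x + t *\<^sub>R v)"
  have l0: "l 0 = x" by (simp add: l_def)
  have l: "(l has_derivative (\<lambda>t. t *\<^sub>R v)) (at 0)"
    unfolding l_def by (auto intro!: derivative_eq_intros)
  have sml: "smooth_on T l" for T
    unfolding l_def
    by (intro smooth_on_add smooth_on_const smooth_on_linear bounded_linear_scaleR_left)
  have "open (l -` V)"
    unfolding l_def using assms(1) by (intro open_vimage) (auto intro!: continuous_intros)
  moreover have "0 \<in> l -` V" using assms(4) l0 by simp
  ultimately obtain e where e: "e > 0" "ball 0 e \<subseteq> l -` V" using openE by blast
  then have e': "l ` {-e<..<e} \<subseteq> V" by (auto simp: subset_iff)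
  have "((\<lambda>t. f (l t)) has_derivative (\<lambda>t. f' (t *\<^sub>R v))) (at 0)"
    using has_derivative_compose[OF l, of f f'] assms(5) l0 by simp
  moreover have "f' (t *\<^sub>R v) = t *\<^sub>R f' v" for t
    using assms(5) has_derivative_linear linear_scale by blast
  ultimately have "((\<lambda>t. f (l t)) has_vector_derivative f' v) (at 0)"
    unfolding has_vector_derivative_def by simp
  moreover have "smooth_on {-e<..<e} (\<lambda>t. f (l t))"
    by (rule smooth_on_compose[OF sml assms(2) e'])
  moreover have "(\<lambda>t. f (l t)) ` {-e<..<e} \<subseteq> S" using e' assms(3) by auto
  ultimately show ?thesis
    unfolding tangent_space_def using e(1) l0 by (intro CollectI exI[of _ e] conjI exI[of _ "\<lambda>t. f (l t)"]) auto
qed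

lemma two_form_on_sum_left:
  assumes "two_form_on U \<omega>" "x \<in> U" "w \<in> span U" "finite B" "B \<subseteq> span U"
  shows "\<omega> x (\<Sum>b\<in>B. f b *\<^sub>R b) w = (\<Sum>b\<in>B. f b * \<omega> x b w)"
proof -
  have form: "\<omega> x (u + v) w = \<omega> x u w + \<omega> x v w" "\<omega> x (r *\<^sub>R u) w = r * \<omega> x u w"
    if "u \<in> span U" "v \<in> span U" for u v r
    using assms(1-3) that unfolding two_form_on_def by blast+
  have zero: "\<omega> x 0 w = 0" using form(2)[OF span_zero span_zero, of 0] by simp
  show ?thesis
    using assms(4,5)
  proof (induction B rule: finite_induct)
    case (insert b B)
    have "(\<Sum>b\<in>B. f b *\<^sub>R b) \<in> span U"
      using insert.prems by (intro span_sum span_scale) auto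
    moreover have "f b *\<^sub>R b \<in> span U" "b \<in> span U" using insert.prems by (auto intro: span_scale)
    ultimately show ?case using insert form by simp
  qed (simp add: zero)
qed

text \<open>\<open>two_form_on\<close> gives smoothness in the base point only for constant vectors.
  With an orthonormal basis of \<open>span U\<close> the coefficients of the moving vectors are
  inner products, which vary continuously.\<close>

lemma continuous_on_two_form:
  fixes U :: "'e::euclidean_space set" and G :: "'c::topological_space \<Rightarrow> 'e"
  assumes "two_form_on U \<omega>" "continuous_on V G" "G ` V \<subseteq> U"
    and "continuous_on V p" "p ` V \<subseteq> span U" "continuous_on V q" "q ` V \<subseteq> span U"
  shows "continuous_on V (\<lambda>y. \<omega> (G y) (p y) (q y))"
proof -
  obtain B where B: "B \<subseteq> span U" "pairwise orthogonal B" "\<And>x. x \<in> B \<Longrightarrow> norm x = 1"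
    "independent B" "span B = span U"
    using orthonormal_basis_subspace[OF subspace_span] by metis
  have fin: "finite B" using B(4) independent_imp_finite by blast
  have anti: "\<omega> x v w = - \<omega> x w v" if "x \<in> U" "v \<in> span U" "w \<in> span U" for x v w
    using assms(1) that unfolding two_form_on_def by blast
  have expand: "(\<Sum>b\<in>B. (v \<bullet> b) *\<^sub>R b) = v" if "v \<in> span U" for v
    using orthonormal_basis_expand[OF B(2,3) _ fin] that B(5) by blast
  have left: "\<omega> x v w = (\<Sum>b\<in>B. (v \<bullet> b) * \<omega> x b w)" if "x \<in> U" "v \<in> span U" "w \<in> span U" for x v w
    using two_form_on_sum_left[OF assms(1) that(1,3) fin B(1), of "\<lambda>b. v \<bullet> b"] expand[OF that(2)] by simp
  \<comment> \<open>Linearity is given in the first slot and reaches the second through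
    antisymmetry.\<close>
  have right: "\<omega> x b w = (\<Sum>c\<in>B. (w \<bullet> c) * \<omega> x b c)" if "x \<in> U" "b \<in> B" "w \<in> span U" for x b w
  proof -
    have b: "b \<in> span U" using that(2) B(1) by auto
    have "\<omega> x b w = - (\<Sum>c\<in>B. (w \<bullet> c) * \<omega> x c b)"
      using anti[OF that(1) b that(3)] left[OF that(1,3) b] by simp
    also have "\<dots> = (\<Sum>c\<in>B. (w \<bullet> c) * \<omega> x b c)"
      unfolding sum_negf[symmetric]
    proof (rule sum.cong[OF refl])
      fix c assume "c \<in> B"
      then show "- ((w \<bullet> c) * \<omega> x c b) = (w \<bullet> c) * \<omega> x b c"
        using anti[OF that(1) b, of c] B(1) by auto
    qed
    finally show ?thesis .
  qed
  have "continuous_on V (\<lambda>y. \<Sum>b\<in>B. (p y \<bullet> b) * (\<Sum>c\<in>B. (q y \<bullet> c) * \<omega> (G y) b c))"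
  proof (intro continuous_on_sum continuous_on_mult continuous_on_inner continuous_on_const assms(4,6))
    fix b c assume bc: "b \<in> B" "c \<in> B"
    then have "smooth_on U (\<lambda>x. \<omega> x b c)"
      using assms(1) B(1) unfolding two_form_on_def by blast
    from continuous_on_compose2[OF smooth_on_imp_continuous_on[OF this] assms(2,3)]
    show "continuous_on V (\<lambda>y. \<omega> (G y) b c)" .
  qed
  moreover have "(\<Sum>b\<in>B. (p y \<bullet> b) * (\<Sum>c\<in>B. (q y \<bullet> c) * \<omega> (G y) b c)) = \<omega> (G y) (p y) (q y)"
    if "y \<in> V" for y
  proof -
    have y: "G y \<in> U" "p y \<in> span U" "q y \<in> span U" using that assms by auto
    show ?thesis
      unfolding left[OF y] by (intro sum.cong refl) (simp add: right[OF y(1) _ y(3)])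
  qed
  ultimately show ?thesis
    by (simp cong: continuous_on_cong)
qed

text \<open>The inner map starts from an open set, so the composite has an ordinary derivative
  although \<open>f\<close> is differentiated only within \<open>U\<close>.\<close>

lemma has_derivative_compose_within:
  assumes "open V" "p \<in> V" "(\<gamma> has_derivative \<gamma>') (at p)" "\<gamma> ` V \<subseteq> U"
    and "(f has_derivative f') (at (\<gamma> p) within U)"
  shows "((\<lambda>q. f (\<gamma> q)) has_derivative (\<lambda>u. f' (\<gamma>' u))) (at p)"
  using has_derivative_in_compose[OF has_derivative_at_withinI[OF assms(3), of V]]
    has_derivative_subset[OF assms(5,4)] at_within_open[OF assms(2,1)] by auto

text \<open>Two lifts differing pointwise by elements of a countable group need not differ by a single
  group element, but by Baire they do so locally on a dense open set; the pull-backs of an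
  invariant form agree there, hence everywhere by continuity.\<close>

lemma lifts_pull_back_eq:
  fixes U :: "'e::euclidean_space set" and V :: "'c::euclidean_space set"
  assumes form: "two_form_on U \<omega>" and count: "countable G"
    and G: "\<And>g. g \<in> G \<Longrightarrow> smooth_on U g" "\<And>g. g \<in> G \<Longrightarrow> pulls_back g U \<omega> \<omega>"
    and V: "open V" and f1: "smooth_on V f1" "f1 ` V \<subseteq> U" and f2: "smooth_on V f2" "f2 ` V \<subseteq> U"
    and lift: "\<And>y. y \<in> V \<Longrightarrow> \<exists>g\<in>G. f2 y = g (f1 y)"
    and x: "x \<in> V" and D1: "(f1 has_derivative f1') (at x)" and D2: "(f2 has_derivative f2') (at x)"
  shows "\<omega> (f1 x) (f1' v) (f1' w) = \<omega> (f2 x) (f2' v) (f2' w)"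
proof -
  let ?D1 = "\<lambda>y. frechet_derivative f1 (at y)" and ?D2 = "\<lambda>y. frechet_derivative f2 (at y)"
  let ?\<alpha>1 = "\<lambda>y. \<omega> (f1 y) (?D1 y v) (?D1 y w)" and ?\<alpha>2 = "\<lambda>y. \<omega> (f2 y) (?D2 y v) (?D2 y w)"
  note d1 = smooth_on_open_derivative[OF V f1(1)] and d2 = smooth_on_open_derivative[OF V f2(1)]
  have tan1: "?D1 y u \<in> tangent_space U (f1 y)" if "y \<in> V" for y u
    by (rule smooth_derivative_in_tangent_space[OF V f1 that d1(1)[OF that]])
  have tan2: "?D2 y u \<in> tangent_space U (f2 y)" if "y \<in> V" for y u
    by (rule smooth_derivative_in_tangent_space[OF V f2 that d2(1)[OF that]])
  have c1: "continuous_on V ?\<alpha>1"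
    using tan1 tangent_space_subset_span
    by (intro continuous_on_two_form[OF form] smooth_on_imp_continuous_on[OF f1(1)] f1(2) d1(2)) blast+
  have c2: "continuous_on V ?\<alpha>2"
    using tan2 tangent_space_subset_span
    by (intro continuous_on_two_form[OF form] smooth_on_imp_continuous_on[OF f2(1)] f2(2) d2(2)) blast+
  define C where "C g = {y \<in> V. f2 y - g (f1 y) = 0}" for g
  have closed: "closedin (top_of_set V) (C g)" if "g \<in> G" for g
  proof -
    have "continuous_on V (\<lambda>y. f2 y - g (f1 y))"
      using smooth_on_imp_continuous_on[OF f2(1)]
        smooth_on_imp_continuous_on[OF smooth_on_compose[OF f1(1) G(1)[OF that] f1(2)]]
      by (intro continuous_on_diff)
    then show ?thesis unfolding C_def by (rule continuous_closedin_preimage_constant)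
  qed
  have "V \<subseteq> (\<Union>g\<in>G. C g)" using lift by (auto simp: C_def)
  note dense = countable_closed_cover_interiors_dense[OF V count closed this]
  have eq: "?\<alpha>1 y = ?\<alpha>2 y" if y: "y \<in> interior (C g)" and g: "g \<in> G" for y g
  proof -
    have sub: "interior (C g) \<subseteq> V" using interior_subset[of "C g"] by (auto simp: C_def)
    then have yV: "y \<in> V" using y by blast
    \<comment> \<open>\<open>U\<close> may have empty interior, so \<open>g\<close> has a derivative
      only within \<open>U\<close>. It still determines \<open>?D2 y\<close>, because
      \<open>f2\<close> equals \<open>g\<close> after \<open>f1\<close> on a full neighbourhood of
      \<open>y\<close>.\<close>
    obtain g' where g': "(g has_derivative g') (at (f1 y) within U)"
      using smooth_on_has_derivative_within[OF G(1)[OF g]] f1(2) yV by blast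
    have "((\<lambda>z. g (f1 z)) has_derivative (\<lambda>u. g' (?D1 y u))) (at y)"
      by (rule has_derivative_compose_within[OF V yV d1(1)[OF yV] f1(2) g'])
    moreover have "g (f1 z) = f2 z" if "z \<in> interior (C g)" for z
      using that interior_subset[of "C g"] by (auto simp: C_def)
    ultimately have "(f2 has_derivative (\<lambda>u. g' (?D1 y u))) (at y)"
      by (rule has_derivative_transform_within_open[OF _ open_interior y])
    then have D2': "?D2 y = (\<lambda>u. g' (?D1 y u))"
      using frechet_derivative_at by metis
    have fy: "f2 y = g (f1 y)" "f1 y \<in> U"
      using y interior_subset[of "C g"] f1(2) yV by (auto simp: C_def)
    show ?thesis
      using G(2)[OF g] g' fy tan1[OF yV] unfolding pulls_back_def D2' by metis
  qed
  have "closedin (top_of_set V) {y \<in> V. ?\<alpha>1 y - ?\<alpha>2 y = 0}"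
    by (rule continuous_closedin_preimage_constant[OF continuous_on_diff[OF c1 c2]])
  then obtain K where K: "closed K" "{y \<in> V. ?\<alpha>1 y - ?\<alpha>2 y = 0} = V \<inter> K"
    by (auto simp: closedin_closed)
  have "(\<Union>g\<in>G. interior (C g)) \<subseteq> {y \<in> V. ?\<alpha>1 y - ?\<alpha>2 y = 0}"
  proof
    fix y assume "y \<in> (\<Union>g\<in>G. interior (C g))"
    then obtain g where g: "g \<in> G" "y \<in> interior (C g)" by blast
    then have "y \<in> V" using interior_subset[of "C g"] by (auto simp: C_def)
    then show "y \<in> {y \<in> V. ?\<alpha>1 y - ?\<alpha>2 y = 0}" using eq[OF g(2,1)] by simp
  qed
  then have "closure (\<Union>g\<in>G. interior (C g)) \<subseteq> K"
    using K closure_minimal by (metis Int_lower2 subset_trans)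
  then have "x \<in> {y \<in> V. ?\<alpha>1 y - ?\<alpha>2 y = 0}" using dense x K(2) by blast
  then have "?\<alpha>1 x = ?\<alpha>2 x" by simp
  moreover have "?D1 x = f1'" "?D2 x = f2'" using D1 D2 frechet_derivative_at by metis+
  ultimately show ?thesis by simp
qed

section \<open>Torus actions\<close>

lemma norm_texp [simp]: "cmod (texp x $ j) = 1"
  by (simp add: texp_def norm_exp_eq_Re)

lemma tmul_texp_add: "tmul (texp x) (tmul (texp y) z) = tmul (texp (x + y)) z"
  by (simp add: vec_eq_iff tmul_def texp_def exp_add[symmetric] distrib_left mult.assoc[symmetric])

lemma tmul_texp_0 [simp]: "tmul (texp 0) z = z"
  by (simp add: vec_eq_iff tmul_def texp_def)

lemma tmul_nth [simp]: "tmul a z $ j = a $ j * z $ j"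
  by (simp add: tmul_def)

lemma linear_pi_map: "linear (pi_map X)"
  by (rule linearI) (simp_all add: pi_map_def scaleR_add_left sum.distrib scaleR_sum_right)

lemma quasilattice_zero: "quasilattice Q \<Longrightarrow> 0 \<in> Q"
  unfolding quasilattice_def by (auto intro!: exI[of _ "\<lambda>_. 0"])

lemma quasilattice_add:
  assumes "quasilattice Q" "a \<in> Q" "b \<in> Q"
  shows "a + b \<in> Q"
proof -
  obtain S where S: "Q = {\<Sum>v\<in>S. of_int (k v) *\<^sub>R v | k :: 'a \<Rightarrow> int. True}"
    using assms(1) by (auto simp: quasilattice_def)
  obtain k l where "a = (\<Sum>v\<in>S. of_int (k v) *\<^sub>R v)" "b = (\<Sum>v\<in>S. of_int (l v) *\<^sub>R v)"
    using assms(2,3) unfolding S by blast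
  then have "a + b = (\<Sum>v\<in>S. of_int (k v + l v) *\<^sub>R v)"
    by (simp add: sum.distrib scaleR_add_left)
  then show ?thesis unfolding S by (intro CollectI exI[of _ "\<lambda>v. k v + l v"]) simp
qed

lemma quasilattice_uminus:
  assumes "quasilattice Q" "a \<in> Q"
  shows "- a \<in> Q"
proof -
  obtain S where S: "Q = {\<Sum>v\<in>S. of_int (k v) *\<^sub>R v | k :: 'a \<Rightarrow> int. True}"
    using assms(1) by (auto simp: quasilattice_def)
  obtain k where "a = (\<Sum>v\<in>S. of_int (k v) *\<^sub>R v)"
    using assms(2) unfolding S by blast
  then have "- a = (\<Sum>v\<in>S. of_int (- k v) *\<^sub>R v)"
    by (simp add: sum_negf)
  then show ?thesis unfolding S by (intro CollectI exI[of _ "\<lambda>v. - k v"]) simp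
qed

section \<open>Orbits of \<open>N\<close> and the action of the quasitorus on them\<close>

lemma mem_N_orbit_iff: "w \<in> N_orbit X Q z \<longleftrightarrow> (\<exists>x. pi_map X x \<in> Q \<and> w = tmul (texp x) z)"
  by (auto simp: N_orbit_def N_grp_def)

lemma self_mem_N_orbit: "quasilattice Q \<Longrightarrow> z \<in> N_orbit X Q z"
  unfolding mem_N_orbit_iff
  by (intro exI[of _ 0]) (simp add: linear_0[OF linear_pi_map] quasilattice_zero)

lemma N_orbit_tmul:
  assumes "quasilattice Q" "pi_map X x \<in> Q"
  shows "N_orbit X Q (tmul (texp x) z) = N_orbit X Q z"
proof (intro Set.set_eqI iffI)
  fix w assume "w \<in> N_orbit X Q (tmul (texp x) z)"
  then obtain y where "pi_map X y \<in> Q" "w = tmul (texp (y + x)) z"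
    by (auto simp: mem_N_orbit_iff tmul_texp_add)
  then show "w \<in> N_orbit X Q z"
    using assms quasilattice_add unfolding mem_N_orbit_iff
    by (intro exI[of _ "y + x"]) (simp add: linear_add[OF linear_pi_map])
next
  fix w assume "w \<in> N_orbit X Q z"
  then obtain y where y: "pi_map X y \<in> Q" "w = tmul (texp y) z"
    by (auto simp: mem_N_orbit_iff)
  then have "pi_map X (y - x) \<in> Q"
    using assms quasilattice_add[OF assms(1) y(1) quasilattice_uminus[OF assms]]
    by (simp add: linear_diff[OF linear_pi_map])
  then show "w \<in> N_orbit X Q (tmul (texp x) z)"
    using y unfolding mem_N_orbit_iff by (intro exI[of _ "y - x"]) (simp add: tmul_texp_add)
qed

lemma N_orbit_eqD:
  assumes "quasilattice Q" "N_orbit X Q z = N_orbit X Q w"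
  obtains x where "pi_map X x \<in> Q" "w = tmul (texp x) z"
  using self_mem_N_orbit[OF assms(1), of w X] unfolding assms(2)[symmetric] mem_N_orbit_iff by blast

lemma mem_qclass_iff: "Y \<in> qclass Q Z \<longleftrightarrow> Y - Z \<in> Q"
  unfolding qclass_def by (auto simp: image_iff algebra_simps intro!: bexI[of _ "Y - Z"])

text \<open>\<open>D_act\<close> lets every representative of the coset act on every point of the
  orbit. Both choices are ambiguous by elements of \<open>N\<close> only, so a single
  \<open>N\<close>-orbit results, and one representative of each kind computes it.\<close>

lemma D_act_N_orbit:
  assumes "quasilattice Q"
  shows "D_act X (qclass Q (pi_map X x)) (N_orbit X Q z) = N_orbit X Q (tmul (texp x) z)"
proof (intro Set.set_eqI iffI)
  fix w assume "w \<in> D_act X (qclass Q (pi_map X x)) (N_orbit X Q z)"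
  then obtain y u where yu: "pi_map X y - pi_map X x \<in> Q" "pi_map X u \<in> Q"
    "w = tmul (texp y) (tmul (texp u) z)"
    by (auto simp: D_act_def mem_qclass_iff mem_N_orbit_iff)
  have "pi_map X (y - x + u) \<in> Q"
    using quasilattice_add[OF assms yu(1,2)]
    by (simp add: linear_add[OF linear_pi_map] linear_diff[OF linear_pi_map])
  then show "w \<in> N_orbit X Q (tmul (texp x) z)"
    unfolding mem_N_orbit_iff yu(3)
    by (intro exI[of _ "y - x + u"]) (simp add: tmul_texp_add algebra_simps)
next
  fix w assume "w \<in> N_orbit X Q (tmul (texp x) z)"
  then obtain u where u: "pi_map X u \<in> Q" "w = tmul (texp u) (tmul (texp x) z)"
    by (auto simp: mem_N_orbit_iff)
  then have "pi_map X (u + x) \<in> qclass Q (pi_map X x)"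
    by (simp add: mem_qclass_iff linear_add[OF linear_pi_map])
  then show "w \<in> D_act X (qclass Q (pi_map X x)) (N_orbit X Q z)"
    unfolding D_act_def using u(2) self_mem_N_orbit[OF assms, of z X]
    by (intro CollectI exI[of _ "u + x"] exI[of _ z]) (simp add: tmul_texp_add)
qed

lemma Ups_tmul [simp]: "Ups lam (tmul (texp x) z) v = Ups lam z v"
  by (simp add: Ups_def norm_mult)

lemma Psi_zero_tmul [simp]: "tmul (texp x) z \<in> Psi_zero X lam \<longleftrightarrow> z \<in> Psi_zero X lam"
  by (simp add: Psi_zero_def)

lemma linear_Ups: "linear (Ups lam z)"
  by (rule linearI) (simp_all add: Ups_def sum.distrib distrib_left sum_distrib_left mult.left_commute)

text \<open>On the zero level \<open>Ups lam z\<close> vanishes on the kernel of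
  \<open>pi_map X\<close>, hence factors through \<open>pi_map X\<close>; \<open>\<nu>\<close>
  represents the factor under the inner product. Surjectivity makes it unique, so the definite
  description in \<open>Phi\<close> denotes it.\<close>

lemma Phi_N_orbit:
  assumes "quasilattice Q" "surj (pi_map X)" "z \<in> Psi_zero X lam"
  shows "Phi X lam (N_orbit X Q z) \<bullet> pi_map X v = Ups lam z v"
proof -
  obtain s where s: "linear s" "pi_map X \<circ> s = id"
    using linear_surjective_right_inverse[OF linear_pi_map assms(2)] by blast
  have ps: "pi_map X (s Y) = Y" for Y using s(2) by (metis comp_apply id_apply)
  define \<nu> where "\<nu> = (\<Sum>b\<in>Basis. Ups lam z (s b) *\<^sub>R b)"
  have \<nu>: "\<nu> \<bullet> pi_map X v = Ups lam z v" for v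
  proof -
    have "linear (\<lambda>Y. Ups lam z (s Y))"
      using linear_compose[OF s(1) linear_Ups] by (simp add: o_def)
    then have lin: "linear (\<lambda>Y. Ups lam z (s Y))" .
    have "Ups lam z (s Y) = \<nu> \<bullet> Y" for Y
    proof -
      have "Ups lam z (s Y) = Ups lam z (s (\<Sum>b\<in>Basis. (Y \<bullet> b) *\<^sub>R b))"
        by (simp only: euclidean_representation)
      also have "\<dots> = (\<Sum>b\<in>Basis. (Y \<bullet> b) * Ups lam z (s b))"
        by (simp add: linear_sum[OF lin] linear_scale[OF lin])
      also have "\<dots> = \<nu> \<bullet> Y"
        by (simp add: \<nu>_def inner_sum_left inner_sum_right inner_commute mult.commute)
      finally show ?thesis .
    qed
    then have "\<nu> \<bullet> pi_map X v = Ups lam z (s (pi_map X v))" by simp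
    also have "\<dots> = Ups lam z v"
    proof -
      have "pi_map X (s (pi_map X v) - v) = 0"
        using ps by (simp add: linear_diff[OF linear_pi_map])
      then show ?thesis
        using assms(3) by (auto simp: Psi_zero_def linear_diff[OF linear_Ups])
    qed
    finally show ?thesis .
  qed
  have "Phi X lam (N_orbit X Q z) = \<nu>"
    unfolding Phi_def
  proof (rule the_equality)
    show "\<forall>z\<in>N_orbit X Q z. \<forall>v. \<nu> \<bullet> pi_map X v = Ups lam z v"
      using \<nu> by (auto simp: mem_N_orbit_iff)
    fix \<mu> assume \<mu>: "\<forall>z\<in>N_orbit X Q z. \<forall>v. \<mu> \<bullet> pi_map X v = Ups lam z v"
    have "\<mu> \<bullet> Y = \<nu> \<bullet> Y" for Y
      using \<mu> self_mem_N_orbit[OF assms(1)] \<nu> ps by metis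
    then show "\<mu> = \<nu>" by (metis vector_eq_rdot)
  qed
  then show ?thesis using \<nu> by simp
qed

section \<open>Calculus of the torus action, of \<open>omega0\<close> and of the moment map on the
  ambient space\<close>

lemma smooth_on_tmul_texp:
  assumes "smooth_on S f" "smooth_on S g"
  shows "smooth_on S (\<lambda>y. tmul (texp (f y)) (g y))"
proof -
  have "smooth_on S (\<lambda>y. exp (2 * of_real pi * \<i> * of_real (f y $ j)))" for j
  proof (rule smooth_on_holomorphic[of UNIV exp S "\<lambda>y. 2 * of_real pi * \<i> * of_real (f y $ j)"])
    show "smooth_on S (\<lambda>y. 2 * of_real pi * \<i> * of_real (f y $ j))"
      by (intro smooth_on_mult smooth_on_const smooth_on_bounded_linear_compose[OF bounded_linear_of_real]
          smooth_on_vec_nth assms(1))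
  qed (auto intro: holomorphic_on_exp)
  then have "smooth_on S (\<lambda>y. \<chi> j. exp (2 * of_real pi * \<i> * of_real (f y $ j)) * g y $ j)"
    by (intro smooth_on_vec_lambda smooth_on_mult smooth_on_vec_nth assms(2))
  then show ?thesis by (simp add: tmul_def texp_def)
qed

lemma omega0_tmul_texp [simp]: "omega0 (tmul (texp x) v) (tmul (texp x) w) = omega0 v w"
proof -
  have "texp x $ j * a * cnj (texp x $ j * b) = a * cnj b" for j a b
  proof -
    have "texp x $ j * a * cnj (texp x $ j * b) = (texp x $ j * cnj (texp x $ j)) * (a * cnj b)"
      by simp
    also have "texp x $ j * cnj (texp x $ j) = 1" by (simp add: complex_norm_square[symmetric])
    finally show ?thesis by simp
  qed
  then show ?thesis by (simp only: omega0_def tmul_nth)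
qed

text \<open>The derivative of the torus action along \<open>x\<close> is the symplectic gradient of \<open>Ups lam _ x\<close>.\<close>

lemma omega0_rotation:
  "omega0 (\<chi> j. 2 * of_real pi * \<i> * of_real (x $ j) * z $ j) w = (\<Sum>j\<in>UNIV. 2 * x $ j * (z $ j \<bullet> w $ j))"
proof -
  have "Re ((2 * of_real pi * \<i> * of_real r * a * cnj b - b * cnj (2 * of_real pi * \<i> * of_real r * a)) / (2 * of_real pi * \<i>))
      = 2 * r * (a \<bullet> b)" for r a b
  proof -
    have "(2 * of_real pi * \<i> * of_real r * a * cnj b - b * cnj (2 * of_real pi * \<i> * of_real r * a)) / (2 * of_real pi * \<i>)
      = of_real r * (a * cnj b + b * cnj a)"
      by (simp add: field_simps)
    also have "Re \<dots> = 2 * r * (a \<bullet> b)"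
      by (simp add: inner_complex_def algebra_simps)
    finally show ?thesis .
  qed
  then show ?thesis by (simp add: omega0_def sum_divide_distrib)
qed

lemma tmul_texp_has_vector_derivative:
  "((\<lambda>t. tmul (texp (t *\<^sub>R x)) z) has_vector_derivative (\<chi> j. 2 * of_real pi * \<i> * of_real (x $ j) * z $ j)) (at 0)"
proof -
  have "((\<lambda>t. tmul (texp (t *\<^sub>R x)) z $ j) has_vector_derivative 2 * of_real pi * \<i> * of_real (x $ j) * z $ j) (at 0)" for j
  proof -
    \<comment> \<open>The real parameter is extended to a complex one, so that a field derivative
      can be taken and then restricted to real times.\<close>
    have "((\<lambda>s::complex. exp (s * (2 * of_real pi * \<i> * of_real (x $ j))) * z $ j) has_field_derivative
        2 * of_real pi * \<i> * of_real (x $ j) * z $ j) (at (of_real 0))"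
      by (auto intro!: derivative_eq_intros)
    from has_vector_derivative_real_field[OF this]
    show ?thesis by (simp add: texp_def tmul_def mult_ac)
  qed
  \<comment> \<open>Each entry has real dimension two: \<open>y\<close> stands for the complex part
    of a basis vector \<open>axis j y\<close>, against which differentiability is tested
    componentwise.\<close>
  then have "((\<lambda>t. (texp (t *\<^sub>R x) $ j * z $ j) \<bullet> y) has_derivative
      (\<lambda>s. s * ((2 * of_real pi * \<i> * of_real (x $ j) * z $ j) \<bullet> y))) (at 0)" for j y
    using bounded_linear.has_derivative[OF bounded_linear_inner_left, of "\<lambda>t. tmul (texp (t *\<^sub>R x)) z $ j" _ "at 0" y]
    unfolding has_vector_derivative_def by fastforce
  then show ?thesis
    unfolding has_vector_derivative_def has_derivative_componentwise_within[of "\<lambda>t. tmul (texp (t *\<^sub>R x)) z"]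
    by (auto simp: Basis_vec_def inner_axis)
qed

lemma smooth_on_Ups: "smooth_on S f \<Longrightarrow> smooth_on S (\<lambda>y. Ups lam (f y) v)"
  unfolding Ups_def
  by (intro smooth_on_sum smooth_on_mult smooth_on_add smooth_on_const)
    (simp add: power2_norm_eq_inner smooth_on_bilinear[OF bounded_bilinear_inner] smooth_on_vec_nth)

text \<open>The sum is the one in \<open>omega0_rotation\<close>: pairing with the rotation field
  along \<open>x\<close> and differentiating the moment map give the same number. The factor 2 comes
  from the squared modulus.\<close>

lemma Ups_has_real_derivative:
  assumes "(c has_vector_derivative w) (at t)"
  shows "((\<lambda>t. Ups lam (c t) x) has_real_derivative (\<Sum>j\<in>UNIV. 2 * x $ j * (c t $ j \<bullet> w $ j))) (at t)"
proof -
  have c: "((\<lambda>t. c t $ j) has_derivative (\<lambda>s. s *\<^sub>R (w $ j))) (at t)" for j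
    using bounded_linear.has_derivative[OF bounded_linear_vec_nth assms[unfolded has_vector_derivative_def], of j]
    by simp
  have "((\<lambda>t. ((cmod (c t $ j))\<^sup>2 + lam j) * x $ j) has_derivative (\<lambda>s. s * (2 * x $ j * (c t $ j \<bullet> w $ j)))) (at t)" for j
  proof -
    have "((\<lambda>t. c t $ j \<bullet> c t $ j + lam j) has_derivative
        (\<lambda>s. (c t $ j \<bullet> s *\<^sub>R w $ j + s *\<^sub>R w $ j \<bullet> c t $ j) + 0)) (at t)"
      by (rule has_derivative_add[OF has_derivative_inner[OF c c] has_derivative_const])
    from has_derivative_mult_left[OF this, of "x $ j"]
    show ?thesis
      by (simp add: power2_norm_eq_inner inner_commute algebra_simps)
  qed
  then have "((\<lambda>t. Ups lam (c t) x) has_derivative (\<lambda>s. \<Sum>j\<in>UNIV. s * (2 * x $ j * (c t $ j \<bullet> w $ j)))) (at t)"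
    unfolding Ups_def by (intro has_derivative_sum)
  moreover have "(\<lambda>s. \<Sum>j\<in>UNIV. s * (2 * x $ j * (c t $ j \<bullet> w $ j))) = (*) (\<Sum>j\<in>UNIV. 2 * x $ j * (c t $ j \<bullet> w $ j))"
    by (intro ext) (subst mult.commute, rule sum_distrib_left[symmetric])
  ultimately show ?thesis unfolding has_field_derivative_def by simp
qed

section \<open>Pieces with good charts\<close>

lemma continuous_on_tmul [continuous_intros]:
  "continuous_on S f \<Longrightarrow> continuous_on S g \<Longrightarrow> continuous_on S (\<lambda>y. tmul (f y) (g y))"
  unfolding tmul_def by (intro continuous_intros)

text \<open>The saturation of \<open>U\<close> is the union of its translates by \<open>N\<close>,
  each relatively open because \<open>S\<close> is invariant. The projection to orbits is therefore
  open.\<close>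

lemma openin_N_orbit_saturation:
  assumes "quasilattice Q" and inv: "\<And>x z. z \<in> S \<Longrightarrow> tmul (texp x) z \<in> S"
    and U: "openin (top_of_set S) U"
  shows "openin (top_of_set S) {z\<in>S. N_orbit X Q z \<in> N_orbit X Q ` U}"
proof -
  have US: "U \<subseteq> S" using openin_imp_subset[OF U] .
  have "{z\<in>S. N_orbit X Q z \<in> N_orbit X Q ` U} = (\<Union>x\<in>{x. pi_map X x \<in> Q}. S \<inter> (\<lambda>z. tmul (texp x) z) -` U)"
  proof (intro equalityI subsetI)
    fix z assume z: "z \<in> {z\<in>S. N_orbit X Q z \<in> N_orbit X Q ` U}"
    then obtain w where w: "w \<in> U" "N_orbit X Q z = N_orbit X Q w" by blast
    obtain x where "pi_map X x \<in> Q" "w = tmul (texp x) z"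
      using N_orbit_eqD[OF assms(1) w(2)] by blast
    then show "z \<in> (\<Union>x\<in>{x. pi_map X x \<in> Q}. S \<inter> (\<lambda>z. tmul (texp x) z) -` U)"
      using w z by auto
  next
    fix z assume "z \<in> (\<Union>x\<in>{x. pi_map X x \<in> Q}. S \<inter> (\<lambda>z. tmul (texp x) z) -` U)"
    then obtain x where "pi_map X x \<in> Q" "z \<in> S" "tmul (texp x) z \<in> U" by blast
    then show "z \<in> {z\<in>S. N_orbit X Q z \<in> N_orbit X Q ` U}"
      using N_orbit_tmul[OF assms(1), of X x z] by (metis (mono_tags, lifting) imageI mem_Collect_eq)
  qed
  moreover have "openin (top_of_set S) (S \<inter> (\<lambda>z. tmul (texp x) z) -` U)" for x
    using inv by (intro continuous_openin_preimage[OF _ _ U] continuous_intros) auto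
  then have "openin (top_of_set S) (\<Union>x\<in>{x. pi_map X x \<in> Q}. S \<inter> (\<lambda>z. tmul (texp x) z) -` U)"
    by (intro openin_Union) (elim imageE, simp only:)
  ultimately show ?thesis by (simp only:)
qed

text \<open>The piece carries the subspace topology of \<open>M\<close>; this identifies it with the
  quotient topology of \<open>S\<close>. If a saturated set is \<open>S \<inter> O1\<close>, the
  orbits of all zero-level points in \<open>O1\<close> form an open set of \<open>M\<close>, and it
  meets the piece in nothing new because \<open>S\<close> is a union of orbits.\<close>

lemma openin_piece_top:
  assumes "quasilattice Q" and inv: "\<And>x z. z \<in> S \<Longrightarrow> tmul (texp x) z \<in> S" and S: "S \<subseteq> Psi_zero X lam"
  shows "openin (piece_top X lam Q S) V \<longleftrightarrow> V \<subseteq> N_orbit X Q ` S \<and> openin (top_of_set S) {z\<in>S. N_orbit X Q z \<in> V}"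
    (is "?L \<longleftrightarrow> ?R")
proof
  assume ?L
  then obtain V' where V': "openin (M_top X lam Q) V'" "V = V' \<inter> N_orbit X Q ` S"
    unfolding piece_top_def openin_subtopology by blast
  then obtain O1 where "open O1" "{z \<in> Psi_zero X lam. N_orbit X Q z \<in> V'} = Psi_zero X lam \<inter> O1"
    unfolding M_top_def openin_quotient_top openin_open by blast
  then have "{z\<in>S. N_orbit X Q z \<in> V} = S \<inter> O1" using S V'(2) by blast
  then show ?R using V'(2) \<open>open O1\<close> by auto
next
  assume R: ?R
  then obtain O1 where O1: "open O1" "{z\<in>S. N_orbit X Q z \<in> V} = S \<inter> O1"
    unfolding openin_open by blast
  define V' where "V' = N_orbit X Q ` (Psi_zero X lam \<inter> O1)"
  have "openin (M_top X lam Q) V'"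
    unfolding M_top_def openin_quotient_top V'_def
    using O1(1) by (intro conjI openin_N_orbit_saturation[OF assms(1)]) auto
  moreover have "V = V' \<inter> N_orbit X Q ` S"
  proof (intro equalityI subsetI)
    fix m assume m: "m \<in> V"
    then obtain z where "z \<in> S" "m = N_orbit X Q z" using R by blast
    moreover from this m O1(2) have "z \<in> O1" by blast
    ultimately show "m \<in> V' \<inter> N_orbit X Q ` S" using S by (auto simp: V'_def)
  next
    fix m assume "m \<in> V' \<inter> N_orbit X Q ` S"
    then obtain z z' where z: "z \<in> O1" "m = N_orbit X Q z" "z' \<in> S" "m = N_orbit X Q z'"
      by (auto simp: V'_def)
    then obtain x where "z = tmul (texp x) z'"
      using N_orbit_eqD[OF assms(1), of X z' z] by auto
    then have "z \<in> S" using inv z(3) by blast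
    then show "m \<in> V" using z O1(2) by blast
  qed
  ultimately show ?L unfolding piece_top_def openin_subtopology by blast
qed

lemma topspace_piece_top:
  assumes "S \<subseteq> Psi_zero X lam"
  shows "topspace (piece_top X lam Q S) = N_orbit X Q ` S"
proof -
  have "openin (M_top X lam Q) (N_orbit X Q ` Psi_zero X lam)"
    unfolding M_top_def openin_quotient_top
    by (auto simp: openin_subtopology_self cong: conj_cong)
  then have "topspace (M_top X lam Q) = N_orbit X Q ` Psi_zero X lam"
    unfolding topspace_def M_top_def openin_quotient_top by auto
  then show ?thesis using assms by (auto simp: piece_top_def)
qed

text \<open>The saturation of \<open>A\<close> is the union of its translates by \<open>Q\<close>,
  which is open even when \<open>Q\<close> is dense.\<close>

lemma openin_quasitorus_top_image:
  assumes "quasilattice Q" "open A"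
  shows "openin (quasitorus_top Q) (qclass Q ` A)"
proof -
  have "{Y. qclass Q Y \<in> qclass Q ` A} = (\<Union>q\<in>Q. (+) q ` A)"
  proof (intro equalityI subsetI)
    fix Y assume "Y \<in> {Y. qclass Q Y \<in> qclass Q ` A}"
    then obtain Z where Z: "Z \<in> A" "qclass Q Y = qclass Q Z" by blast
    have "Y \<in> qclass Q Y" using quasilattice_zero[OF assms(1)] by (simp add: mem_qclass_iff)
    then have "Y - Z \<in> Q" using Z(2) by (simp add: mem_qclass_iff)
    then show "Y \<in> (\<Union>q\<in>Q. (+) q ` A)" using Z(1) by (auto intro!: bexI[of _ "Y - Z"] image_eqI[of _ _ Z])
  next
    fix Y assume "Y \<in> (\<Union>q\<in>Q. (+) q ` A)"
    then obtain q Z where q: "q \<in> Q" "Z \<in> A" "Y = q + Z" by blast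
    have "qclass Q Y = qclass Q Z"
    proof (intro Set.set_eqI)
      fix W
      have "W - Y = (W - Z) + - q" "W - Z = (W - Y) + q" using q(3) by simp_all
      then show "W \<in> qclass Q Y \<longleftrightarrow> W \<in> qclass Q Z"
        unfolding mem_qclass_iff
        using quasilattice_add[OF assms(1)] quasilattice_uminus[OF assms(1)] q(1) by metis
    qed
    then show "Y \<in> {Y. qclass Q Y \<in> qclass Q ` A}" using q(2) by blast
  qed
  moreover have "open (\<Union>q\<in>Q. (+) q ` A)"
    using assms(2) by (intro open_UN ballI open_translation)
  ultimately show ?thesis
    unfolding quasitorus_top_def openin_quotient_top by auto
qed

text \<open>A section of the projection from \<open>S\<close> to \<open>S / N\<close> over the whole
  chart domain; for the base charts it is the explicit point inside \<open>cmap\<close>.\<close>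

definition smooth_section :: "('d::finite \<Rightarrow> 'a::euclidean_space) \<Rightarrow> 'a set \<Rightarrow> (complex ^ 'd) set \<Rightarrow>
    (complex ^ 'd, (complex ^ 'd) set) chart \<Rightarrow> (complex ^ 'd \<Rightarrow> complex ^ 'd) \<Rightarrow> bool" where
  "smooth_section X Q S a \<sigma> \<longleftrightarrow> smooth_on (cdom a) \<sigma> \<and>
     (\<forall>w\<in>cdom a. \<sigma> w \<in> S \<and> N_orbit X Q (\<sigma> w) = cmap a w)"

text \<open>The parameter lies in \<dd> and not in the quotient, since \<dd> is the domain of the
  chart of \<open>D\<close>. The normalisation at 0 is what turns \<open>L\<close> into a lift of
  the flow of a fundamental field.\<close>

definition lifted_action :: "('d::finite \<Rightarrow> 'a::euclidean_space) \<Rightarrow> 'a set \<Rightarrow>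
    (complex ^ 'd, (complex ^ 'd) set) chart \<Rightarrow> ('a \<times> (complex ^ 'd) \<Rightarrow> complex ^ 'd) \<Rightarrow> bool" where
  "lifted_action X Q a L \<longleftrightarrow> smooth_on (UNIV \<times> cdom a) L \<and> L ` (UNIV \<times> cdom a) \<subseteq> cdom a \<and>
     (\<forall>w\<in>cdom a. L (0, w) = w) \<and>
     (\<forall>Y. \<forall>w\<in>cdom a. cmap a (L (Y, w)) = D_act X (qclass Q Y) (cmap a w))"

text \<open>\<open>pulls_back_to_omega0\<close> constrains \<omega> along such lifts only, so their
  existence at every point of \<open>S\<close> is what gives that condition content.\<close>

definition local_lift :: "('d::finite \<Rightarrow> 'a::euclidean_space) \<Rightarrow> 'a set \<Rightarrow> (complex ^ 'd) set \<Rightarrow>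
    (complex ^ 'd, (complex ^ 'd) set) chart \<Rightarrow> complex ^ 'd \<Rightarrow> bool" where
  "local_lift X Q S a z \<longleftrightarrow> (\<exists>W P. openin (top_of_set S) W \<and> z \<in> W \<and> smooth_on W P \<and> P ` W \<subseteq> cdom a \<and>
     (\<forall>y\<in>W. cmap a (P y) = N_orbit X Q y))"

lemma local_liftE:
  assumes "local_lift X Q S a z"
  obtains W P where "openin (top_of_set S) W" "z \<in> W" "smooth_on W P" "P ` W \<subseteq> cdom a"
    "\<And>y. y \<in> W \<Longrightarrow> cmap a (P y) = N_orbit X Q y"
proof -
  obtain W P where "openin (top_of_set S) W" "z \<in> W" "smooth_on W P" "P ` W \<subseteq> cdom a"
    "\<forall>y\<in>W. cmap a (P y) = N_orbit X Q y"
    using assms unfolding local_lift_def by (elim exE conjE)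
  then show ?thesis by (intro that[of W P]) simp_all
qed

text \<open>A good chart is required around each point of \<open>S\<close>; the other charts of the
  atlas are treated by composing with local changes of charts. The regular piece and the singular
  pieces are both instances.\<close>

locale quasifold_piece =
  fixes X :: "'d::finite \<Rightarrow> 'a::euclidean_space" and lam :: "'d \<Rightarrow> real" and Q :: "'a set"
    and S :: "(complex ^ 'd) set" and k :: nat
    and \<A> :: "(complex ^ 'd, (complex ^ 'd) set) chart set"
    and \<omega> :: "(complex ^ 'd, (complex ^ 'd) set) form_family"
  assumes Q: "quasilattice Q" and surj_pi: "surj (pi_map X)"
    and S_Psi: "S \<subseteq> Psi_zero X lam" and S_inv: "\<And>x z. z \<in> S \<Longrightarrow> tmul (texp x) z \<in> S"
    and atl: "atlas (piece_top X lam Q S) k \<A>"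
    and form: "quasifold_two_form \<A> \<omega>" and pull: "pulls_back_to_omega0 X Q S \<A> \<omega>"
    and good_charts: "\<And>z. z \<in> S \<Longrightarrow>
      \<exists>a\<in>\<A>. (\<exists>\<sigma>. smooth_section X Q S a \<sigma>) \<and> (\<exists>L. lifted_action X Q a L) \<and> local_lift X Q S a z"
begin

abbreviation "T \<equiv> piece_top X lam Q S"

lemma chart: "a \<in> \<A> \<Longrightarrow> quasifold_chart T k a"
  and compatible: "a \<in> \<A> \<Longrightarrow> b \<in> \<A> \<Longrightarrow> compatible_charts a b"
  using atl unfolding atlas_def by blast+

lemma topspace_T: "topspace T = N_orbit X Q ` S"
  by (rule topspace_piece_top[OF S_Psi])

lemma cim_subset: "a \<in> \<A> \<Longrightarrow> cim a \<subseteq> N_orbit X Q ` S"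
  using atl topspace_T unfolding atlas_def by blast

lemma openin_cdom: "a \<in> \<A> \<Longrightarrow> openin (top_of_set (span (cdom a))) (cdom a)"
  using chart unfolding quasifold_chart_def premodel_def by blast

text \<open>A lift into a good chart, followed by a local change of charts into
  \<open>b\<close>.\<close>

lemma local_lift_chart:
  assumes b: "b \<in> \<A>" and z: "z \<in> S" "N_orbit X Q z \<in> cim b"
  shows "local_lift X Q S b z"
proof -
  obtain a where a: "a \<in> \<A>" "local_lift X Q S a z" using good_charts[OF z(1)] by blast
  then obtain W P where W: "openin (top_of_set S) W" "z \<in> W" "smooth_on W P" "P ` W \<subseteq> cdom a"
    "\<And>y. y \<in> W \<Longrightarrow> cmap a (P y) = N_orbit X Q y"
    using local_liftE[OF a(2)] by metis
  have Pz: "P z \<in> cdom a" "cmap a (P z) \<in> cim b" using W z by auto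
  obtain V \<tau> \<rho> where V: "openin (top_of_set (cdom a)) V" "P z \<in> V" "smooth_on V \<tau>" "\<tau> ` V \<subseteq> cdom b"
    "\<And>u. u \<in> V \<Longrightarrow> cmap b (\<tau> u) = cmap a u"
    using local_change_of_charts[OF chart[OF a(1)] chart[OF b] compatible[OF a(1) b] Pz] by metis
  let ?W = "W \<inter> P -` V"
  have "openin (top_of_set W) ?W"
    using W(4) by (intro continuous_openin_preimage[OF smooth_on_imp_continuous_on[OF W(3)] _ V(1)]) auto
  then have "openin (top_of_set S) ?W" using W(1) openin_trans by blast
  moreover have "smooth_on ?W (\<lambda>y. \<tau> (P y))"
    by (rule smooth_on_compose[OF smooth_on_subset[OF W(3)] V(3)]) auto
  ultimately show ?thesis
    unfolding local_lift_def using W(2,5) V(2,4,5)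
    by (intro exI[of _ ?W] exI[of _ "\<lambda>y. \<tau> (P y)"]) auto
qed

text \<open>The chart \<open>b\<close> is carried locally into a good chart, whose global section is
  then available.\<close>

lemma local_section:
  assumes b: "b \<in> \<A>" and x: "x \<in> cdom b"
  obtains V \<sigma> where "openin (top_of_set (cdom b)) V" "x \<in> V" "smooth_on V \<sigma>" "\<sigma> ` V \<subseteq> S"
    "\<And>y. y \<in> V \<Longrightarrow> N_orbit X Q (\<sigma> y) = cmap b y"
proof -
  have "cmap b x \<in> cim b" using x by (simp add: cim_def)
  then obtain z where z: "z \<in> S" "cmap b x = N_orbit X Q z" using cim_subset[OF b] by blast
  obtain a \<sigma> where a: "a \<in> \<A>" "smooth_section X Q S a \<sigma>" "local_lift X Q S a z"
    using good_charts[OF z(1)] by blast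
  have "cmap b x \<in> cim a"
    using a(3) z(2) unfolding local_lift_def cim_def by (metis image_eqI image_subset_iff)
  then obtain V \<tau> \<rho> where V: "openin (top_of_set (cdom b)) V" "x \<in> V" "smooth_on V \<tau>" "\<tau> ` V \<subseteq> cdom a"
    "\<And>u. u \<in> V \<Longrightarrow> cmap a (\<tau> u) = cmap b u"
    using local_change_of_charts[OF chart[OF b] chart[OF a(1)] compatible[OF b a(1)] x] by metis
  show ?thesis
  proof (rule that[OF V(1,2)])
    show "smooth_on V (\<lambda>y. \<sigma> (\<tau> y))"
      using a(2) by (intro smooth_on_compose[OF V(3) _ V(4)]) (simp add: smooth_section_def)
    show "(\<lambda>y. \<sigma> (\<tau> y)) ` V \<subseteq> S" "\<And>y. y \<in> V \<Longrightarrow> N_orbit X Q (\<sigma> (\<tau> y)) = cmap b y"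
      using a(2) V(4,5) unfolding smooth_section_def by (auto simp: image_subset_iff)
  qed
qed

text \<open>The parameter set \<open>V\<close> is open in an auxiliary Euclidean space, so that
  \<open>G'\<close> and \<open>\<sigma>'\<close> are ordinary derivatives. In the applications it is
  an open set of the plane, and \<open>v\<close>, \<open>w\<close> are its unit vectors.\<close>

lemma pull_back_eq_omega0:
  fixes V :: "'c::euclidean_space set"
  assumes b: "b \<in> \<A>" and V: "open V" and \<sigma>: "smooth_on V \<sigma>" "\<sigma> ` V \<subseteq> S"
    and G: "smooth_on V G" "G ` V \<subseteq> cdom b" and eq: "\<And>y. y \<in> V \<Longrightarrow> cmap b (G y) = N_orbit X Q (\<sigma> y)"
    and x: "x \<in> V" and G': "(G has_derivative G') (at x)" and \<sigma>': "(\<sigma> has_derivative \<sigma>') (at x)"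
  shows "\<omega> b (G x) (G' v) (G' w) = omega0 (\<sigma>' v) (\<sigma>' w)"
proof -
  have "\<sigma> x \<in> S" "N_orbit X Q (\<sigma> x) \<in> cim b"
    using x \<sigma>(2) G(2) eq[OF x] by (auto simp: cim_def)
  then obtain W P where W: "openin (top_of_set S) W" "\<sigma> x \<in> W" "smooth_on W P" "P ` W \<subseteq> cdom b"
    "\<And>y. y \<in> W \<Longrightarrow> cmap b (P y) = N_orbit X Q y"
    using local_liftE[OF local_lift_chart[OF b]] by metis
  \<comment> \<open>Shrinking to \<open>V1\<close> keeps \<open>\<sigma>\<close> inside the set
    \<open>W\<close> on which the lift \<open>P\<close> of the projection is defined.\<close>
  define V1 where "V1 = V \<inter> \<sigma> -` W"
  have "openin (top_of_set V) V1"
    unfolding V1_def using \<sigma>(2)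
    by (intro continuous_openin_preimage[OF smooth_on_imp_continuous_on[OF \<sigma>(1)] _ W(1)]) auto
  then have V1: "open V1" using V openin_open_trans by blast
  have V1V: "V1 \<subseteq> V" "\<sigma> ` V1 \<subseteq> W" "x \<in> V1" using x W(2) by (auto simp: V1_def)
  have \<sigma>1: "smooth_on V1 \<sigma>" by (rule smooth_on_subset[OF \<sigma>(1) V1V(1)])
  obtain P' where P': "(P has_derivative P') (at (\<sigma> x) within W)"
    using smooth_on_has_derivative_within[OF W(3,2)] by blast
  have D2: "((\<lambda>y. P (\<sigma> y)) has_derivative (\<lambda>u. P' (\<sigma>' u))) (at x)"
    by (rule has_derivative_compose_within[OF V1 V1V(3) \<sigma>' V1V(2) P'])
  have ch: "quasifold_chart T k b" by (rule chart[OF b])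
  have "\<omega> b (G x) (G' v) (G' w) = \<omega> b (P (\<sigma> x)) (P' (\<sigma>' v)) (P' (\<sigma>' w))"
  proof (rule lifts_pull_back_eq[of "cdom b" _ "cgrp b" V1 G "\<lambda>y. P (\<sigma> y)" x G'])
    show "two_form_on (cdom b) (\<omega> b)" using form b by (simp add: quasifold_two_form_def)
    show "countable (cgrp b)" using ch by (simp add: quasifold_chart_def premodel_def)
    show "smooth_on (cdom b) g" if "g \<in> cgrp b" for g
      using ch that by (simp add: quasifold_chart_def premodel_def)
    show "pulls_back g (cdom b) (\<omega> b) (\<omega> b)" if "g \<in> cgrp b" for g
      using form b that by (simp add: quasifold_two_form_def)
    show "smooth_on V1 G" by (rule smooth_on_subset[OF G(1) V1V(1)])
    show "G ` V1 \<subseteq> cdom b" using G(2) V1V(1) by blast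
    show "smooth_on V1 (\<lambda>y. P (\<sigma> y))" by (rule smooth_on_compose[OF \<sigma>1 W(3) V1V(2)])
    show "(\<lambda>y. P (\<sigma> y)) ` V1 \<subseteq> cdom b" using V1V(2) W(4) by blast
    show "\<exists>g\<in>cgrp b. P (\<sigma> y) = g (G y)" if y: "y \<in> V1" for y
    proof -
      have yV: "y \<in> V" "\<sigma> y \<in> W" using y V1V by auto
      then have "cmap b (G y) = cmap b (P (\<sigma> y))" using eq W(5) by metis
      moreover have "G y \<in> cdom b" "P (\<sigma> y) \<in> cdom b" using yV G(2) W(4) by auto
      ultimately show ?thesis using ch unfolding quasifold_chart_def by blast
    qed
  qed (use V1 V1V G' D2 in auto)
  also have "\<dots> = omega0 (\<sigma>' v) (\<sigma>' w)"
  proof -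
    have tan: "\<sigma>' u \<in> tangent_space W (\<sigma> x)" for u
      by (rule smooth_derivative_in_tangent_space[OF V1 \<sigma>1 V1V(2,3) \<sigma>'])
    have "pulls_back P W (\<omega> b) (\<lambda>_. omega0)"
      using pull b W unfolding pulls_back_to_omega0_def by blast
    then show ?thesis using W(2) P' tan unfolding pulls_back_def by blast
  qed
  finally show ?thesis .
qed

lemma preserves_form_D_act:
  assumes "c \<in> range (qclass Q)"
  shows "preserves_form \<A> \<omega> (D_act X c)"
  unfolding preserves_form_def
proof (intro ballI allI impI, elim conjE)
  fix a b W G
  assume a: "a \<in> \<A>" and b: "b \<in> \<A>" and W: "openin (top_of_set (cdom a)) W" and G: "smooth_on W G" "G ` W \<subseteq> cdom b"
    and eq: "\<forall>x\<in>W. cmap b (G x) = D_act X c (cmap a x)"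
  obtain x0 where x0: "c = qclass Q (pi_map X x0)" using assms surj_pi by (metis imageE surjE)
  show "pulls_back G W (\<omega> b) (\<omega> a)"
    unfolding pulls_back_def
  proof (intro ballI allI impI)
    fix x G' v w
    assume x: "x \<in> W" and G': "(G has_derivative G') (at x within W)"
      and "v \<in> tangent_space W x" "w \<in> tangent_space W x"
    have Wa: "W \<subseteq> cdom a" using W openin_imp_subset by blast
    have vw: "v \<in> span (cdom a)" "w \<in> span (cdom a)"
      using \<open>v \<in> tangent_space W x\<close> \<open>w \<in> tangent_space W x\<close> tangent_space_subset_span span_mono[OF Wa] by blast+
    obtain V \<sigma> where V: "openin (top_of_set (cdom a)) V" "x \<in> V" "smooth_on V \<sigma>" "\<sigma> ` V \<subseteq> S"
      "\<And>y. y \<in> V \<Longrightarrow> N_orbit X Q (\<sigma> y) = cmap a y"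
      using local_section[OF a subsetD[OF Wa x]] by metis
    define U where "U = W \<inter> V"
    have U: "openin (top_of_set (cdom a)) U" "x \<in> U" "U \<subseteq> W" "U \<subseteq> V"
      using W V(1,2) x by (auto simp: U_def intro: openin_Int)
    have oU: "openin (top_of_set (span (cdom a))) U" using U(1) openin_cdom[OF a] openin_trans by blast
    \<comment> \<open>The chart domain is open only in its span. The affine plane through
      \<open>x\<close> along \<open>v\<close> and \<open>w\<close> stays in that span, so the
      preimage of \<open>U\<close> is open in the parameters and \<open>v\<close>, \<open>w\<close>
      become derivatives along the axes.\<close>
    define \<gamma> where "\<gamma> = (\<lambda>p :: real \<times> real. x + fst p *\<^sub>R v + snd p *\<^sub>R w)"
    obtain O1 where O1: "open O1" "U = span (cdom a) \<inter> O1" using oU by (auto simp: openin_open)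
    have "\<gamma> p \<in> span (cdom a)" for p
      unfolding \<gamma>_def using span_base[OF subsetD[OF Wa x]] vw by (intro span_add span_scale)
    then have "\<gamma> -` U = \<gamma> -` O1" using O1(2) by blast
    moreover have "continuous_on UNIV \<gamma>" unfolding \<gamma>_def by (intro continuous_intros)
    ultimately have op: "open (\<gamma> -` U)" using O1(1) by (simp add: open_vimage)
    have \<gamma>0: "\<gamma> 0 = x" by (simp add: \<gamma>_def)
    have 0: "0 \<in> \<gamma> -` U" using \<gamma>0 U(2) by simp
    have \<gamma>': "(\<gamma> has_derivative (\<lambda>p. fst p *\<^sub>R v + snd p *\<^sub>R w)) (at 0)"
      unfolding \<gamma>_def by (auto intro!: derivative_eq_intros)
    have sm\<gamma>: "smooth_on (\<gamma> -` U) \<gamma>"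
      unfolding \<gamma>_def
      by (intro smooth_on_add smooth_on_scaleR smooth_on_const smooth_on_linear bounded_linear_fst bounded_linear_snd)
    have \<gamma>U: "\<gamma> ` (\<gamma> -` U) \<subseteq> U" by blast
    obtain \<sigma>' where \<sigma>': "(\<sigma> has_derivative \<sigma>') (at x within U)"
      using smooth_on_has_derivative_within[OF smooth_on_subset[OF V(3) U(4)] U(2)] by blast
    have D\<sigma>: "((\<lambda>p. \<sigma> (\<gamma> p)) has_derivative (\<lambda>p. \<sigma>' (fst p *\<^sub>R v + snd p *\<^sub>R w))) (at 0)"
      using has_derivative_compose_within[OF op 0 \<gamma>' \<gamma>U] \<sigma>' \<gamma>0 by simp
    have DG: "((\<lambda>p. G (\<gamma> p)) has_derivative (\<lambda>p. G' (fst p *\<^sub>R v + snd p *\<^sub>R w))) (at 0)"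
      using has_derivative_compose_within[OF op 0 \<gamma>' \<gamma>U] has_derivative_subset[OF G' U(3)] \<gamma>0 by simp
    have sm\<sigma>: "smooth_on (\<gamma> -` U) (\<lambda>p. \<sigma> (\<gamma> p))"
      by (rule smooth_on_compose[OF sm\<gamma> smooth_on_subset[OF V(3) U(4)] \<gamma>U])
    have lin: "bounded_linear (\<lambda>z. tmul (texp x0) z)"
      unfolding linear_conv_bounded_linear[symmetric]
      by (rule linearI) (simp_all add: vec_eq_iff algebra_simps)
    let ?e1 = "(1, 0) :: real \<times> real" and ?e2 = "(0, 1) :: real \<times> real"
    have "\<omega> b (G (\<gamma> 0)) (G' (fst ?e1 *\<^sub>R v + snd ?e1 *\<^sub>R w)) (G' (fst ?e2 *\<^sub>R v + snd ?e2 *\<^sub>R w))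
      = omega0 (tmul (texp x0) (\<sigma>' (fst ?e1 *\<^sub>R v + snd ?e1 *\<^sub>R w)))
          (tmul (texp x0) (\<sigma>' (fst ?e2 *\<^sub>R v + snd ?e2 *\<^sub>R w)))"
    proof (rule pull_back_eq_omega0[OF b op _ _ _ _ _ 0 DG bounded_linear.has_derivative[OF lin D\<sigma>]])
      show "smooth_on (\<gamma> -` U) (\<lambda>p. tmul (texp x0) (\<sigma> (\<gamma> p)))"
        by (rule smooth_on_bounded_linear_compose[OF lin sm\<sigma>])
      show "(\<lambda>p. tmul (texp x0) (\<sigma> (\<gamma> p))) ` (\<gamma> -` U) \<subseteq> S"
        using V(4) U(4) S_inv by blast
      show "smooth_on (\<gamma> -` U) (\<lambda>p. G (\<gamma> p))"
        by (rule smooth_on_compose[OF sm\<gamma> smooth_on_subset[OF G(1) U(3)] \<gamma>U])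
      show "(\<lambda>p. G (\<gamma> p)) ` (\<gamma> -` U) \<subseteq> cdom b" using G(2) U(3) by blast
      show "cmap b (G (\<gamma> p)) = N_orbit X Q (tmul (texp x0) (\<sigma> (\<gamma> p)))" if "p \<in> \<gamma> -` U" for p
      proof -
        have "\<gamma> p \<in> W" "\<gamma> p \<in> V" using that U(3,4) by auto
        then show ?thesis using eq V(5) x0 D_act_N_orbit[OF Q] by metis
      qed
    qed
    also have "\<dots> = omega0 (\<sigma>' (fst ?e1 *\<^sub>R v + snd ?e1 *\<^sub>R w)) (\<sigma>' (fst ?e2 *\<^sub>R v + snd ?e2 *\<^sub>R w))"
      by simp
    \<comment> \<open>The same comparison with \<open>\<gamma>\<close> itself as the map into the
      chart \<open>a\<close>, which reads off \<omega> before the action.\<close>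
    also have "\<dots> = \<omega> a (\<gamma> 0) (fst ?e1 *\<^sub>R v + snd ?e1 *\<^sub>R w) (fst ?e2 *\<^sub>R v + snd ?e2 *\<^sub>R w)"
    proof (rule pull_back_eq_omega0[OF a op sm\<sigma> _ sm\<gamma> _ _ 0 \<gamma>' D\<sigma>, symmetric])
      show "(\<lambda>p. \<sigma> (\<gamma> p)) ` (\<gamma> -` U) \<subseteq> S" using V(4) U(4) by blast
      show "\<gamma> ` (\<gamma> -` U) \<subseteq> cdom a" using U(3) Wa by blast
      show "cmap a (\<gamma> p) = N_orbit X Q (\<sigma> (\<gamma> p))" if "p \<in> \<gamma> -` U" for p
        using that U(4) V(5) by auto
    qed
    finally show "\<omega> b (G x) (G' v) (G' w) = \<omega> a x v w" by (simp add: \<gamma>0)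
  qed
qed

lemma fundamental_vector_moment:
  assumes a: "a \<in> \<A>" and x: "x \<in> cdom a" and \<xi>: "fundamental_vector Q (D_act X) Y a x \<xi>"
    and v: "v \<in> span (cdom a)"
  shows "((\<lambda>t. Phi X lam (cmap a (x + t *\<^sub>R v)) \<bullet> Y) has_real_derivative \<omega> a x \<xi> v) (at 0)"
proof -
  obtain W H e where e: "e > 0" and W: "openin (top_of_set (cdom a)) W" "x \<in> W"
    and H: "smooth_on ({-e<..<e} \<times> W) H" "H ` ({-e<..<e} \<times> W) \<subseteq> cdom a" "\<forall>y\<in>W. H (0, y) = y"
    and Hact: "\<forall>t\<in>{-e<..<e}. \<forall>y\<in>W. cmap a (H (t, y)) = D_act X (qclass Q (t *\<^sub>R Y)) (cmap a y)"
    and Hd: "((\<lambda>t. H (t, x)) has_vector_derivative \<xi>) (at 0)"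
    using \<xi> unfolding fundamental_vector_def by (elim exE conjE)
  obtain xY where xY: "pi_map X xY = Y" using surj_pi by (metis surjE)
  obtain V \<sigma> where V: "openin (top_of_set (cdom a)) V" "x \<in> V" "smooth_on V \<sigma>" "\<sigma> ` V \<subseteq> S"
    "\<And>y. y \<in> V \<Longrightarrow> N_orbit X Q (\<sigma> y) = cmap a y"
    using local_section[OF a x] by metis
  define U where "U = W \<inter> V"
  have U: "openin (top_of_set (cdom a)) U" "x \<in> U" "U \<subseteq> W" "U \<subseteq> V"
    using W V(1,2) x by (auto simp: U_def intro: openin_Int)
  have oU: "openin (top_of_set (span (cdom a))) U" using U(1) openin_cdom[OF a] openin_trans by blast
  define l where "l = (\<lambda>s::real. x + s *\<^sub>R v)"
  have l0: "l 0 = x" by (simp add: l_def)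
  obtain O1 where O1: "open O1" "U = span (cdom a) \<inter> O1" using oU by (auto simp: openin_open)
  have "l p \<in> span (cdom a)" for p
    unfolding l_def using span_base[OF x] v by (intro span_add span_scale)
  then have "l -` U = l -` O1" using O1(2) by blast
  moreover have "continuous_on UNIV l" unfolding l_def by (intro continuous_intros)
  ultimately have opl: "open (l -` U)" using O1(1) by (simp add: open_vimage)
  define R where "R = {-e<..<e} \<times> (l -` U)"
  have R: "open R" unfolding R_def using opl by (intro open_Times) auto
  have 0: "(0, 0) \<in> R" using e U(2) l0 by (simp add: R_def)
  have sml: "smooth_on B l" for B
    unfolding l_def by (intro smooth_on_add smooth_on_scaleR smooth_on_const smooth_on_id)
  have fs: "smooth_on B (fst :: real \<times> real \<Rightarrow> real)" "smooth_on B (snd :: real \<times> real \<Rightarrow> real)" for B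
    by (intro smooth_on_linear bounded_linear_fst bounded_linear_snd)+
  have smls: "smooth_on B (\<lambda>p :: real \<times> real. l (snd p))" for B
    by (rule smooth_on_compose[OF fs(2) sml subset_UNIV])
  define G where "G = (\<lambda>p. H (fst p, l (snd p)))"
  \<comment> \<open>\<open>xY\<close> is a preimage of \<open>Y\<close> in the Lie algebra of the
    torus. Flowing the section along it represents the same map into the piece as \<open>G\<close>,
    by the description of the action on orbits.\<close>
  define \<Sigma> where "\<Sigma> = (\<lambda>p. tmul (texp (fst p *\<^sub>R xY)) (\<sigma> (l (snd p))))"
  have G: "smooth_on R G"
    unfolding G_def
    by (rule smooth_on_compose[OF smooth_on_Pair[OF fs(1) smls] H(1)]) (use U(3) in \<open>auto simp: R_def\<close>)
  have GR: "G ` R \<subseteq> cdom a" using H(2) U(3) by (fastforce simp: G_def R_def)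
  have \<Sigma>: "smooth_on R \<Sigma>"
    unfolding \<Sigma>_def
    by (intro smooth_on_tmul_texp smooth_on_scaleR fs smooth_on_const
        smooth_on_compose[OF smls V(3)]) (use U(4) in \<open>auto simp: R_def\<close>)
  have \<Sigma>R: "\<Sigma> ` R \<subseteq> S" using S_inv V(4) U(4) by (fastforce simp: \<Sigma>_def R_def)
  have eq: "cmap a (G p) = N_orbit X Q (\<Sigma> p)" if p: "p \<in> R" for p
  proof -
    have "fst p \<in> {-e<..<e}" "l (snd p) \<in> W" "l (snd p) \<in> V" using p U(3,4) by (auto simp: R_def)
    then have "cmap a (G p) = D_act X (qclass Q (pi_map X (fst p *\<^sub>R xY))) (N_orbit X Q (\<sigma> (l (snd p))))"
      using Hact V(5) by (simp add: G_def linear_scale[OF linear_pi_map] xY)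
    then show ?thesis by (simp only: D_act_N_orbit[OF Q] \<Sigma>_def)
  qed
  obtain G' \<Sigma>' where G': "(G has_derivative G') (at (0, 0))" and \<Sigma>': "(\<Sigma> has_derivative \<Sigma>') (at (0, 0))"
    using smooth_on_open_derivative(1)[OF R G 0] smooth_on_open_derivative(1)[OF R \<Sigma> 0] by blast
  have key: "\<omega> a (G (0, 0)) (G' (1, 0)) (G' (0, 1)) = omega0 (\<Sigma>' (1, 0)) (\<Sigma>' (0, 1))"
    by (rule pull_back_eq_omega0[OF a R \<Sigma> \<Sigma>R G GR eq 0 G' \<Sigma>'])
  \<comment> \<open>Along the time axis these give \<open>\<xi>\<close> for \<open>G\<close> and the
    rotation field for \<open>\<Sigma>\<close>; along the other axis, \<open>v\<close> and the
    derivative of the section.\<close>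
  have partial: "((\<lambda>t. f (t, 0)) has_vector_derivative f' (1, 0)) (at 0)"
    "((\<lambda>s. f (0, s)) has_vector_derivative f' (0, 1)) (at 0)"
    if f: "(f has_derivative f') (at (0, 0))" for f :: "real \<times> real \<Rightarrow> complex ^ 'd" and f'
  proof -
    have "linear f'" using f has_derivative_linear by blast
    then have sc: "f' (t, 0) = t *\<^sub>R f' (1, 0)" "f' (0, t) = t *\<^sub>R f' (0, 1)" for t
      using linear_scale[of f' t "(1, 0)"] linear_scale[of f' t "(0, 1)"] by simp_all
    have "((\<lambda>t. (t, 0 :: real)) has_derivative (\<lambda>t. (t, 0))) (at 0)" "((\<lambda>t. (0 :: real, t)) has_derivative (\<lambda>t. (0, t))) (at (0 :: real))"
      by (auto intro!: derivative_eq_intros)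
    note compose = has_derivative_compose[OF this(1), of f f'] has_derivative_compose[OF this(2), of f f']
    show "((\<lambda>t. f (t, 0)) has_vector_derivative f' (1, 0)) (at 0)"
      unfolding has_vector_derivative_def by (rule has_derivative_eq_rhs[OF compose(1)[OF f]]) (intro ext sc(1))
    show "((\<lambda>s. f (0, s)) has_vector_derivative f' (0, 1)) (at 0)"
      unfolding has_vector_derivative_def by (rule has_derivative_eq_rhs[OF compose(2)[OF f]]) (intro ext sc(2))
  qed
  have G0: "G (0, 0) = x" using H(3) W(2) by (simp add: G_def l0)
  have "G' (1, 0) = \<xi>"
    using vector_derivative_unique_at[OF partial(1)[OF G']] Hd by (simp add: G_def l0)
  moreover have "G' (0, 1) = v"
  proof -
    have "((\<lambda>s. G (0, s)) has_vector_derivative v) (at 0)"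
    proof (rule has_vector_derivative_transform_within_open[OF _ opl])
      show "(l has_vector_derivative v) (at 0)"
        unfolding l_def has_vector_derivative_def by (auto intro!: derivative_eq_intros)
      show "0 \<in> l -` U" using U(2) l0 by simp
      show "l s = G (0, s)" if "s \<in> l -` U" for s
        using that H(3) U(3) by (auto simp: G_def)
    qed
    then show ?thesis using vector_derivative_unique_at[OF partial(2)[OF G']] by blast
  qed
  moreover have "\<Sigma>' (1, 0) = (\<chi> j. 2 * of_real pi * \<i> * of_real (xY $ j) * \<sigma> x $ j)"
    using vector_derivative_unique_at[OF partial(1)[OF \<Sigma>']] tmul_texp_has_vector_derivative[of xY "\<sigma> x"]
    by (simp add: \<Sigma>_def l0)
  ultimately have val: "\<omega> a x \<xi> v = (\<Sum>j\<in>UNIV. 2 * xY $ j * (\<sigma> x $ j \<bullet> \<Sigma>' (0, 1) $ j))"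
    using key G0 by (simp add: omega0_rotation)
  have "((\<lambda>s. \<sigma> (l s)) has_vector_derivative \<Sigma>' (0, 1)) (at 0)"
    using partial(2)[OF \<Sigma>'] by (simp add: \<Sigma>_def)
  from Ups_has_real_derivative[OF this, of lam xY]
  have "((\<lambda>s. Ups lam (\<sigma> (l s)) xY) has_real_derivative \<omega> a x \<xi> v) (at 0)"
    by (simp add: val l0)
  then show ?thesis
    unfolding l_def[symmetric]
  proof (rule has_field_derivative_transform_within_open[OF _ opl])
    show "0 \<in> l -` U" using U(2) l0 by simp
    show "Ups lam (\<sigma> (l s)) xY = Phi X lam (cmap a (x + s *\<^sub>R v)) \<bullet> Y" if "s \<in> l -` U" for s
    proof -
      have ls: "l s \<in> V" using that U(4) by auto
      then have "\<sigma> (l s) \<in> Psi_zero X lam" using V(4) S_Psi by blast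
      from Phi_N_orbit[OF Q surj_pi this, of xY] V(5)[OF ls] show ?thesis by (simp add: xY l_def)
    qed
  qed
qed

section \<open>Existence of the fundamental field; smoothness of the action and of
  \<open>Phi\<close>\<close>

lemma openin_T: "openin T V \<longleftrightarrow> V \<subseteq> N_orbit X Q ` S \<and> openin (top_of_set S) {z\<in>S. N_orbit X Q z \<in> V}"
  by (rule openin_piece_top[OF Q _ S_Psi]) (rule S_inv)

lemma openin_T_image:
  assumes "openin (top_of_set S) U"
  shows "openin T (N_orbit X Q ` U)"
  unfolding openin_T
  using openin_imp_subset[OF assms] openin_N_orbit_saturation[OF Q _ assms, of X] S_inv by blast

lemma obtain_right_inverse:
  obtains s where "linear s" "\<And>Y. pi_map X (s Y) = Y"
proof -
  obtain s where s: "linear s" "pi_map X \<circ> s = id"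
    using linear_surjective_right_inverse[OF linear_pi_map surj_pi] by blast
  then have "pi_map X (s Y) = Y" for Y by (metis comp_apply id_apply)
  then show ?thesis using that s(1) by blast
qed

text \<open>The lifted action of a good chart is conjugated by a local change of charts:
  \<open>H\<close> is \<open>\<rho>\<close> after \<open>L\<close> after \<open>\<tau>\<close>. It
  is defined for small times because the image of \<open>\<tau>\<close> is open in
  \<open>cdom b\<close>.\<close>

lemma fundamental_vector_exists:
  assumes a: "a \<in> \<A>" and x: "x \<in> cdom a"
  shows "\<exists>\<xi>. fundamental_vector Q (D_act X) Y a x \<xi>"
proof -
  have "cmap a x \<in> cim a" using x by (simp add: cim_def)
  then obtain z where z: "z \<in> S" "cmap a x = N_orbit X Q z" using cim_subset[OF a] by blast
  obtain b L where b: "b \<in> \<A>" "lifted_action X Q b L" "local_lift X Q S b z"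
    using good_charts[OF z(1)] by blast
  have L: "smooth_on (UNIV \<times> cdom b) L" "L ` (UNIV \<times> cdom b) \<subseteq> cdom b" "\<And>w. w \<in> cdom b \<Longrightarrow> L (0, w) = w"
    "\<And>Y w. w \<in> cdom b \<Longrightarrow> cmap b (L (Y, w)) = D_act X (qclass Q Y) (cmap b w)"
    using b(2) unfolding lifted_action_def by auto
  have "cmap a x \<in> cim b"
    using b(3) z(2) unfolding local_lift_def cim_def by (metis image_eqI image_subset_iff)
  then obtain V \<tau> \<rho> where V: "openin (top_of_set (cdom a)) V" "x \<in> V" "smooth_on V \<tau>" "\<tau> ` V \<subseteq> cdom b"
    "openin (top_of_set (cdom b)) (\<tau> ` V)" "smooth_on (\<tau> ` V) \<rho>"
    "\<And>u. u \<in> V \<Longrightarrow> \<rho> (\<tau> u) = u" "\<And>u. u \<in> V \<Longrightarrow> cmap b (\<tau> u) = cmap a u"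
    using local_change_of_charts[OF chart[OF a] chart[OF b(1)] compatible[OF a b(1)] x] by metis
  have Va: "V \<subseteq> cdom a" using V(1) openin_imp_subset by blast
  define K where "K = (\<lambda>p. L (fst p *\<^sub>R Y, \<tau> (snd p)))"
  have fs: "smooth_on B (fst :: real \<times> (complex ^ 'd) \<Rightarrow> real)" "smooth_on B (snd :: real \<times> (complex ^ 'd) \<Rightarrow> _)" for B
    by (intro smooth_on_linear bounded_linear_fst bounded_linear_snd)+
  have K: "smooth_on (UNIV \<times> V) K"
    unfolding K_def
  proof (rule smooth_on_compose[OF smooth_on_Pair[OF smooth_on_scaleR[OF fs(1) smooth_on_const]
          smooth_on_compose[OF fs(2) V(3)]] L(1)])
    show "(\<lambda>p. (fst p *\<^sub>R Y, \<tau> (snd p))) ` (UNIV \<times> V) \<subseteq> UNIV \<times> cdom b" using V(4) by auto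
  qed auto
  have Kb: "K ` (UNIV \<times> V) \<subseteq> cdom b" using L(2) V(4) by (fastforce simp: K_def)
  \<comment> \<open>Staying inside the image of \<open>\<tau>\<close> is an open condition on time
    and point. It holds at \<open>(0, x)\<close>, hence on a box around it, which supplies
    \<open>e\<close> and \<open>W\<close>.\<close>
  have "openin (top_of_set (UNIV \<times> V)) ((UNIV \<times> V) \<inter> K -` (\<tau> ` V))"
    using Kb by (intro continuous_openin_preimage[OF smooth_on_imp_continuous_on[OF K] _ V(5)]) auto
  then obtain N where N: "open N" "(UNIV \<times> V) \<inter> K -` (\<tau> ` V) = (UNIV \<times> V) \<inter> N"
    by (auto simp: openin_open)
  have K0: "K (0, u) = \<tau> u" if "u \<in> V" for u using that V(4) L(3) by (auto simp: K_def)
  have "(0, x) \<in> (UNIV \<times> V) \<inter> K -` (\<tau> ` V)" using V(2) K0 by auto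
  then have "(0, x) \<in> N" unfolding N(2) by blast
  then obtain A B where AB: "open A" "open B" "0 \<in> A" "x \<in> B" "A \<times> B \<subseteq> N"
    using open_prod_elim[OF N(1)] by (metis mem_Sigma_iff)
  obtain e where e: "e > 0" "ball 0 e \<subseteq> A" using openE[OF AB(1,3)] by blast
  define W where "W = V \<inter> B"
  have W: "openin (top_of_set (cdom a)) W" "x \<in> W" "W \<subseteq> V"
    using V(1,2) AB(2,4) by (auto simp: W_def intro: openin_Int_open)
  have KW: "K p \<in> \<tau> ` V" if "p \<in> {-e<..<e} \<times> W" for p
  proof -
    have "p \<in> (UNIV \<times> V) \<inter> N" using that e(2) AB(5) by (fastforce simp: W_def subset_iff)
    then show ?thesis unfolding N(2)[symmetric] by blast
  qed
  define H where "H = (\<lambda>p. \<rho> (K p))"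
  have H: "smooth_on ({-e<..<e} \<times> W) H"
    unfolding H_def
  proof (rule smooth_on_compose[OF smooth_on_subset[OF K] V(6)])
    show "{-e<..<e} \<times> W \<subseteq> UNIV \<times> V" using W(3) by blast
    show "K ` ({-e<..<e} \<times> W) \<subseteq> \<tau> ` V" using KW by blast
  qed
  have "smooth_on {-e<..<e} (\<lambda>t. H (t, x))"
    by (rule smooth_on_compose[OF smooth_on_Pair[OF smooth_on_id smooth_on_const] H]) (use W(2) in auto)
  from smooth_on_open_derivative(1)[OF _ this, of 0] e(1)
  have "(\<lambda>t. H (t, x)) differentiable (at 0)" by (auto simp: differentiable_def)
  then have "((\<lambda>t. H (t, x)) has_vector_derivative vector_derivative (\<lambda>t. H (t, x)) (at 0)) (at 0)"
    by (simp add: vector_derivative_works)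
  moreover have "H ` ({-e<..<e} \<times> W) \<subseteq> cdom a"
  proof
    fix y assume "y \<in> H ` ({-e<..<e} \<times> W)"
    then obtain p where p: "p \<in> {-e<..<e} \<times> W" "y = \<rho> (K p)" unfolding H_def by blast
    then obtain u where "u \<in> V" "K p = \<tau> u" using KW[OF p(1)] by blast
    then show "y \<in> cdom a" using p(2) V(7) Va by auto
  qed
  moreover have "\<forall>y\<in>W. H (0, y) = y" using W(3) K0 V(7) by (auto simp: H_def)
  moreover have "\<forall>t\<in>{-e<..<e}. \<forall>y\<in>W. cmap a (H (t, y)) = D_act X (qclass Q (t *\<^sub>R Y)) (cmap a y)"
  proof (intro ballI)
    fix t y assume ty: "t \<in> {-e<..<e}" "y \<in> W"
    then obtain u where u: "u \<in> V" "K (t, y) = \<tau> u" using KW[of "(t, y)"] by blast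
    have y: "y \<in> V" "\<tau> y \<in> cdom b" using ty(2) W(3) V(4) by auto
    have "cmap a (H (t, y)) = cmap b (K (t, y))" using u V(7,8) by (simp add: H_def)
    also have "\<dots> = D_act X (qclass Q (t *\<^sub>R Y)) (cmap a y)"
      using L(4)[OF y(2)] V(8)[OF y(1)] by (simp add: K_def)
    finally show "cmap a (H (t, y)) = D_act X (qclass Q (t *\<^sub>R Y)) (cmap a y)" .
  qed
  ultimately show ?thesis
    unfolding fundamental_vector_def using e(1) W(1,2) H
    by (intro exI[of _ "vector_derivative (\<lambda>t. H (t, x)) (at 0)"] exI[of _ W] exI[of _ H] exI[of _ e]) simp
qed

text \<open>A product of quotient maps need not be a quotient map. Here both projections are open,
  so boxes have open images and continuity can be checked on representatives in \<dd> and
  \<open>S\<close>.\<close>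

lemma continuous_map_D_act:
  "continuous_map (prod_topology (quasitorus_top Q) T) T (\<lambda>(c, m). D_act X c m)"
proof -
  obtain s where s: "linear s" "\<And>Y. pi_map X (s Y) = Y" using obtain_right_inverse by metis
  have act: "D_act X (qclass Q Y) (N_orbit X Q z) = N_orbit X Q (tmul (texp (s Y)) z)" for Y z
    using D_act_N_orbit[OF Q, of X "s Y" z] s(2) by simp
  have topQ: "\<exists>Y. c = qclass Q Y" if "c \<in> topspace (quasitorus_top Q)" for c
    using that unfolding quasitorus_top_def topspace_def openin_quotient_top by auto
  have cont: "continuous_on (UNIV \<times> S) (\<lambda>p. tmul (texp (s (fst p))) (snd p))"
  proof (rule smooth_on_imp_continuous_on, rule smooth_on_tmul_texp)
    show "smooth_on (UNIV \<times> S) (\<lambda>p :: 'a \<times> (complex ^ 'd). s (fst p))"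
      using s(1) unfolding linear_conv_bounded_linear
      by (rule smooth_on_bounded_linear_compose[OF _ smooth_on_linear[OF bounded_linear_fst]])
    show "smooth_on (UNIV \<times> S) (\<lambda>p :: 'a \<times> (complex ^ 'd). snd p)"
      by (rule smooth_on_linear[OF bounded_linear_snd])
  qed
  show ?thesis
    unfolding continuous_map_def
  proof (intro conjI allI impI)
    show "(\<lambda>(c, m). D_act X c m) \<in> topspace (prod_topology (quasitorus_top Q) T) \<rightarrow> topspace T"
    proof
      fix p assume "p \<in> topspace (prod_topology (quasitorus_top Q) T)"
      then obtain c z where p: "p = (c, N_orbit X Q z)" "c \<in> topspace (quasitorus_top Q)" "z \<in> S"
        by (auto simp: topspace_T)
      obtain Y where "c = qclass Q Y" using topQ[OF p(2)] by blast
      then show "(case p of (c, m) \<Rightarrow> D_act X c m) \<in> topspace T"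
        using p S_inv by (auto simp: act topspace_T)
    qed
    fix U assume U: "openin T U"
    have oU: "openin (top_of_set S) {z\<in>S. N_orbit X Q z \<in> U}"
      using U openin_T by blast
    have "openin (top_of_set (UNIV \<times> S)) ((UNIV \<times> S) \<inter> (\<lambda>p. tmul (texp (s (fst p))) (snd p)) -` {z\<in>S. N_orbit X Q z \<in> U})"
      using S_inv by (intro continuous_openin_preimage[OF cont _ oU]) auto
    then obtain O1 where O1: "open O1"
      "(UNIV \<times> S) \<inter> (\<lambda>p. tmul (texp (s (fst p))) (snd p)) -` {z\<in>S. N_orbit X Q z \<in> U} = (UNIV \<times> S) \<inter> O1"
      by (auto simp: openin_open)
    have O1_iff: "(Y, z) \<in> O1 \<longleftrightarrow> N_orbit X Q (tmul (texp (s Y)) z) \<in> U" if "z \<in> S" for Y z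
      using O1(2) that S_inv by (fastforce simp: set_eq_iff)
    show "openin (prod_topology (quasitorus_top Q) T)
        {p \<in> topspace (prod_topology (quasitorus_top Q) T). (case p of (c, m) \<Rightarrow> D_act X c m) \<in> U}"
      unfolding openin_prod_topology_alt
    proof (intro allI impI)
      fix c m assume "(c, m) \<in> {p \<in> topspace (prod_topology (quasitorus_top Q) T). (case p of (c, m) \<Rightarrow> D_act X c m) \<in> U}"
      then have c: "c \<in> topspace (quasitorus_top Q)" and m: "m \<in> topspace T" and cm: "D_act X c m \<in> U" by auto
      obtain Y where Y: "c = qclass Q Y" using topQ[OF c] by blast
      obtain z where z: "z \<in> S" "m = N_orbit X Q z" using m topspace_T by auto
      have "(Y, z) \<in> O1" using cm O1_iff[OF z(1)] by (simp add: Y z(2) act)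
      then obtain A B where AB: "open A" "open B" "Y \<in> A" "z \<in> B" "A \<times> B \<subseteq> O1"
        using open_prod_elim[OF O1(1)] by (metis mem_Sigma_iff)
      have "openin T (N_orbit X Q ` (S \<inter> B))"
        using AB(2) by (intro openin_T_image openin_open_Int)
      moreover have "qclass Q ` A \<times> N_orbit X Q ` (S \<inter> B) \<subseteq>
          {p \<in> topspace (prod_topology (quasitorus_top Q) T). (case p of (c, m) \<Rightarrow> D_act X c m) \<in> U}"
      proof
        fix p assume "p \<in> qclass Q ` A \<times> N_orbit X Q ` (S \<inter> B)"
        then obtain Y' z' where p: "p = (qclass Q Y', N_orbit X Q z')" "Y' \<in> A" "z' \<in> S" "z' \<in> B" by blast
        have "qclass Q Y' \<in> topspace (quasitorus_top Q)"
          using openin_subset[OF openin_quasitorus_top_image[OF Q AB(1)]] p(2) by blast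
        moreover have "(Y', z') \<in> O1" using p AB(5) by blast
        ultimately show "p \<in> {p \<in> topspace (prod_topology (quasitorus_top Q) T). (case p of (c, m) \<Rightarrow> D_act X c m) \<in> U}"
          using p O1_iff[OF p(3)] by (simp add: topspace_T act)
      qed
      ultimately show "\<exists>U' V'. openin (quasitorus_top Q) U' \<and> openin T V' \<and> c \<in> U' \<and> m \<in> V' \<and> U' \<times> V' \<subseteq>
          {p \<in> topspace (prod_topology (quasitorus_top Q) T). (case p of (c, m) \<Rightarrow> D_act X c m) \<in> U}"
        using openin_quasitorus_top_image[OF Q AB(1)] AB(3,4) Y z
        by (intro exI[of _ "qclass Q ` A"] exI[of _ "N_orbit X Q ` (S \<inter> B)"]) blast
    qed
  qed
qed

lemma smooth_quasitorus_action_D_act: "smooth_quasitorus_action Q T \<A> (D_act X)"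
proof -
  obtain s where s: "linear s" "\<And>Y. pi_map X (s Y) = Y" using obtain_right_inverse by metis
  have act: "D_act X (qclass Q Y) (N_orbit X Q z) = N_orbit X Q (tmul (texp (s Y)) z)" for Y z
    using D_act_N_orbit[OF Q, of X "s Y" z] s(2) by simp
  have smooth: "\<exists>a\<in>prod_charts {quasitorus_chart Q} \<A>. \<exists>b\<in>\<A>. p \<in> cim a \<and> (case p of (c, m) \<Rightarrow> D_act X c m) \<in> cim b \<and>
        (\<exists>F. smooth_on (cdom a) F \<and> F ` cdom a \<subseteq> cdom b \<and>
             (\<forall>u\<in>cdom a. cmap b (F u) = (case cmap a u of (c, m) \<Rightarrow> D_act X c m)))"
    if p: "p \<in> topspace (prod_topology (quasitorus_top Q) T)" for p
  proof -
    obtain c m where cm: "p = (c, m)" "c \<in> topspace (quasitorus_top Q)" "m \<in> topspace T"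
      using p by auto
    obtain Y where Y: "c = qclass Q Y"
      using cm(2) unfolding quasitorus_top_def topspace_def openin_quotient_top by auto
    obtain z where z: "z \<in> S" "m = N_orbit X Q z" using cm(3) topspace_T by auto
    obtain b L where b: "b \<in> \<A>" "lifted_action X Q b L" "local_lift X Q S b z"
      using good_charts[OF z(1)] by blast
    have L: "smooth_on (UNIV \<times> cdom b) L" "L ` (UNIV \<times> cdom b) \<subseteq> cdom b"
      "\<And>Y w. w \<in> cdom b \<Longrightarrow> cmap b (L (Y, w)) = D_act X (qclass Q Y) (cmap b w)"
      using b(2) unfolding lifted_action_def by auto
    have "m \<in> cim b"
      using b(3) z(2) unfolding local_lift_def cim_def by (metis image_eqI image_subset_iff)
    then obtain w where w: "w \<in> cdom b" "m = cmap b w" unfolding cim_def by blast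
    \<comment> \<open>The product of \<open>quasitorus_chart Q\<close>, whose domain is all of
      \<dd>, with \<open>b\<close>; on it the lift \<open>L\<close> represents the action.\<close>
    define a where "a = \<lparr>cdom = UNIV \<times> cdom b,
       cgrp = {restrict (map_prod g h) (UNIV \<times> cdom b) | g h. g \<in> (+) ` Q \<and> h \<in> cgrp b},
       cmap = map_prod (qclass Q) (cmap b)\<rparr>"
    have "a \<in> prod_charts {quasitorus_chart Q} \<A>"
      unfolding prod_charts_def a_def using b(1)
      by (intro CollectI exI[of _ "quasitorus_chart Q"] exI[of _ b]) (simp add: quasitorus_chart_def)
    moreover have "p \<in> cim a"
      using w by (auto simp: cim_def a_def cm(1) Y intro!: image_eqI[of _ _ "(Y, w)"])
    moreover have "D_act X c m \<in> cim b"
    proof -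
      have "L (Y, w) \<in> cdom b" using L(2) w(1) by blast
      then show ?thesis using L(3)[OF w(1), of Y] by (auto simp: cim_def w(2) Y intro!: image_eqI)
    qed
    moreover have "smooth_on (cdom a) L \<and> L ` cdom a \<subseteq> cdom b \<and>
             (\<forall>u\<in>cdom a. cmap b (L u) = (case cmap a u of (c, m) \<Rightarrow> D_act X c m))"
      using L by (auto simp: a_def)
    ultimately show ?thesis using b(1) cm(1) by (intro bexI[of _ a] bexI[of _ b]) auto
  qed
  show ?thesis
    unfolding smooth_quasitorus_action_def quasifold_smooth_def
  proof (intro conjI ballI allI)
    fix m assume "m \<in> topspace T"
    then show "D_act X (qclass Q 0) m = m"
      using linear_0[OF s(1)] by (auto simp: topspace_T act)
  next
    fix Y Z m assume "m \<in> topspace T"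
    then show "D_act X (qclass Q (Y + Z)) m = D_act X (qclass Q Y) (D_act X (qclass Q Z) m)"
      by (auto simp: topspace_T act tmul_texp_add linear_add[OF s(1)])
  qed (use continuous_map_D_act smooth in blast)+
qed

text \<open>Trades the definite description in \<open>Phi\<close> for a formula in \<open>z\<close>
  that is smooth by inspection.\<close>

lemma Phi_eq_sum:
  assumes "z \<in> S" and "\<And>Y. pi_map X (s Y) = Y"
  shows "Phi X lam (N_orbit X Q z) = (\<Sum>b\<in>Basis. Ups lam z (s b) *\<^sub>R b)"
proof -
  have "Phi X lam (N_orbit X Q z) \<bullet> b = Ups lam z (s b)" for b
    using Phi_N_orbit[OF Q surj_pi subsetD[OF S_Psi assms(1)], of "s b"] assms(2) by simp
  then show ?thesis
    using euclidean_representation[of "Phi X lam (N_orbit X Q z)"] by simp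
qed

lemma quasifold_smooth_Phi: "quasifold_smooth T \<A> euclidean {vector_space_chart} (Phi X lam)"
proof -
  obtain s where s: "linear s" "\<And>Y. pi_map X (s Y) = Y" using obtain_right_inverse by metis
  define \<Phi>' where "\<Phi>' z = (\<Sum>b\<in>Basis. Ups lam z (s b) *\<^sub>R b)" for z
  have Phi: "Phi X lam (N_orbit X Q z) = \<Phi>' z" if "z \<in> S" for z
    unfolding \<Phi>'_def by (rule Phi_eq_sum[OF that s(2)])
  have sm: "smooth_on B (\<lambda>u. \<Phi>' (f u))" if "smooth_on B f" for B f
    unfolding \<Phi>'_def by (intro smooth_on_sum smooth_on_scaleR smooth_on_Ups that smooth_on_const)
  have "continuous_map T euclidean (Phi X lam)"
    unfolding continuous_map_def
  proof (intro conjI allI impI)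
    fix U :: "'a set" assume "openin euclidean U"
    then have "openin (top_of_set S) (S \<inter> \<Phi>' -` U)"
      using smooth_on_imp_continuous_on[OF sm[OF smooth_on_id]] by (intro continuous_openin_preimage_gen) auto
    moreover have "{z\<in>S. N_orbit X Q z \<in> {m \<in> topspace T. Phi X lam m \<in> U}} = S \<inter> \<Phi>' -` U"
      by (auto simp: topspace_T Phi)
    ultimately show "openin T {m \<in> topspace T. Phi X lam m \<in> U}"
      unfolding openin_T by (auto simp: topspace_T)
  qed auto
  moreover have "\<exists>a\<in>\<A>. \<exists>b\<in>{vector_space_chart}. m \<in> cim a \<and> Phi X lam m \<in> cim b \<and>
        (\<exists>F. smooth_on (cdom a) F \<and> F ` cdom a \<subseteq> cdom b \<and> (\<forall>u\<in>cdom a. cmap b (F u) = Phi X lam (cmap a u)))"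
    if m: "m \<in> topspace T" for m
  proof -
    obtain z where z: "z \<in> S" "m = N_orbit X Q z" using m topspace_T by auto
    obtain a \<sigma> where a: "a \<in> \<A>" "smooth_section X Q S a \<sigma>" "local_lift X Q S a z"
      using good_charts[OF z(1)] by blast
    have "m \<in> cim a"
      using a(3) z(2) unfolding local_lift_def cim_def by (metis image_eqI image_subset_iff)
    moreover have "smooth_on (cdom a) (\<lambda>u. \<Phi>' (\<sigma> u))"
      using a(2) by (intro sm) (simp add: smooth_section_def)
    moreover have "\<Phi>' (\<sigma> u) = Phi X lam (cmap a u)" if "u \<in> cdom a" for u
      using a(2) Phi that unfolding smooth_section_def by metis
    ultimately show ?thesis
      using a(1) by (intro bexI[of _ a] bexI[of _ vector_space_chart] conjI exI[of _ "\<lambda>u. \<Phi>' (\<sigma> u)"])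
        (auto simp: vector_space_chart_def cim_def)
  qed
  ultimately show ?thesis unfolding quasifold_smooth_def by blast
qed

lemma hamiltonian_action_D_act: "hamiltonian_action Q T \<A> \<omega> (D_act X) (Phi X lam)"
  unfolding hamiltonian_action_def
proof (intro conjI ballI allI impI)
  fix c m assume "c \<in> range (qclass Q)" "m \<in> topspace T"
  then obtain Y z where c: "c = qclass Q Y" and z: "z \<in> S" "m = N_orbit X Q z" using topspace_T by auto
  obtain s where s: "linear s" "\<And>Y. pi_map X (s Y) = Y" using obtain_right_inverse by metis
  have "D_act X c m = N_orbit X Q (tmul (texp (s Y)) z)"
    using D_act_N_orbit[OF Q, of X "s Y" z] s(2) by (simp add: c z)
  then show "Phi X lam (D_act X c m) = Phi X lam m"
    using Phi_eq_sum[OF S_inv[OF z(1)] s(2)] Phi_eq_sum[OF z(1) s(2)] by (simp add: z(2))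
qed (use preserves_form_D_act quasifold_smooth_Phi fundamental_vector_exists fundamental_vector_moment in auto)

end

section \<open>The charts of the pieces are good\<close>

text \<open>The charts of the regular piece are the case \<open>J = {}\<close>, \<open>K = UNIV\<close> of the following ones, those of
  a singular piece the case \<open>K = - {0}\<close>.\<close>

definition model_dom ::
  "('d::finite \<Rightarrow> 'a::euclidean_space) \<Rightarrow> ('d \<Rightarrow> real) \<Rightarrow> 'a \<Rightarrow> 'd set \<Rightarrow> 'd set \<Rightarrow> complex set \<Rightarrow> (complex ^ 'd) set" where
  "model_dom X lam \<mu> I J K = {w \<in> coord_set K (I - J). \<forall>k. k \<notin> I \<union> J \<longrightarrow> singular_sq X lam \<mu> I J w k > 0}"

definition model_section ::
  "('d::finite \<Rightarrow> 'a::euclidean_space) \<Rightarrow> ('d \<Rightarrow> real) \<Rightarrow> 'a \<Rightarrow> 'd set \<Rightarrow> 'd set \<Rightarrow> complex ^ 'd \<Rightarrow> complex ^ 'd" where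
  "model_section X lam \<mu> I J w =
     (\<chi> j. if j \<in> I - J then w $ j else if j \<in> I \<union> J then 0 else of_real (sqrt (singular_sq X lam \<mu> I J w j)))"

lemma regular_sq_eq: "regular_sq X lam \<mu> I = singular_sq X lam \<mu> I {}"
  by (simp add: fun_eq_iff regular_sq_def singular_sq_def)

lemma regular_dom_eq: "regular_dom X lam \<mu> I = model_dom X lam \<mu> I {} UNIV"
  by (simp add: regular_dom_def model_dom_def regular_sq_eq)

lemma cmap_regular_base_chart: "cmap (regular_base_chart X lam Q \<mu> I) w = N_orbit X Q (model_section X lam \<mu> I {} w)"
  by (simp add: regular_base_chart_def model_section_def regular_sq_eq cong: if_cong)

lemma singular_dom_eq: "singular_dom X lam \<mu> I J = model_dom X lam \<mu> I J (- {0})"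
  by (simp add: singular_dom_def model_dom_def)

lemma cmap_singular_base_chart: "cmap (singular_base_chart X lam Q \<mu> I J) w = N_orbit X Q (model_section X lam \<mu> I J w)"
  by (simp add: singular_base_chart_def model_section_def)

lemma singular_sq_cong:
  assumes "\<And>h. h \<in> I - J \<Longrightarrow> cmod (v $ h) = cmod (w $ h)"
  shows "singular_sq X lam \<mu> I J v k = singular_sq X lam \<mu> I J w k"
  using assms by (simp add: singular_sq_def)

text \<open>The linear section of \<open>pi_map X\<close> supported on \<open>I\<close>, given by
  coordinates in the basis of normals. Through it \<dd> acts by elements of the torus of
  \<open>I\<close>, which leave the coordinates outside \<open>I\<close> fixed, as the base charts
  require.\<close>

definition base_section :: "('d::finite \<Rightarrow> 'a::euclidean_space) \<Rightarrow> 'd set \<Rightarrow> 'a \<Rightarrow> real ^ 'd" where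
  "base_section X I Y = (\<chi> h. if h \<in> I then representation (X ` I) Y (X h) else 0)"

lemma vertex_basesD:
  assumes "I \<in> vertex_bases X lam \<mu>"
  shows "inj_on X I" "independent (X ` I)" "span (X ` I) = UNIV" "\<And>h. h \<in> I \<Longrightarrow> \<mu> \<bullet> X h = lam h"
  using assms by (auto simp: vertex_bases_def active_indices_def)

lemma linear_base_section:
  assumes "I \<in> vertex_bases X lam \<mu>"
  shows "linear (base_section X I)"
  using vertex_basesD[OF assms]
  by (intro linearI) (auto simp: base_section_def vec_eq_iff representation_add representation_scale)

lemma representation_expansion:
  assumes "I \<in> vertex_bases X lam \<mu>"
  shows "(\<Sum>h\<in>I. representation (X ` I) Y (X h) *\<^sub>R X h) = Y"
proof -
  note I = vertex_basesD[OF assms]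
  have "(\<Sum>b\<in>X ` I. representation (X ` I) Y b *\<^sub>R b) = Y"
    using I by (intro sum_representation_eq) auto
  then show ?thesis using I(1) by (simp add: sum.reindex)
qed

lemma pi_map_base_section:
  assumes "I \<in> vertex_bases X lam \<mu>"
  shows "pi_map X (base_section X I Y) = Y"
proof -
  have "pi_map X (base_section X I Y) = (\<Sum>h\<in>I. representation (X ` I) Y (X h) *\<^sub>R X h)"
    unfolding pi_map_def base_section_def
    by (rule sum.mono_neutral_cong_right) auto
  then show ?thesis using representation_expansion[OF assms] by simp
qed

text \<open>The squared moduli of the coordinates outside \<open>I\<close> are read off from those in \<open>I\<close>, because
  \<open>e\<^sub>k - \<Sum>h\<in>I. a\<^sub>h\<^sub>k e\<^sub>h\<close> lies in the kernel of \<^term>\<open>pi_map X\<close>.\<close>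

lemma singular_sq_level:
  fixes X :: "'d::finite \<Rightarrow> 'a::euclidean_space"
  assumes I: "I \<in> vertex_bases X lam \<mu>" and z: "z \<in> Psi_zero X lam" "\<And>j. j \<in> J \<Longrightarrow> z $ j = 0"
  shows "singular_sq X lam \<mu> I J z k = (cmod (z $ k))\<^sup>2"
proof -
  let ?a = "\<lambda>h. base_coeff X I h k"
  define v :: "real ^ 'd" where "v = axis k 1 - (\<Sum>h\<in>I. ?a h *\<^sub>R axis h 1)"
  have ax: "pi_map X (axis j 1) = X j" for j
    by (simp add: pi_map_def axis_def if_distrib[of "\<lambda>r. r *\<^sub>R _"] cong: if_cong)
  have "pi_map X v = 0"
    using representation_expansion[OF I, of "X k"]
    by (simp add: v_def linear_diff[OF linear_pi_map] linear_sum[OF linear_pi_map] linear_scale[OF linear_pi_map]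
        ax base_coeff_def)
  then have "Ups lam z v = 0" using z(1) by (simp add: Psi_zero_def)
  moreover have "Ups lam z (axis j 1) = (cmod (z $ j))\<^sup>2 + lam j" for j
    by (simp add: Ups_def axis_def if_distrib[of "\<lambda>r. _ * r"] cong: if_cong)
  ultimately have level: "(cmod (z $ k))\<^sup>2 + lam k = (\<Sum>h\<in>I. ?a h * ((cmod (z $ h))\<^sup>2 + lam h))"
    by (simp add: v_def linear_diff[OF linear_Ups] linear_sum[OF linear_Ups] linear_scale[OF linear_Ups])
  have split: "(\<Sum>h\<in>I. f h) = (\<Sum>h\<in>I \<inter> J. f h) + (\<Sum>h\<in>I - J. f h)" for f :: "'d \<Rightarrow> real"
    by (rule sum.Int_Diff) simp
  show ?thesis
  \<comment> \<open>For \<open>k\<close> active at the vertex, \<mu> satisfies the equations of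
    \<open>k\<close> and of all \<open>h\<close> in \<open>I\<close>, so the constants
    \<open>lam\<close> cancel. For other \<open>k\<close> they stay in the formula.\<close>
  proof (cases "k \<in> active_indices X lam \<mu>")
    case True
    then have "lam k = \<mu> \<bullet> (\<Sum>h\<in>I. ?a h *\<^sub>R X h)"
      using representation_expansion[OF I, of "X k"] by (simp add: active_indices_def base_coeff_def)
    also have "\<dots> = (\<Sum>h\<in>I. ?a h * lam h)"
      using vertex_basesD(4)[OF I] by (simp add: inner_sum_right)
    finally have "(cmod (z $ k))\<^sup>2 = (\<Sum>h\<in>I. ?a h * (cmod (z $ h))\<^sup>2)"
      using level by (simp add: distrib_left sum.distrib)
    also have "\<dots> = (\<Sum>h\<in>I - J. ?a h * (cmod (z $ h))\<^sup>2)"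
      unfolding split using z(2) by simp
    finally show ?thesis using True by (simp add: singular_sq_def)
  next
    case False
    have "(\<Sum>h\<in>I. ?a h * ((cmod (z $ h))\<^sup>2 + lam h))
      = (\<Sum>h\<in>I \<inter> J. ?a h * lam h) + (\<Sum>h\<in>I - J. ?a h * ((cmod (z $ h))\<^sup>2 + lam h))"
      unfolding split using z(2) by simp
    then show ?thesis using False level by (simp add: singular_sq_def)
  qed
qed

lemma smooth_on_singular_sq: "smooth_on S (\<lambda>w. singular_sq X lam \<mu> I J w k)"
proof -
  have sq: "smooth_on S (\<lambda>w. (cmod (w $ h))\<^sup>2)" for h
    unfolding power2_norm_eq_inner
    by (rule smooth_on_bilinear[OF bounded_bilinear_inner smooth_on_vec_nth[OF smooth_on_id] smooth_on_vec_nth[OF smooth_on_id]])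
  show ?thesis
  proof (cases "k \<in> active_indices X lam \<mu>")
    case True
    then show ?thesis
      by (simp add: singular_sq_def) (intro smooth_on_sum smooth_on_mult smooth_on_const sq)
  next
    case False
    then show ?thesis
      by (simp add: singular_sq_def) (intro smooth_on_diff smooth_on_add smooth_on_sum smooth_on_mult smooth_on_const sq)
  qed
qed

text \<open>Positivity on the domain keeps the square roots away from zero, where they would fail to
  be smooth.\<close>

lemma smooth_on_model_section: "smooth_on (model_dom X lam \<mu> I J K) (model_section X lam \<mu> I J)"
proof -
  let ?U = "model_dom X lam \<mu> I J K"
  have "smooth_on ?U (\<lambda>w. if j \<in> I - J then w $ j else if j \<in> I \<union> J then 0
      else complex_of_real (sqrt (singular_sq X lam \<mu> I J w j)))" for j
  proof -
    consider "j \<in> I - J" | "j \<in> I \<union> J" "j \<notin> I - J" | "j \<notin> I \<union> J" by blast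
    then show ?thesis
    proof cases
      case 1
      then show ?thesis by (simp add: smooth_on_vec_nth smooth_on_id)
    next
      case 2
      then show ?thesis using smooth_on_const[of ?U "0 :: complex"] by auto
    next
      case 3
      have "smooth_on ?U (\<lambda>w. complex_of_real (sqrt (singular_sq X lam \<mu> I J w j)))"
        by (rule smooth_on_bounded_linear_compose[OF bounded_linear_of_real smooth_on_sqrt[OF smooth_on_singular_sq]])
          (use 3 in \<open>simp add: model_dom_def\<close>)
      then show ?thesis using 3 by simp
    qed
  qed
  from smooth_on_vec_lambda[OF this] show ?thesis
    unfolding model_section_def[abs_def] .
qed

lemma texp_base_section_outside: "h \<notin> I \<Longrightarrow> texp (base_section X I Y) $ h = 1"
  by (simp add: texp_def base_section_def)

lemma model_dom_tmul:
  assumes K: "\<And>u z. z \<in> K \<Longrightarrow> cmod u = 1 \<Longrightarrow> u * z \<in> K" and w: "w \<in> model_dom X lam \<mu> I J K"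
  shows "tmul (texp x) w \<in> model_dom X lam \<mu> I J K"
proof -
  have "singular_sq X lam \<mu> I J (tmul (texp x) w) k = singular_sq X lam \<mu> I J w k" for k
    by (rule singular_sq_cong) (simp add: norm_mult)
  moreover have "tmul (texp x) w \<in> coord_set K (I - J)"
    using w K by (auto simp: model_dom_def coord_set_def split: if_splits)
  ultimately show ?thesis using w by (simp add: model_dom_def)
qed

text \<open>The torus element is 1 outside \<open>I\<close>, where the section has its square roots,
  and these depend on moduli alone.\<close>

lemma model_section_tmul:
  "model_section X lam \<mu> I J (tmul (texp (base_section X I Y)) w) = tmul (texp (base_section X I Y)) (model_section X lam \<mu> I J w)"
proof -
  have "singular_sq X lam \<mu> I J (tmul (texp x) w) k = singular_sq X lam \<mu> I J w k" for k x
    by (rule singular_sq_cong) (simp add: norm_mult)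
  then show ?thesis
    by (auto simp: vec_eq_iff model_section_def texp_base_section_outside)
qed

text \<open>Near a given point one can move by an element of \<open>N\<close> depending smoothly on the point
  to the slice where the coordinates outside \<open>I\<close> are positive; this inverts \<open>model_section\<close>.\<close>

lemma model_local_lift:
  fixes X :: "'d::finite \<Rightarrow> 'a::euclidean_space"
  assumes Q: "quasilattice Q" and I: "I \<in> vertex_bases X lam \<mu>"
    and K: "open K" "\<And>u z. z \<in> K \<Longrightarrow> cmod u = 1 \<Longrightarrow> u * z \<in> K"
    and S: "S \<subseteq> Psi_zero X lam" "\<And>z j. z \<in> S \<Longrightarrow> j \<in> J \<Longrightarrow> z $ j = 0"
    and z: "z0 \<in> S" "\<And>k. k \<notin> I \<union> J \<Longrightarrow> z0 $ k \<noteq> 0" "\<And>h. h \<in> I - J \<Longrightarrow> z0 $ h \<in> K"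
  shows "\<exists>W P. openin (top_of_set S) W \<and> z0 \<in> W \<and> smooth_on W P \<and> P ` W \<subseteq> model_dom X lam \<mu> I J K \<and>
    (\<forall>y\<in>W. N_orbit X Q (model_section X lam \<mu> I J (P y)) = N_orbit X Q y)"
proof -
  \<comment> \<open>A branch of the argument is needed near \<open>z0\<close>.
    \<open>\<theta>0 k\<close> is the phase of its coordinate \<open>k\<close>, and
    \<open>u k\<close> rotates this phase away, so that near \<open>z0\<close> its values lie in the
    right half-plane, where \<open>Ln\<close> is holomorphic.\<close>
  define \<theta>0 where "\<theta>0 k = Im (Ln (z0 $ k))" for k
  define u where "u k z = z $ k * exp (- \<i> * \<theta>0 k)" for k and z :: "complex ^ 'd"
  define W where "W = S \<inter> (\<Inter>k\<in>- (I \<union> J). {z. 0 < Re (u k z)}) \<inter> (\<Inter>h\<in>I - J. {z. z $ h \<in> K})"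
  define t where "t z = (\<chi> k. if k \<in> I \<union> J then 0 else - (\<theta>0 k + Im (Ln (u k z))) / (2 * pi))" for z
  \<comment> \<open>Rotation by \<open>t\<close> makes the coordinates outside
    \<open>I \<union> J\<close> positive, but \<open>t\<close> need not lie in the kernel of
    \<open>pi_map X\<close>. Subtracting the section of its image returns to the kernel and alters
    only entries in \<open>I\<close>, so positivity is kept.\<close>
  define x where "x z = t z - base_section X I (pi_map X (t z))" for z
  define P where "P z = (\<chi> j. if j \<in> I - J then tmul (texp (x z)) z $ j else 0)" for z
  have WS: "W \<subseteq> S" by (auto simp: W_def)
  have ou: "open {z. 0 < Re (u k z)}" for k
    unfolding u_def by (intro open_Collect_less continuous_intros)
  have oK: "open {z :: complex ^ 'd. z $ h \<in> K}" for h
    using open_vimage[OF K(1), of "\<lambda>z :: complex ^ 'd. z $ h"] by (simp add: vimage_def continuous_intros)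
  have W: "openin (top_of_set S) W"
    unfolding W_def Int_assoc
    by (intro openin_open_Int open_Int open_INT ballI ou oK) auto
  have z0: "z0 \<in> W"
  proof -
    have "u k z0 = of_real (cmod (z0 $ k))" if "k \<notin> I \<union> J" for k
    proof -
      have "z0 $ k = exp (of_real (Re (Ln (z0 $ k))) + \<i> * \<theta>0 k)"
        using z(2)[OF that] unfolding \<theta>0_def by (metis complex_eq exp_Ln)
      then have "u k z0 = exp (of_real (Re (Ln (z0 $ k))) + \<i> * \<theta>0 k) * exp (- \<i> * \<theta>0 k)"
        unfolding u_def by simp
      also have "\<dots> = of_real (exp (Re (Ln (z0 $ k))))"
        by (simp add: exp_add[symmetric] exp_of_real del: exp_add)
      finally show ?thesis using z(2)[OF that] by (simp add: Re_Ln)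
    qed
    then show ?thesis using z by (simp add: W_def)
  qed
  have smu: "smooth_on B (u k)" for B k
    unfolding u_def[abs_def] by (intro smooth_on_mult smooth_on_vec_nth smooth_on_id smooth_on_const)
  have smt: "smooth_on W t"
    unfolding t_def[abs_def]
  proof (rule smooth_on_vec_lambda)
    fix k
    show "smooth_on W (\<lambda>z. if k \<in> I \<union> J then 0 else - (\<theta>0 k + Im (Ln (u k z))) / (2 * pi))"
    proof (cases "k \<in> I \<union> J")
      case False
      have "smooth_on W (\<lambda>z. Ln (u k z))"
      proof (rule smooth_on_holomorphic[of "- \<real>\<^sub>\<le>\<^sub>0" Ln W "u k"])
        show "u k ` W \<subseteq> - \<real>\<^sub>\<le>\<^sub>0"
        proof
          fix v assume "v \<in> u k ` W"
          then have "0 < Re v" using False by (auto simp: W_def)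
          then show "v \<in> - \<real>\<^sub>\<le>\<^sub>0" by (simp add: complex_nonpos_Reals_iff)
        qed
        show "open (- \<real>\<^sub>\<le>\<^sub>0 :: complex set)" by (simp add: open_Compl)
      qed (auto intro: smu holomorphic_on_Ln)
      then have "smooth_on W (\<lambda>z. (\<theta>0 k + Im (Ln (u k z))) * (- 1 / (2 * pi)))"
        by (intro smooth_on_mult smooth_on_const smooth_on_add smooth_on_bounded_linear_compose[OF bounded_linear_Im])
      moreover have "(\<theta>0 k + Im (Ln (u k z))) * (- 1 / (2 * pi)) = (if k \<in> I \<union> J then 0 else - (\<theta>0 k + Im (Ln (u k z))) / (2 * pi))" for z
        using False by (simp add: diff_divide_distrib add_divide_distrib)
      ultimately show ?thesis by (simp only:)
    qed (simp add: smooth_on_const)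
  qed
  have smx: "smooth_on W x"
  proof -
    have "linear (\<lambda>v. base_section X I (pi_map X v))"
      using linear_compose[OF linear_pi_map linear_base_section[OF I]] by (simp add: o_def)
    then have "bounded_linear (\<lambda>v. base_section X I (pi_map X v))"
      by (simp add: linear_conv_bounded_linear)
    from smooth_on_diff[OF smt smooth_on_bounded_linear_compose[OF this smt]] show ?thesis
      by (simp add: x_def[abs_def])
  qed
  have smP: "smooth_on W P"
    unfolding P_def[abs_def]
  proof (rule smooth_on_vec_lambda)
    fix j
    show "smooth_on W (\<lambda>z. if j \<in> I - J then tmul (texp (x z)) z $ j else 0)"
      by (cases "j \<in> I - J")
        (simp_all only: if_True if_False smooth_on_const smooth_on_vec_nth[OF smooth_on_tmul_texp[OF smx smooth_on_id]])
  qed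
  have main: "P y \<in> model_dom X lam \<mu> I J K \<and> model_section X lam \<mu> I J (P y) = tmul (texp (x y)) y" if y: "y \<in> W" for y
  proof -
    have yS: "y \<in> S" using y WS by blast
    have pos: "tmul (texp (x y)) y $ k = of_real (cmod (y $ k)) \<and> y $ k \<noteq> 0" if k: "k \<notin> I \<union> J" for k
    proof -
      have Re: "0 < Re (u k y)" using y k by (simp add: W_def)
      then have u0: "u k y \<noteq> 0" by auto
      have "x y $ k = - (\<theta>0 k + Im (Ln (u k y))) / (2 * pi)"
        using k by (simp add: x_def t_def base_section_def)
      then have e: "2 * pi * x y $ k = - \<theta>0 k - Im (Ln (u k y))" by (simp add: field_simps)
      have "2 * of_real pi * \<i> * of_real (x y $ k) = \<i> * of_real (2 * pi * x y $ k)" by simp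
      also have "\<dots> = - \<i> * \<theta>0 k + - \<i> * of_real (Im (Ln (u k y)))"
        unfolding e by (simp add: algebra_simps)
      finally have "texp (x y) $ k = exp (- \<i> * \<theta>0 k) * exp (- \<i> * of_real (Im (Ln (u k y))))"
        unfolding texp_def exp_add[symmetric] by simp
      then have "tmul (texp (x y)) y $ k = u k y * exp (- \<i> * of_real (Im (Ln (u k y))))"
        by (simp add: u_def)
      also have "\<dots> = exp (of_real (Re (Ln (u k y))) + \<i> * of_real (Im (Ln (u k y)))) * exp (- \<i> * of_real (Im (Ln (u k y))))"
        using exp_Ln[OF u0] by (metis complex_eq)
      also have "\<dots> = of_real (exp (Re (Ln (u k y))))"
        by (simp add: exp_add[symmetric] exp_of_real del: exp_add)
      also have "exp (Re (Ln (u k y))) = cmod (y $ k)"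
        using u0 by (simp add: Re_Ln) (simp add: u_def norm_mult)
      finally show ?thesis using u0 by (auto simp: u_def)
    qed
    \<comment> \<open>Rotation preserves moduli and \<open>y\<close> is on the zero level, so the
      expressions under the roots are squared moduli of coordinates of \<open>y\<close>.\<close>
    have level: "singular_sq X lam \<mu> I J (P y) k = (cmod (y $ k))\<^sup>2" for k
    proof -
      have "singular_sq X lam \<mu> I J (P y) k = singular_sq X lam \<mu> I J y k"
        by (rule singular_sq_cong) (simp add: P_def norm_mult)
      then show ?thesis using singular_sq_level[OF I, of y J k] yS S by auto
    qed
    have "P y \<in> coord_set K (I - J)"
      using y K(2) by (auto simp: coord_set_def P_def W_def)
    then have "P y \<in> model_dom X lam \<mu> I J K"
      using pos by (simp add: model_dom_def level)
    moreover have "model_section X lam \<mu> I J (P y) $ j = tmul (texp (x y)) y $ j" for j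
    proof -
      consider "j \<in> I - J" | "j \<in> J" | "j \<notin> I \<union> J" by blast
      then show ?thesis
      proof cases
        case 1
        then show ?thesis by (simp add: model_section_def P_def)
      next
        case 2
        then show ?thesis using S(2)[OF yS] by (simp add: model_section_def)
      next
        case 3
        then show ?thesis using pos[OF 3] by (simp add: model_section_def level)
      qed
    qed
    ultimately show ?thesis by (simp add: vec_eq_iff)
  qed
  show ?thesis
  proof (intro exI[of _ W] exI[of _ P] conjI ballI W z0 smP)
    show "P ` W \<subseteq> model_dom X lam \<mu> I J K" using main by blast
    fix y assume "y \<in> W"
    moreover have "pi_map X (x y) = 0"
      by (simp add: x_def linear_diff[OF linear_pi_map] pi_map_base_section[OF I])
    then have "pi_map X (x y) \<in> Q" using quasilattice_zero[OF Q] by simp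
    ultimately show "N_orbit X Q (model_section X lam \<mu> I J (P y)) = N_orbit X Q y"
      using main N_orbit_tmul[OF Q] by metis
  qed
qed

section \<open>Vertices of the polytope\<close>

text \<open>If the active normals did not span, some nonzero \<open>v\<close> would be orthogonal to
  them. Small steps along \<open>v\<close> and \<open>-v\<close> would preserve the active equations
  and the finitely many strict inequalities, so \<mu> would be the midpoint of a segment in
  \<Delta>.\<close>

lemma span_active_normals:
  fixes \<Delta> :: "'a::euclidean_space set" and X :: "'d::finite \<Rightarrow> 'a"
  assumes "polytope_normals \<Delta> X lam" and \<mu>: "\<mu> extreme_point_of \<Delta>"
  shows "span (X ` active_indices X lam \<mu>) = UNIV"
proof (rule ccontr)
  let ?A = "active_indices X lam \<mu>"
  have \<Delta>: "\<nu> \<in> \<Delta> \<longleftrightarrow> (\<forall>j. lam j \<le> \<nu> \<bullet> X j)" for \<nu>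
  proof -
    have "\<Delta> = (\<Inter>j. {\<mu>. \<mu> \<bullet> X j \<ge> lam j})" using assms(1) by (simp add: polytope_normals_def)
    then show ?thesis by blast
  qed
  assume "span (X ` ?A) \<noteq> UNIV"
  then have "dim (X ` ?A) < DIM('a)"
    using dim_eq_full dim_subset_UNIV by (metis order_le_less)
  then obtain v where v: "v \<noteq> 0" "\<And>y. y \<in> span (X ` ?A) \<Longrightarrow> orthogonal v y"
    using orthogonal_to_subspace_exists by metis
  have \<mu>\<Delta>: "\<mu> \<in> \<Delta>" using \<mu> by (simp add: extreme_point_of_def)
  have "\<forall>\<^sub>F t in at_right 0. \<forall>j. lam j \<le> (\<mu> + t *\<^sub>R v) \<bullet> X j \<and> lam j \<le> (\<mu> - t *\<^sub>R v) \<bullet> X j"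
  proof (rule eventually_all_finite)
    fix j
    show "\<forall>\<^sub>F t in at_right 0. lam j \<le> (\<mu> + t *\<^sub>R v) \<bullet> X j \<and> lam j \<le> (\<mu> - t *\<^sub>R v) \<bullet> X j"
    proof (cases "j \<in> ?A")
      case True
      then have "v \<bullet> X j = 0" using v(2)[OF span_base] by (auto simp: orthogonal_def)
      then show ?thesis using True by (simp add: inner_add_left inner_diff_left active_indices_def)
    next
      case False
      then have less: "lam j < \<mu> \<bullet> X j" using \<mu>\<Delta> \<Delta>[of \<mu>] by (auto simp: active_indices_def order_less_le)
      have "((\<lambda>t. (\<mu> + t *\<^sub>R v) \<bullet> X j) \<longlongrightarrow> (\<mu> + 0 *\<^sub>R v) \<bullet> X j) (at_right 0)"
        "((\<lambda>t. (\<mu> - t *\<^sub>R v) \<bullet> X j) \<longlongrightarrow> (\<mu> - 0 *\<^sub>R v) \<bullet> X j) (at_right 0)"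
        by (intro tendsto_intros)+
      then have "\<forall>\<^sub>F t in at_right 0. lam j < (\<mu> + t *\<^sub>R v) \<bullet> X j" "\<forall>\<^sub>F t in at_right 0. lam j < (\<mu> - t *\<^sub>R v) \<bullet> X j"
        using less by (auto dest: order_tendstoD(1))
      then show ?thesis by eventually_elim auto
    qed
  qed
  moreover have "\<forall>\<^sub>F t in at_right (0 :: real). 0 < t" by (simp add: eventually_at_right_less)
  ultimately have "\<forall>\<^sub>F t in at_right 0. 0 < t \<and> \<mu> + t *\<^sub>R v \<in> \<Delta> \<and> \<mu> - t *\<^sub>R v \<in> \<Delta>"
    by eventually_elim (simp add: \<Delta>)
  then obtain t where t: "0 < t" "\<mu> + t *\<^sub>R v \<in> \<Delta>" "\<mu> - t *\<^sub>R v \<in> \<Delta>"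
    using eventually_happens[of _ "at_right (0 :: real)"] by auto
  have "\<mu> + t *\<^sub>R v \<noteq> \<mu> - t *\<^sub>R v"
  proof
    assume "\<mu> + t *\<^sub>R v = \<mu> - t *\<^sub>R v"
    then have "(2 * t) *\<^sub>R v = 0" by (simp add: algebra_simps scaleR_2[symmetric])
    then show False using t(1) v(1) by simp
  qed
  then have "midpoint (\<mu> + t *\<^sub>R v) (\<mu> - t *\<^sub>R v) \<in> open_segment (\<mu> + t *\<^sub>R v) (\<mu> - t *\<^sub>R v)" by simp
  moreover have "midpoint (\<mu> + t *\<^sub>R v) (\<mu> - t *\<^sub>R v) = \<mu>"
    by (simp add: midpoint_def scaleR_2[symmetric])
  ultimately show False using \<mu> t unfolding extreme_point_of_def by metis
qed

text \<open>A nonempty polytope has a vertex, and the normals active there already span.\<close>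

lemma surj_pi_map:
  fixes \<Delta> :: "'a::euclidean_space set" and X :: "'d::finite \<Rightarrow> 'a"
  assumes "polytope_normals \<Delta> X lam"
  shows "surj (pi_map X)"
proof -
  have P: "polytope \<Delta>" "aff_dim \<Delta> = int DIM('a)" using assms by (auto simp: polytope_normals_def)
  then have "\<Delta> \<noteq> {}" using aff_dim_empty by fastforce
  then obtain \<mu> where "\<mu> extreme_point_of \<Delta>"
    using extreme_point_exists_convex polytope_imp_compact polytope_imp_convex P(1) by metis
  from span_active_normals[OF assms this] have "span (range X) = UNIV"
    using span_mono[of "X ` active_indices X lam \<mu>" "range X"] by auto
  moreover have "span (range X) \<subseteq> range (pi_map X)"
  proof (rule span_minimal)
    show "subspace (range (pi_map X))"
      by (rule linear_subspace_image[OF linear_pi_map subspace_UNIV])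
    have "pi_map X (axis j 1) = X j" for j
      by (simp add: pi_map_def axis_def if_distrib[of "\<lambda>r. r *\<^sub>R _"] cong: if_cong)
    then show "range X \<subseteq> range (pi_map X)" by (metis image_subset_iff rangeI)
  qed
  ultimately show ?thesis by blast
qed

text \<open>The dimension of an open face is \<open>n\<close> minus the rank of its normals, so nonsingularity says
  that these normals are linearly independent.\<close>

lemma nonsingular_face_independent:
  fixes \<Delta> :: "'a::euclidean_space set" and X :: "'d::finite \<Rightarrow> 'a"
  assumes "polytope_normals \<Delta> X lam" and J: "nonsingular_face \<Delta> X lam J"
  shows "inj_on X J" "independent (X ` J)"
proof -
  have \<Delta>: "\<nu> \<in> \<Delta> \<longleftrightarrow> (\<forall>j. lam j \<le> \<nu> \<bullet> X j)" for \<nu>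
  proof -
    have "\<Delta> = (\<Inter>j. {\<mu>. \<mu> \<bullet> X j \<ge> lam j})" using assms(1) by (simp add: polytope_normals_def)
    then show ?thesis by blast
  qed
  \<comment> \<open>The open face is the affine subspace \<open>L\<close> of the equations cut by
    the open set \<open>N\<close> of strict inequalities; being nonempty, it has the dimension of
    \<open>L\<close>.\<close>
  define L where "L = {\<nu>. \<forall>j\<in>J. \<nu> \<bullet> X j = lam j}"
  define N where "N = (\<Inter>k\<in>- J. {\<nu>. lam k < \<nu> \<bullet> X k})"
  have F: "open_face \<Delta> X lam J = L \<inter> N"
  proof (intro equalityI subsetI)
    fix \<nu> assume "\<nu> \<in> open_face \<Delta> X lam J"
    then show "\<nu> \<in> L \<inter> N" by (auto simp: open_face_def L_def N_def \<Delta> order_less_le)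
  next
    fix \<nu> assume \<nu>: "\<nu> \<in> L \<inter> N"
    have "lam j \<le> \<nu> \<bullet> X j \<and> (\<nu> \<bullet> X j = lam j \<longleftrightarrow> j \<in> J)" for j
    proof (cases "j \<in> J")
      case False
      then have "lam j < \<nu> \<bullet> X j" using \<nu> by (simp add: N_def)
      then show ?thesis using False by simp
    qed (use \<nu> in \<open>simp add: L_def\<close>)
    then show "\<nu> \<in> open_face \<Delta> X lam J" by (simp add: open_face_def \<Delta>)
  qed
  have card: "int (card J) = int DIM('a) - aff_dim (L \<inter> N)" and ne: "L \<inter> N \<noteq> {}"
    using J unfolding nonsingular_face_def F by auto
  obtain \<nu> where \<nu>: "\<nu> \<in> L" using ne by blast
  \<comment> \<open>The direction space of \<open>L\<close>, written as the orthogonal complement of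
    the span of the normals in \<open>J\<close>.\<close>
  define V where "V = {y \<in> UNIV. \<forall>x\<in>span (X ` J). orthogonal x y}"
  have V: "y \<in> V \<longleftrightarrow> (\<forall>j\<in>J. y \<bullet> X j = 0)" for y
  proof
    assume "\<forall>j\<in>J. y \<bullet> X j = 0"
    then have "orthogonal y x" if "x \<in> span (X ` J)" for x
      using that orthogonal_to_span[of x "X ` J" y] by (auto simp: orthogonal_def)
    then show "y \<in> V" by (auto simp: V_def orthogonal_commute)
  next
    assume y: "y \<in> V"
    show "\<forall>j\<in>J. y \<bullet> X j = 0"
    proof
      fix j assume "j \<in> J"
      then have "X j \<in> span (X ` J)" by (intro span_base) simp
      then show "y \<bullet> X j = 0" using y by (auto simp: V_def orthogonal_def inner_commute)
    qed
  qed
  have subV: "subspace V" by (auto simp: subspace_def V inner_add_left)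
  have L: "L = (+) \<nu> ` V"
  proof (intro equalityI subsetI)
    fix y assume "y \<in> L"
    then have "y - \<nu> \<in> V" using \<nu> by (simp add: V L_def inner_diff_left)
    then show "y \<in> (+) \<nu> ` V" by (intro image_eqI[of _ _ "y - \<nu>"]) auto
  next
    fix y assume "y \<in> (+) \<nu> ` V"
    then show "y \<in> L" using \<nu> by (auto simp: V L_def inner_add_left)
  qed
  have "convex L" unfolding L by (intro convex_translation subspace_imp_convex subV)
  moreover have "open N"
    unfolding N_def by (intro open_INT ballI open_Collect_less continuous_intros) auto
  ultimately have "aff_dim (L \<inter> N) = aff_dim L" using ne by (rule aff_dim_convex_Int_open)
  also have "\<dots> = int (dim V)" unfolding L aff_dim_translation_eq by (rule aff_dim_subspace[OF subV])
  finally have "int (card J) = int DIM('a) - int (dim V)" using card by simp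
  moreover have "dim V + dim (span (X ` J)) = DIM('a)"
    using dim_subspace_orthogonal_to_vectors[OF subspace_span subspace_UNIV subset_UNIV, of "X ` J"]
    by (simp add: V_def)
  \<comment> \<open>The rank of the normals equals the number of their indices, which excludes both
    coincidences and linear relations.\<close>
  ultimately have dim: "dim (X ` J) = card J" by simp
  have "dim (X ` J) \<le> card (X ` J)" by (rule dim_le_card') simp
  moreover have "card (X ` J) \<le> card J" by (rule card_image_le) simp
  ultimately have eq: "card (X ` J) = card J" using dim by simp
  then show "inj_on X J" by (intro eq_card_imp_inj_on) auto
  show "independent (X ` J)"
    by (rule card_le_dim_spanning[of "X ` J" "X ` J"]) (auto simp: span_superset dim eq)
qed

text \<open>Any vertex of the closed face where the inequalities in \<open>J\<close> are equalities
  has \<open>J\<close> among its active indices, and the independent normals of \<open>J\<close>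
  extend to a basis of active ones. This supplies charts around every point of the regular level, as
  all vanishing coordinates then lie in \<open>I\<close>.\<close>

lemma nonsingular_face_vertex_basis:
  fixes \<Delta> :: "'a::euclidean_space set" and X :: "'d::finite \<Rightarrow> 'a"
  assumes PN: "polytope_normals \<Delta> X lam" and J: "nonsingular_face \<Delta> X lam J"
  obtains \<mu> I where "\<mu> extreme_point_of \<Delta>" "I \<in> vertex_bases X lam \<mu>" "J \<subseteq> I"
proof -
  have P: "polytope \<Delta>" using PN by (auto simp: polytope_normals_def)
  have ge: "lam j \<le> \<nu> \<bullet> X j" if "\<nu> \<in> \<Delta>" for \<nu> j
  proof -
    have "\<Delta> = (\<Inter>j. {\<mu>. \<mu> \<bullet> X j \<ge> lam j})" using PN by (simp add: polytope_normals_def)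
    then show ?thesis using that by blast
  qed
  define G where "G = \<Delta> \<inter> {\<nu>. \<forall>j\<in>J. \<nu> \<bullet> X j = lam j}"
  have "\<Delta> \<inter> {\<nu>. \<forall>j\<in>B. \<nu> \<bullet> X j = lam j} face_of \<Delta>" for B :: "'d set"
  proof -
    have "finite B" by simp
    then show ?thesis
    proof (induction B rule: finite_induct)
      case empty
      then show ?case using face_of_refl polytope_imp_convex[OF P] by simp
    next
      case (insert j B)
      have "\<Delta> \<inter> {\<nu>. X j \<bullet> \<nu> = lam j} face_of \<Delta>"
        using face_of_Int_supporting_hyperplane_ge[OF polytope_imp_convex[OF P], where a = "X j" and b = "lam j"] ge
        by (simp add: inner_commute)
      from face_of_Int[OF this insert.IH]
      have "\<Delta> \<inter> {\<nu>. X j \<bullet> \<nu> = lam j} \<inter> (\<Delta> \<inter> {\<nu>. \<forall>j\<in>B. \<nu> \<bullet> X j = lam j}) face_of \<Delta>" .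
      moreover have "\<Delta> \<inter> {\<nu>. X j \<bullet> \<nu> = lam j} \<inter> (\<Delta> \<inter> {\<nu>. \<forall>j\<in>B. \<nu> \<bullet> X j = lam j})
          = \<Delta> \<inter> {\<nu>. \<forall>j\<in>insert j B. \<nu> \<bullet> X j = lam j}"
        by (auto simp: inner_commute)
      ultimately show ?case by simp
    qed
  qed
  then have G: "G face_of \<Delta>" unfolding G_def .
  have "open_face \<Delta> X lam J \<noteq> {}" using J by (simp add: nonsingular_face_def)
  then have "G \<noteq> {}" by (auto simp: G_def open_face_def)
  moreover have "compact G" "convex G"
    using face_of_imp_compact[OF _ _ G] face_of_imp_convex[OF G] polytope_imp_compact[OF P] polytope_imp_convex[OF P]
    by auto
  ultimately obtain \<mu> where "\<mu> extreme_point_of G" using extreme_point_exists_convex by metis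
  then have \<mu>: "\<mu> extreme_point_of \<Delta>" "\<mu> \<in> G" using extreme_point_of_face[OF G] by auto
  let ?A = "active_indices X lam \<mu>"
  have JA: "J \<subseteq> ?A" using \<mu>(2) by (auto simp: G_def active_indices_def)
  \<comment> \<open>Index sets rather than sets of vectors are maximised, so that injectivity of
    \<open>X\<close> on them is part of the choice.\<close>
  let ?\<C> = "{I. J \<subseteq> I \<and> I \<subseteq> ?A \<and> inj_on X I \<and> independent (X ` I)}"
  have "finite ?\<C>" by simp
  moreover have "J \<in> ?\<C>" using JA nonsingular_face_independent[OF PN J] by simp
  ultimately have "\<exists>I\<in>?\<C>. J \<subseteq> I \<and> (\<forall>I'\<in>?\<C>. I \<subseteq> I' \<longrightarrow> I = I')"
    by (rule finite_has_maximal2)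
  then obtain I where I: "I \<in> ?\<C>" "\<forall>I'\<in>?\<C>. I \<subseteq> I' \<longrightarrow> I = I'"
    by (elim bexE conjE)
  have "X k \<in> span (X ` I)" if k: "k \<in> ?A" for k
  proof (rule ccontr)
    assume nk: "X k \<notin> span (X ` I)"
    have kI: "X k \<notin> X ` I" by (rule contra_subsetD[OF span_superset nk])
    have "independent (insert (X k) (X ` I))"
      using I(1) nk by (intro independent_insertI) simp_all
    moreover have "inj_on X (insert k I)" using I(1) kI by auto
    ultimately have "insert k I \<in> ?\<C>" using I(1) k by auto
    from bspec[OF I(2) this] have "I = insert k I" by (simp add: subset_insertI)
    then show False using kI by blast
  qed
  then have "span (X ` ?A) \<subseteq> span (X ` I)"
    by (intro span_minimal) auto
  then have "span (X ` I) = UNIV" using span_active_normals[OF PN \<mu>(1)] by blast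
  then have "I \<in> vertex_bases X lam \<mu>" using I(1) by (simp add: vertex_bases_def)
  then show ?thesis using that \<mu>(1) I(1) by blast
qed

section \<open>Lifting to the universal covers of the charts\<close>

lemma smooth_universal_cover_local_inverse:
  assumes "smooth_universal_cover W c U" "w \<in> W"
  obtains B h where "openin (top_of_set W) B" "w \<in> B" "openin (top_of_set U) (c ` B)"
    "smooth_on B c" "smooth_on (c ` B) h" "\<And>y. y \<in> B \<Longrightarrow> h (c y) = y"
proof -
  obtain B where B: "openin (top_of_set W) B" "w \<in> B" "openin (top_of_set U) (c ` B)" "diffeo B (c ` B) c"
    using assms unfolding smooth_universal_cover_def by blast
  then have "inj_on c B" unfolding diffeo_def bij_betw_def by blast
  then have "inv_into B c (c y) = y" if "y \<in> B" for y using that by simp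
  then show ?thesis using that[of B "inv_into B c"] B unfolding diffeo_def by blast
qed

lemma smooth_universal_cover_smooth_on:
  assumes "smooth_universal_cover W c U"
  shows "smooth_on W c"
proof (rule smooth_on_local)
  fix w assume "w \<in> W"
  from smooth_universal_cover_local_inverse[OF assms this]
  show "\<exists>V. openin (top_of_set W) V \<and> w \<in> V \<and> smooth_on V c" by metis
qed

text \<open>Near each point the lift is \<open>f\<close> followed by a smooth local inverse of
  \<open>c\<close>; continuity of \<open>g\<close> keeps it in the range of that one
  inverse.\<close>

lemma smooth_universal_cover_lift_smooth_on:
  fixes f :: "'b::euclidean_space \<Rightarrow> 'e::euclidean_space"
  assumes cov: "smooth_universal_cover W c U" and f: "smooth_on V f"
    and g: "continuous_on V g" "g ` V \<subseteq> W" "\<And>y. y \<in> V \<Longrightarrow> c (g y) = f y"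
  shows "smooth_on V g"
proof (rule smooth_on_local)
  fix y assume y: "y \<in> V"
  then have "g y \<in> W" using g(2) by blast
  from smooth_universal_cover_local_inverse[OF cov this]
  obtain B h where B: "openin (top_of_set W) B" "g y \<in> B" "smooth_on (c ` B) h" "\<And>y. y \<in> B \<Longrightarrow> h (c y) = y"
    by metis
  let ?V = "V \<inter> g -` B"
  have "openin (top_of_set V) ?V"
    using g(2) by (intro continuous_openin_preimage[OF g(1) _ B(1)]) auto
  moreover have "smooth_on ?V (\<lambda>z. h (f z))"
  proof (rule smooth_on_compose[OF smooth_on_subset[OF f] B(3)])
    show "f ` ?V \<subseteq> c ` B" using g(3) by (auto intro!: image_eqI)
  qed auto
  then have "smooth_on ?V g"
    by (rule smooth_on_cong) (use g(3) B(4) in \<open>metis IntE vimageE\<close>)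
  ultimately show "\<exists>V'. openin (top_of_set V) V' \<and> y \<in> V' \<and> smooth_on V' g"
    using y B(2) by (intro exI[of _ ?V]) auto
qed

text \<open>The section passes to the cover by composition with \<open>c\<close>, the lift of the
  projection by a local inverse of \<open>c\<close>. The action needs a global lift, which exists
  because \<dd> times the simply connected \<open>W\<close> is simply connected.\<close>

lemma cover_chart_good:
  fixes X :: "'d::finite \<Rightarrow> 'a::euclidean_space"
  assumes Q: "quasilattice Q" and I: "I \<in> vertex_bases X lam \<mu>"
    and K: "open K" "\<And>u z. z \<in> K \<Longrightarrow> cmod u = 1 \<Longrightarrow> u * z \<in> K"
    and S: "S \<subseteq> Psi_zero X lam" "\<And>z j. z \<in> S \<Longrightarrow> j \<in> J \<Longrightarrow> z $ j = 0"
    and S_inv: "\<And>x z. z \<in> S \<Longrightarrow> tmul (texp x) z \<in> S"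
    and atl: "atlas (piece_top X lam Q S) k \<A>" and mem: "cover_chart W c b \<in> \<A>"
    and cov: "smooth_universal_cover W c (model_dom X lam \<mu> I J K)"
    and b: "\<And>w. cmap b w = N_orbit X Q (model_section X lam \<mu> I J w)"
    and z: "z \<in> S" "\<And>k. k \<notin> I \<union> J \<Longrightarrow> z $ k \<noteq> 0" "\<And>h. h \<in> I - J \<Longrightarrow> z $ h \<in> K"
  shows "\<exists>a\<in>\<A>. (\<exists>\<sigma>. smooth_section X Q S a \<sigma>) \<and> (\<exists>L. lifted_action X Q a L) \<and> local_lift X Q S a z"
proof (intro bexI[OF _ mem] conjI)
  let ?U = "model_dom X lam \<mu> I J K" and ?\<psi> = "model_section X lam \<mu> I J" and ?a = "cover_chart W c b"
  have cdom: "cdom ?a = W" and cmap: "cmap ?a w = N_orbit X Q (?\<psi> (c w))" for w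
    by (simp_all add: cover_chart_def b)
  have W: "W \<noteq> {}" "openin (top_of_set (span W)) W" "connected W" "simply_connected W" "covering_space W c ?U"
    using cov unfolding smooth_universal_cover_def by auto
  have cW: "c ` W = ?U" using W(5) by (rule covering_space_imp_surjective)
  have smc: "smooth_on W c" by (rule smooth_universal_cover_smooth_on[OF cov])
  \<comment> \<open>No computation: the chart belongs to the atlas, so its image lies in the piece.
    The orbit of the section value is thus the orbit of a point of \<open>S\<close>, and
    \<open>S\<close> is invariant under the torus.\<close>
  have \<psi>S: "?\<psi> (c w) \<in> S" if "w \<in> W" for w
  proof -
    have "cmap ?a w \<in> cim ?a" using that by (simp add: cim_def cdom)
    then have "cmap ?a w \<in> N_orbit X Q ` S"
      using atl mem topspace_piece_top[OF S(1), of Q] unfolding atlas_def by blast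
    then obtain z' where z': "z' \<in> S" "N_orbit X Q z' = N_orbit X Q (?\<psi> (c w))"
      unfolding cmap by blast
    obtain x where "?\<psi> (c w) = tmul (texp x) z'" using N_orbit_eqD[OF Q z'(2)] by blast
    then show ?thesis using S_inv z'(1) by simp
  qed
  show "\<exists>\<sigma>. smooth_section X Q S ?a \<sigma>"
  proof (intro exI[of _ "\<lambda>w. ?\<psi> (c w)"])
    have "smooth_on W (\<lambda>w. ?\<psi> (c w))"
      by (rule smooth_on_compose[OF smc smooth_on_model_section[of X lam \<mu> I J K]]) (simp add: cW)
    then show "smooth_section X Q S ?a (\<lambda>w. ?\<psi> (c w))"
      using \<psi>S by (simp add: smooth_section_def cdom cmap)
  qed
  show "\<exists>L. lifted_action X Q ?a L"
  proof -
    let ?s = "base_section X I"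
    \<comment> \<open>The torus action downstairs, composed with \<open>c\<close>; its lift through
      the covering \<open>c\<close> is the required \<open>L\<close>.\<close>
    define f where "f p = tmul (texp (?s (fst p))) (c (snd p))" for p :: "'a \<times> (complex ^ 'd)"
    have sms: "smooth_on B (\<lambda>p :: 'a \<times> (complex ^ 'd). ?s (fst p))" for B
      using linear_base_section[OF I] unfolding linear_conv_bounded_linear
      by (rule smooth_on_bounded_linear_compose[OF _ smooth_on_linear[OF bounded_linear_fst]])
    have "smooth_on (UNIV \<times> W) (\<lambda>p :: 'a \<times> (complex ^ 'd). c (snd p))"
      by (rule smooth_on_compose[OF smooth_on_linear[OF bounded_linear_snd] smc]) auto
    then have smf: "smooth_on (UNIV \<times> W) f"
      unfolding f_def[abs_def] by (rule smooth_on_tmul_texp[OF sms])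
    have fU: "f p \<in> ?U" if "p \<in> UNIV \<times> W" for p
    proof -
      have "c (snd p) \<in> ?U" using that cW by auto
      then show ?thesis unfolding f_def by (intro model_dom_tmul K(2))
    qed
    obtain w0 where w0: "w0 \<in> W" using W(1) by blast
    have lpc: "locally path_connected (UNIV \<times> W :: ('a \<times> (complex ^ 'd)) set)"
      by (rule locally_Times[OF locally_path_connected_UNIV locally_path_connected_open_in_span[OF W(2)]])
        (simp add: path_connected_Times)
    have f0: "f (0, w) = c w" for w
      by (simp add: f_def linear_0[OF linear_base_section[OF I]])
    obtain L where L: "continuous_on (UNIV \<times> W) L" "L \<in> UNIV \<times> W \<rightarrow> W" "L (0, w0) = w0"
      "\<And>p. p \<in> UNIV \<times> W \<Longrightarrow> c (L p) = f p"
    proof (rule covering_space_lift_strong[OF W(5) w0, of "(0, w0)" "UNIV \<times> W" f])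
      show "(0, w0) \<in> UNIV \<times> W" using w0 by simp
      show "simply_connected (UNIV \<times> W :: ('a \<times> (complex ^ 'd)) set)"
        by (intro simply_connected_Times W(4) convex_imp_simply_connected convex_UNIV)
      show "f \<in> UNIV \<times> W \<rightarrow> ?U" using fU by blast
    qed (use lpc smooth_on_imp_continuous_on[OF smf] f0 in auto)
    have "smooth_on (UNIV \<times> W) L"
      by (rule smooth_universal_cover_lift_smooth_on[OF cov smf L(1)]) (use L(2,4) in auto)
    \<comment> \<open>\<open>L (0, _)\<close> and the identity both lift \<open>c\<close> and agree
      at \<open>w0\<close>, where the lift was normalised; \<open>W\<close> is connected, so they
      coincide.\<close>
    moreover have "L (0, w) = w" if w: "w \<in> W" for w
    proof (rule covering_space_lift_unique[OF W(5), of "\<lambda>w. L (0, w)" w0 "\<lambda>w. w" W c])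
      show "continuous_on W (\<lambda>w. L (0, w))"
        by (rule continuous_on_compose2[OF L(1)]) (auto intro!: continuous_intros)
      show "c \<in> W \<rightarrow> ?U" using cW by blast
    qed (use L w w0 W(3) f0 smooth_on_imp_continuous_on[OF smc] in auto)
    moreover have "cmap ?a (L (Y, w)) = D_act X (qclass Q Y) (cmap ?a w)" if "w \<in> W" for Y w
    proof -
      have "cmap ?a (L (Y, w)) = N_orbit X Q (tmul (texp (?s Y)) (?\<psi> (c w)))"
        using L(4)[of "(Y, w)"] that by (simp add: cmap f_def model_section_tmul)
      also have "\<dots> = D_act X (qclass Q (pi_map X (?s Y))) (N_orbit X Q (?\<psi> (c w)))"
        by (rule D_act_N_orbit[OF Q, symmetric])
      finally show ?thesis by (simp add: pi_map_base_section[OF I] cmap)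
    qed
    ultimately have "lifted_action X Q ?a L"
      using L(2) unfolding lifted_action_def cdom by auto
    then show ?thesis by blast
  qed
  show "local_lift X Q S ?a z"
  proof -
    have "\<exists>V P. openin (top_of_set S) V \<and> z \<in> V \<and> smooth_on V P \<and> P ` V \<subseteq> ?U \<and>
        (\<forall>y\<in>V. N_orbit X Q (?\<psi> (P y)) = N_orbit X Q y)"
      by (rule model_local_lift[OF Q I K(1) _ S(1) _ z(1)]) (fact K(2) S(2) z(2) z(3))+
    then obtain V P where V: "openin (top_of_set S) V" "z \<in> V" "smooth_on V P" "P ` V \<subseteq> ?U"
      "\<forall>y\<in>V. N_orbit X Q (?\<psi> (P y)) = N_orbit X Q y"
      by (elim exE conjE)
    then have "P z \<in> c ` W" using cW by blast
    \<comment> \<open>The point over \<open>P z\<close> selects the local inverse \<open>h\<close>;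
      shrinking \<open>V\<close> keeps \<open>P\<close> in its domain.\<close>
    then obtain w where w: "w \<in> W" "P z = c w" by blast
    obtain B h where B: "openin (top_of_set W) B" "w \<in> B" "openin (top_of_set ?U) (c ` B)"
      "smooth_on (c ` B) h" "\<And>y. y \<in> B \<Longrightarrow> h (c y) = y"
      using smooth_universal_cover_local_inverse[OF cov w(1)] by metis
    let ?V = "V \<inter> P -` (c ` B)"
    have "openin (top_of_set V) ?V"
      using V(4) by (intro continuous_openin_preimage[OF smooth_on_imp_continuous_on[OF V(3)] _ B(3)]) auto
    then have "openin (top_of_set S) ?V" using V(1) openin_trans by blast
    moreover have "smooth_on ?V (\<lambda>y. h (P y))"
      by (rule smooth_on_compose[OF smooth_on_subset[OF V(3)] B(4)]) auto
    moreover have "z \<in> ?V" using V(2) w(2) B(2) by auto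
    moreover have "h (P y) \<in> W \<and> c (h (P y)) = P y" if "y \<in> ?V" for y
      using that B(5) openin_imp_subset[OF B(1)] by auto
    ultimately show ?thesis
      unfolding local_lift_def cdom cmap using V(5)
      by (intro exI[of _ ?V] exI[of _ "\<lambda>y. h (P y)"]) auto
  qed
qed

lemma coord_set_tmul:
  assumes "z \<in> coord_set (- {0}) J"
  shows "tmul (texp x) z \<in> coord_set (- {0}) J"
proof -
  have "texp x $ j \<noteq> 0" for j using norm_texp[of x j] by (metis norm_zero zero_neq_one)
  then show ?thesis using assms by (auto simp: coord_set_def split: if_splits)
qed

theorem theorem5p11:
  fixes \<Delta> :: "'a::euclidean_space set"
    and X :: "'d::finite \<Rightarrow> 'a"
    and lam :: "'d \<Rightarrow> real"
    and Q :: "'a set"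
  assumes "polytope_normals \<Delta> X lam"
    and "quasilattice Q"
    and "range X \<subseteq> Q"
  shows "(\<forall>\<A> \<omega>. regular_structure \<Delta> X lam Q \<A> \<omega> \<longrightarrow>
            (let T = piece_top X lam Q (regular_level \<Delta> X lam) in
               smooth_quasitorus_action Q T \<A> (D_act X) \<and>
               quasifold_smooth T \<A> euclidean {vector_space_chart} (Phi X lam) \<and>
               hamiltonian_action Q T \<A> \<omega> (D_act X) (Phi X lam))) \<and>
         (\<forall>J \<A> \<omega>. singular_face \<Delta> X lam J \<and> singular_structure \<Delta> X lam Q J \<A> \<omega> \<longrightarrow>
            (let T = piece_top X lam Q (singular_level X lam J) in
               smooth_quasitorus_action Q T \<A> (D_act X) \<and>
               quasifold_smooth T \<A> euclidean {vector_space_chart} (Phi X lam) \<and>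
               hamiltonian_action Q T \<A> \<omega> (D_act X) (Phi X lam)))"
proof (intro conjI allI impI, goal_cases)
  case (1 \<A> \<omega>)
  let ?S = "regular_level \<Delta> X lam"
  have S: "?S \<subseteq> Psi_zero X lam" by (auto simp: regular_level_def)
  have S_inv: "tmul (texp x) z \<in> ?S" if "z \<in> ?S" for x z
    using that coord_set_tmul unfolding regular_level_def by fastforce
  have atl: "atlas (piece_top X lam Q ?S) (2 * DIM('a)) \<A>"
    using 1 by (simp add: regular_structure_def quasifold_def)
  interpret quasifold_piece X lam Q ?S "2 * DIM('a)" \<A> \<omega>
  proof
    show "\<exists>a\<in>\<A>. (\<exists>\<sigma>. smooth_section X Q ?S a \<sigma>) \<and> (\<exists>L. lifted_action X Q a L) \<and> local_lift X Q ?S a z"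
      if z: "z \<in> ?S" for z
    proof -
      obtain J where J: "nonsingular_face \<Delta> X lam J" "z \<in> coord_set (- {0}) (- J)"
        using z by (auto simp: regular_level_def)
      obtain \<mu> I where \<mu>: "\<mu> extreme_point_of \<Delta>" and I: "I \<in> vertex_bases X lam \<mu>" "J \<subseteq> I"
        using nonsingular_face_vertex_basis[OF assms(1) J(1)] by blast
      obtain W c where W: "smooth_universal_cover W c (regular_dom X lam \<mu> I)"
        "cover_chart W c (regular_base_chart X lam Q \<mu> I) \<in> \<A>"
        using 1 \<mu> I(1) unfolding regular_structure_def by blast
      show ?thesis
      proof (rule cover_chart_good[OF assms(2) I(1) _ _ S _ S_inv atl W(2) W(1)[unfolded regular_dom_eq]
            cmap_regular_base_chart z])
        \<comment> \<open>The coordinates of \<open>z\<close> vanish exactly on the index set of its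
          face, and \<open>I\<close> was chosen to contain that set.\<close>
        show "z $ k \<noteq> 0" if "k \<notin> I \<union> {}" for k
          using J(2) that I(2) by (auto simp: coord_set_def split: if_splits)
      qed auto
    qed
  qed (use 1 assms surj_pi_map[OF assms(1)] S S_inv atl in \<open>auto simp: regular_structure_def symplectic_form_def\<close>)
  show ?case
    unfolding Let_def
    by (intro conjI smooth_quasitorus_action_D_act quasifold_smooth_Phi hamiltonian_action_D_act)
next
  case (2 J \<A> \<omega>)
  let ?S = "singular_level X lam J"
  have S: "?S \<subseteq> Psi_zero X lam" by (auto simp: singular_level_def)
  have S_inv: "tmul (texp x) z \<in> ?S" if "z \<in> ?S" for x z
    using that coord_set_tmul unfolding singular_level_def by fastforce
  have zeros: "z $ j = 0 \<longleftrightarrow> j \<in> J" if "z \<in> ?S" for z j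
    using that by (auto simp: singular_level_def coord_set_def split: if_splits)
  let ?k = "2 * nat (aff_dim (open_face \<Delta> X lam J))"
  have atl: "atlas (piece_top X lam Q ?S) ?k \<A>"
    using 2 by (simp add: singular_structure_def quasifold_def)
  \<comment> \<open>One chart serves all of \<open>?S\<close>: its points vanish exactly at the
    indices in \<open>J\<close>, so the coordinate conditions of \<open>cover_chart_good\<close>
    hold at every \<open>z\<close>.\<close>
  obtain \<mu> I W c where I: "I \<in> vertex_bases X lam \<mu>"
    and W: "smooth_universal_cover W c (singular_dom X lam \<mu> I J)"
      "cover_chart W c (singular_base_chart X lam Q \<mu> I J) \<in> \<A>"
    using 2 unfolding singular_structure_def by blast
  interpret quasifold_piece X lam Q ?S ?k \<A> \<omega>
  proof
    show "\<exists>a\<in>\<A>. (\<exists>\<sigma>. smooth_section X Q ?S a \<sigma>) \<and> (\<exists>L. lifted_action X Q a L) \<and> local_lift X Q ?S a z"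
      if z: "z \<in> ?S" for z
      by (rule cover_chart_good[OF assms(2) I _ _ S _ S_inv atl W(2) W(1)[unfolded singular_dom_eq]
            cmap_singular_base_chart z]) (use zeros z in \<open>auto simp: open_Compl\<close>)
  qed (use 2 assms surj_pi_map[OF assms(1)] S S_inv atl in \<open>auto simp: singular_structure_def symplectic_form_def\<close>)
  show ?case
    unfolding Let_def
    by (intro conjI smooth_quasitorus_action_D_act quasifold_smooth_Phi hamiltonian_action_D_act)
qed

end
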